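(* Suppose $\alpha>-1$ and $\varphi\in H^\infty_1$, i.e. $\varphi$ is an analytic function on the unit disk $\mathbb{D}$ with $\sup_{z\in\mathbb{D}}|\varphi(z)|\le1$. Then the following conditions are equivalent. (a) The defect operator $D^\alpha_{\overline\varphi}=(I-T_\varphi^*T_\varphi)^{1/2}$ is compact on $A^2_\alpha$. (b) The function $\varphi$ is a finite Blaschke product. (c) The space $H^\alpha(\overline\varphi)$ equals $A^2_{\alpha-1}$. (d) The space $H^\alpha(\overline\varphi)$ is contained in $A^2_{\alpha-1}$.
   Context: For any real $\gamma$, $A^2_\gamma$ denotes the space of analytic functions $f$ on $\mathbb{D}$ such that $\int_{\mathbb{D}}(1-|z|^2)^{2k+\gamma}|f^{(k)}(z)|^2\,dA(z)<\infty$, where $k$ is any non-negative integer with $2k+\gamma>-1$ (the space does not depend on the choice of $k$) and $dA$ is normalized area measure on $\mathbb{D}$. For $\alpha>-1$, $A^2_\alpha$ is the weighted Bergman space with the inner product of $L^2(\mathbb{D},dA_\alpha)$, where $dA_\alpha(z)=(\alpha+1)(1-|z|^2)^\alpha\,dA(z)$. $T_\varphi$ is multiplication by $\varphi$ on $A^2_\alpha$ (a contraction) and $T_\varphi^*$ is its adjoint on $A^2_\alpha$. $H^\alpha(\overline\varphi)$ is the range of $(I-T_\varphi^*T_\varphi)^{1/2}$ on $A^2_\alpha$. A finite Blaschke product is a unimodular constant times a finite product of Möbius maps $\frac{a-z}{1-\overline{a}z}$, $a\in\mathbb{D}$.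
   Formalization: Condition (c) is claimed equivalent to the others only when φ is not a unimodular constant; for a unimodular constant the defect operator is zero, so (a) and (d) hold but (c) fails. Constants count as finite Blaschke products, and (a), (b), (d) are equivalent for every φ. *)

theory Defs
  imports "HOL-Complex_Analysis.Complex_Analysis"
begin

abbreviation disc :: "complex set" where
  "disc \<equiv> ball 0 1"

text \<open>Functions on the disc are represented by functions on the whole plane that vanish
  outside the disc, so that equality of such functions is equality on the disc.\<close>

definition analytic_disc :: "(complex \<Rightarrow> complex) set" where
  "analytic_disc = {f. f holomorphic_on disc \<and> (\<forall>z. z \<notin> disc \<longrightarrow> f z = 0)}"

text \<open>The area of the disc is \<open>pi\<close>, so this is Lebesgue measure on the disc divided by \<open>pi\<close>.\<close>

definition dA :: "complex measure" where
  "dA = uniform_measure lborel disc"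

definition dA_weighted :: "real \<Rightarrow> complex measure" where
  "dA_weighted \<alpha> = density dA (\<lambda>z. ennreal ((\<alpha> + 1) * (1 - (cmod z)\<^sup>2) powr \<alpha>))"

text \<open>The space \<open>A\<^sup>2\<^sub>\<gamma>\<close>, defined through the derivative of order \<open>k\<close>. It is meant for
  \<open>2 k + \<gamma> > - 1\<close>, and then it does not depend on \<open>k\<close>; the order is kept as a parameter so that
  nothing relies on this fact. For \<open>\<gamma> > - 1\<close> and \<open>k = 0\<close> this is the weighted Bergman space.\<close>

definition A2 :: "nat \<Rightarrow> real \<Rightarrow> (complex \<Rightarrow> complex) set" where
  "A2 k \<gamma> = {f \<in> analytic_disc.
     integrable dA (\<lambda>z. (1 - (cmod z)\<^sup>2) powr (2 * real k + \<gamma>) * (cmod ((deriv ^^ k) f z))\<^sup>2)}"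

abbreviation bergman :: "real \<Rightarrow> (complex \<Rightarrow> complex) set" where
  "bergman \<alpha> \<equiv> A2 0 \<alpha>"

definition bergman_inner :: "real \<Rightarrow> (complex \<Rightarrow> complex) \<Rightarrow> (complex \<Rightarrow> complex) \<Rightarrow> complex" where
  "bergman_inner \<alpha> f g = (LINT z|dA_weighted \<alpha>. f z * cnj (g z))"

definition bergman_norm :: "real \<Rightarrow> (complex \<Rightarrow> complex) \<Rightarrow> real" where
  "bergman_norm \<alpha> f = sqrt (Re (bergman_inner \<alpha> f f))"

definition bergman_dist :: "real \<Rightarrow> (complex \<Rightarrow> complex) \<Rightarrow> (complex \<Rightarrow> complex) \<Rightarrow> real" where
  "bergman_dist \<alpha> f g = bergman_norm \<alpha> (\<lambda>z. f z - g z)"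

definition bergman_topology :: "real \<Rightarrow> (complex \<Rightarrow> complex) topology" where
  "bergman_topology \<alpha> = Metric_space.mtopology (bergman \<alpha>) (bergman_dist \<alpha>)"

type_synonym operator = "(complex \<Rightarrow> complex) \<Rightarrow> (complex \<Rightarrow> complex)"

definition bounded_operator :: "real \<Rightarrow> operator \<Rightarrow> bool" where
  "bounded_operator \<alpha> S \<longleftrightarrow>
     S \<in> bergman \<alpha> \<rightarrow> bergman \<alpha> \<and>
     (\<forall>f\<in>bergman \<alpha>. \<forall>g\<in>bergman \<alpha>. S (\<lambda>z. f z + g z) = (\<lambda>z. S f z + S g z)) \<and>
     (\<forall>c. \<forall>f\<in>bergman \<alpha>. S (\<lambda>z. c * f z) = (\<lambda>z. c * S f z)) \<and>
     (\<exists>C. \<forall>f\<in>bergman \<alpha>. bergman_norm \<alpha> (S f) \<le> C * bergman_norm \<alpha> f)"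

definition positive_operator :: "real \<Rightarrow> operator \<Rightarrow> bool" where
  "positive_operator \<alpha> S \<longleftrightarrow>
     bounded_operator \<alpha> S \<and> (\<forall>f\<in>bergman \<alpha>. bergman_inner \<alpha> (S f) f \<in> \<real>\<^sub>\<ge>\<^sub>0)"

definition compact_operator :: "real \<Rightarrow> operator \<Rightarrow> bool" where
  "compact_operator \<alpha> S \<longleftrightarrow>
     bounded_operator \<alpha> S \<and>
     compactin (bergman_topology \<alpha>)
       (bergman_topology \<alpha> closure_of (S ` {f \<in> bergman \<alpha>. bergman_norm \<alpha> f \<le> 1}))"

definition adjoint_operator :: "real \<Rightarrow> operator \<Rightarrow> operator" where
  "adjoint_operator \<alpha> S g =
     (THE h. h \<in> bergman \<alpha> \<and>
        (\<forall>f\<in>bergman \<alpha>. bergman_inner \<alpha> (S f) g = bergman_inner \<alpha> f h))"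

text \<open>An operator is only relevant on the Bergman space; requiring it to be extensional
  (undefined elsewhere) makes the positive square root unique as a function.\<close>

definition sqrt_operator :: "real \<Rightarrow> operator \<Rightarrow> operator" where
  "sqrt_operator \<alpha> P =
     (THE S. S \<in> extensional (bergman \<alpha>) \<and> positive_operator \<alpha> S \<and>
        (\<forall>f\<in>bergman \<alpha>. S (S f) = P f))"

definition mult_operator :: "(complex \<Rightarrow> complex) \<Rightarrow> operator" where
  "mult_operator \<phi> f = (\<lambda>z. \<phi> z * f z)"

definition defect_operator :: "real \<Rightarrow> (complex \<Rightarrow> complex) \<Rightarrow> operator" where
  "defect_operator \<alpha> \<phi> =
     sqrt_operator \<alpha>
       (\<lambda>f z. f z - adjoint_operator \<alpha> (mult_operator \<phi>) (mult_operator \<phi> f) z)"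

definition sub_bergman :: "real \<Rightarrow> (complex \<Rightarrow> complex) \<Rightarrow> (complex \<Rightarrow> complex) set" where
  "sub_bergman \<alpha> \<phi> = defect_operator \<alpha> \<phi> ` bergman \<alpha>"

text \<open>Below, only the values of \<open>\<phi>\<close> on the disc matter.\<close>

definition Hinf_ball :: "(complex \<Rightarrow> complex) set" where
  "Hinf_ball = {\<phi>. \<phi> holomorphic_on disc \<and> (\<forall>z\<in>disc. cmod (\<phi> z) \<le> 1)}"

definition finite_blaschke :: "(complex \<Rightarrow> complex) \<Rightarrow> bool" where
  "finite_blaschke \<phi> \<longleftrightarrow>
     (\<exists>c as. cmod c = 1 \<and> set as \<subseteq> disc \<and>
        (\<forall>z\<in>disc. \<phi> z = c * (\<Prod>a\<leftarrow>as. (a - z) / (1 - cnj a * z))))"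

text \<open>The empty list of zeros gives the unimodular constants. For these the defect operator and its
  range are zero, so the range is contained in every space \<open>A2 k \<gamma>\<close> without being equal to it.\<close>

definition unimodular_constant :: "(complex \<Rightarrow> complex) \<Rightarrow> bool" where
  "unimodular_constant \<phi> \<longleftrightarrow> (\<exists>c. cmod c = 1 \<and> (\<forall>z\<in>disc. \<phi> z = c))"

end

(*
  Taylor coefficients, suitably weighted, identify the weighted Bergman space isometrically with l^2, and
  by Parseval on the disc they identify A2 k (alpha - 1) with the sequences x such that the sum of
  (n + 1) |x n|^2 is finite. The defect operator D satisfies
  |D f|^2 = integral of (1 - |phi|^2) |f|^2, to be compared with the integral of (1 - |z|^2) |f|^2,
  which is equivalent to the sum of |x n|^2 / (n + 1).

  If phi is a finite Blaschke product, 1 - |phi|^2 is at most C (1 - |z|^2); by duality D maps l^2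
  boundedly into the weighted space, which is compactly embedded, so D is compact. If phi is not
  constant, the reverse inequality holds as well, and the range of D is the whole weighted space
  (Douglas' lemma). Conversely, if the range of D lies in the weighted space, uniform boundedness makes
  D bounded into it, hence compact. Finally, if D is compact, then D k_a -> 0 for the normalised kernels
  k_a as |a| -> 1, and |D k_a|^2 is at least c (1 - |phi a|^2); so |phi| -> 1 at the boundary, and dividing
  out the zeros shows that phi is a finite Blaschke product.
*)
theory Submission imports Defs begin

section \<open>Square roots and bounded operators on Hilbert spaces\<close>


text \<open>\<open>adjoint_operator\<close> and \<open>sqrt_operator\<close> are definite
  descriptions, so before any estimate both must be shown to denote: the Gram operator of
  multiplication comes from Riesz representation, a positive root of its defect from an operator
  iteration, and uniqueness from the fact that a competing root commutes with the constructed one.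
  The root D has no usable formula; it enters only through its symmetry and the form |D x|^2, which
  is why its range is reached by duality. The Hilbert space is a type with a real inner product.
  Complex linearity is carried by \<open>ell2_scale\<close>, and the imaginary part of the complex
  inner product is the real one after multiplying the second argument by \<open>\<i>\<close>. The
  lower bound for |D k_a|^2 is local: on the disc of radius (1 - |a|) / 2 around a, the weighted
  density |k_a|^2 is at least a constant times (1 - |a|)^(-2), the reciprocal of the area scale, and
  the mean of 1 - |phi|^2 over that disc is at least half its value at a.\<close>

lemma quadratic_nonneg_imp_linear_coeff_zero:
  fixes p q :: real
  assumes "\<And>t. 2 * t * q + t\<^sup>2 * p \<ge> 0" and "p \<ge> 0"
  shows "q = 0"
proof (rule ccontr)
  assume "q \<noteq> 0"
  have "2 * (- q / (p + 1)) * q + (- q / (p + 1))\<^sup>2 * p = - (q\<^sup>2 * (p + 2)) / (p + 1)\<^sup>2"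
    using assms(2) by (simp add: power2_eq_square divide_simps) (simp add: algebra_simps)
  moreover have "q\<^sup>2 * (p + 2) / (p + 1)\<^sup>2 > 0"
    using \<open>q \<noteq> 0\<close> assms(2) by (auto intro!: divide_pos_pos mult_pos_pos)
  ultimately show False using assms(1)[of "- q / (p + 1)"] by linarith
qed

text \<open>Dirichlet's principle: along a minimising sequence of \<open>J\<close> the images under
  \<open>B\<close> are Cauchy, although the sequence itself need not converge, and the first-order
  condition at their limit \<open>h\<close> is the claim. With the identity for \<open>B\<close>
  this is Riesz representation; with the defect operator it yields the inclusion of the weighted
  space in the range.\<close>

lemma functional_dominated_by_operator:
  fixes B :: "'a::real_vector \<Rightarrow> 'b::{real_inner, complete_space}" and l :: "'a \<Rightarrow> real"
  assumes "linear B" "linear l" and le: "\<And>f. \<bar>l f\<bar> \<le> C * norm (B f)"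
  obtains h where "\<And>f. l f = B f \<bullet> h"
proof -
  interpret B: linear B by fact
  interpret l: linear l by fact
  define J where "J f = (norm (B f))\<^sup>2 - 2 * l f" for f
  define m where "m = Inf (range J)"
  have lower: "J f \<ge> - C\<^sup>2" for f
  proof -
    have "2 * l f \<le> 2 * (C * norm (B f))" using le[of f] by linarith
    moreover have "0 \<le> (norm (B f) - C)\<^sup>2" by simp
    ultimately show ?thesis by (simp add: J_def power2_eq_square algebra_simps)
  qed
  have bdd: "bdd_below (range J)" using lower by (meson bdd_belowI2)
  have m_le: "m \<le> J f" for f unfolding m_def by (rule cInf_lower[OF _ bdd]) simp
  have "\<exists>f. J f < m + 1 / Suc n" for n :: nat
    using cInf_lessD[of "range J" "m + 1 / Suc n"] by (auto simp: m_def)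
  then obtain F where F: "J (F n) < m + 1 / Suc n" for n :: nat by metis
  \<comment> \<open>Parallelogram law; the linear terms cancel, so two near-minimisers have close
    images.\<close>
  have mid: "(norm (B f - B g))\<^sup>2 = 2 * J f + 2 * J g - 4 * J ((1/2) *\<^sub>R (f + g))" for f g
    by (simp add: J_def B.scale B.add l.scale l.add power_mult_distrib power2_norm_eq_inner
        inner_simps algebra_simps)
  have bound: "(norm (B (F i) - B (F j)))\<^sup>2 \<le> 2 / Suc i + 2 / Suc j" for i j
    using mid[of "F i" "F j"] F[of i] F[of j] m_le[of "(1/2) *\<^sub>R (F i + F j)"]
    by (simp add: algebra_simps)
  have "Cauchy (\<lambda>n. B (F n))"
  proof (rule CauchyI)
    fix e :: real assume "e > 0"
    then obtain N :: nat where N: "4 / Suc N < e\<^sup>2"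
      using reals_Archimedean[of "e\<^sup>2 / 4"] by (auto simp: field_simps)
    have "norm (B (F i) - B (F j)) < e" if "i \<ge> N" "j \<ge> N" for i j
    proof -
      have "2 / Suc i + 2 / Suc j \<le> 2 / Suc N + 2 / real (Suc N)"
        using that by (intro add_mono divide_left_mono) auto
      then have "(norm (B (F i) - B (F j)))\<^sup>2 < e\<^sup>2" using bound[of i j] N by linarith
      then show ?thesis using \<open>e > 0\<close> by (simp add: power_less_imp_less_base)
    qed
    then show "\<exists>M. \<forall>i\<ge>M. \<forall>j\<ge>M. norm (B (F i) - B (F j)) < e" by blast
  qed
  then obtain h where h: "(\<lambda>n. B (F n)) \<longlonglongrightarrow> h" using Cauchy_convergent_iff convergent_def by blast
  \<comment> \<open>The minimising sequence is perturbed by \<open>t *\<^sub>R f\<close>. The defect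
    \<open>1 / Suc n\<close> of near-minimality vanishes in the limit and leaves a non-negative
    quadratic in \<open>t\<close> whose linear coefficient is twice this difference.\<close>
  have "B f \<bullet> h - l f = 0" for f
  proof (rule quadratic_nonneg_imp_linear_coeff_zero)
    fix t :: real
    have "2 * t * (B f \<bullet> B (F n) - l f) + t\<^sup>2 * (norm (B f))\<^sup>2 \<ge> - (1 / Suc n)" for n
    proof -
      have "J (F n + t *\<^sub>R f) = J (F n) + (2 * t * (B f \<bullet> B (F n) - l f) + t\<^sup>2 * (norm (B f))\<^sup>2)"
        by (simp add: J_def B.scale B.add l.scale l.add power2_norm_eq_inner
            inner_simps algebra_simps power2_eq_square[of t] inner_commute)
      then show ?thesis using m_le[of "F n + t *\<^sub>R f"] F[of n] by linarith
    qed
    moreover have "(\<lambda>n. 2 * t * (B f \<bullet> B (F n) - l f) + t\<^sup>2 * (norm (B f))\<^sup>2)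
       \<longlonglongrightarrow> 2 * t * (B f \<bullet> h - l f) + t\<^sup>2 * (norm (B f))\<^sup>2"
      by (intro tendsto_intros h)
    moreover have "(\<lambda>n. - (1 / real (Suc n))) \<longlonglongrightarrow> 0"
      using tendsto_minus[OF LIMSEQ_Suc[OF lim_1_over_n]] by simp
    ultimately show "0 \<le> 2 * t * (B f \<bullet> h - l f) + t\<^sup>2 * (norm (B f))\<^sup>2"
      by (meson LIMSEQ_le)
  qed simp
  then show ?thesis using that by (metis diff_eq_eq add_0)
qed

section \<open>Positive square roots by a convergent operator iteration\<close>

text \<open>A limit X satisfies 2 X = A + X^2, that is, (1 - X)^2 = 1 - A, so the root sought is the
  identity minus X. Every iterate is a polynomial in \<open>A\<close> with non-negative
  coefficients, which is why the scalar case majorises it.\<close>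

primrec sqrt_iter :: "('a::real_normed_vector \<Rightarrow>\<^sub>L 'a) \<Rightarrow> nat \<Rightarrow> 'a \<Rightarrow>\<^sub>L 'a" where
  "sqrt_iter A 0 = 0"
| "sqrt_iter A (Suc n) = (1/2) *\<^sub>R (A + (sqrt_iter A n o\<^sub>L sqrt_iter A n))"

text \<open>The same recursion with \<open>A\<close> replaced by the number 1. It increases within
  [0, 1] and majorises both the norms and the increments of the iterates.\<close>

primrec sqrt_iter_bound :: "nat \<Rightarrow> real" where
  "sqrt_iter_bound 0 = 0"
| "sqrt_iter_bound (Suc n) = (1 + (sqrt_iter_bound n)\<^sup>2) / 2"

text \<open>Each iterate is a polynomial in \<open>A\<close>. Used with \<open>B\<close> an iterate,
  so that differences of squares factor, and with \<open>B\<close> any bounded operator commuting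
  with \<open>A\<close>, a property that survives in the limit and drives the uniqueness of the
  root.\<close>

lemma sqrt_iter_commute:
  assumes "bounded_linear B" "\<And>x. B (blinfun_apply A x) = blinfun_apply A (B x)"
  shows "B (blinfun_apply (sqrt_iter A n) x) = blinfun_apply (sqrt_iter A n) (B x)"
proof (induction n arbitrary: x)
  interpret bounded_linear B by fact
  case 0
  show ?case by (simp add: zero)
next
  interpret bounded_linear B by fact
  case (Suc n)
  then show ?case by (simp add: blinfun.bilinear_simps scale add assms(2))
qed

lemma sqrt_iter_bound_le_1: "0 \<le> sqrt_iter_bound n \<and> sqrt_iter_bound n \<le> 1"
  by (induction n) (auto intro: power_le_one)

lemma norm_sqrt_iter_le:
  assumes "norm A \<le> 1" shows "norm (sqrt_iter A n) \<le> sqrt_iter_bound n"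
proof (induction n)
  case (Suc n)
  have "norm (sqrt_iter A n o\<^sub>L sqrt_iter A n) \<le> norm (sqrt_iter A n) * norm (sqrt_iter A n)"
    by (rule norm_blinfun_compose)
  also have "\<dots> \<le> sqrt_iter_bound n * sqrt_iter_bound n"
    by (intro mult_mono Suc sqrt_iter_bound_le_1[THEN conjunct1]) auto
  finally show ?case using assms norm_triangle_ineq[of A "sqrt_iter A n o\<^sub>L sqrt_iter A n"]
    by (simp add: power2_eq_square)
qed simp

text \<open>Since the iterates commute, a difference of squares is (X - Y)(X + Y). The scalar
  increments satisfy the same factorisation with equality, so the bound propagates.\<close>

lemma norm_sqrt_iter_Suc_diff_le:
  assumes "norm A \<le> 1"
  shows "norm (sqrt_iter A (Suc n) - sqrt_iter A n) \<le> sqrt_iter_bound (Suc n) - sqrt_iter_bound n"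
proof (induction n)
  case 0
  then show ?case using assms by simp
next
  case (Suc n)
  let ?X = "sqrt_iter A (Suc n)" and ?Y = "sqrt_iter A n"
  let ?x = "sqrt_iter_bound (Suc n)" and ?y = "sqrt_iter_bound n"
  have comm: "blinfun_apply ?X (blinfun_apply ?Y x) = blinfun_apply ?Y (blinfun_apply ?X x)" for x
    by (intro sqrt_iter_commute[OF blinfun.bounded_linear_right] sqrt_iter_commute[symmetric]
        blinfun.bounded_linear_right refl)
  have "(?X o\<^sub>L ?X) - (?Y o\<^sub>L ?Y) = (?X - ?Y) o\<^sub>L (?X + ?Y)"
    by (rule blinfun_eqI) (simp del: sqrt_iter.simps add: blinfun.bilinear_simps comm)
  then have "norm ((?X o\<^sub>L ?X) - (?Y o\<^sub>L ?Y)) \<le> norm (?X - ?Y) * norm (?X + ?Y)"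
    by (metis norm_blinfun_compose)
  also have "\<dots> \<le> (?x - ?y) * (?x + ?y)"
  proof (rule mult_mono[OF Suc])
    show "norm (?X + ?Y) \<le> ?x + ?y"
      using norm_sqrt_iter_le[OF assms, of n] norm_sqrt_iter_le[OF assms, of "Suc n"]
        norm_triangle_ineq[of ?X ?Y] by linarith
    show "?x - ?y \<ge> 0" using Suc norm_ge_zero order_trans by blast
  qed auto
  finally have le: "norm ((?X o\<^sub>L ?X) - (?Y o\<^sub>L ?Y)) \<le> ?x\<^sup>2 - ?y\<^sup>2"
    by (simp only: power2_eq_square) (simp add: algebra_simps)
  have "sqrt_iter A (Suc (Suc n)) - ?X = (1/2) *\<^sub>R ((?X o\<^sub>L ?X) - (?Y o\<^sub>L ?Y))"
    by (simp only: sqrt_iter.simps) (simp add: algebra_simps)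
  then have "norm (sqrt_iter A (Suc (Suc n)) - ?X) = norm ((?X o\<^sub>L ?X) - (?Y o\<^sub>L ?Y)) / 2" by simp
  also have "\<dots> \<le> (?x\<^sup>2 - ?y\<^sup>2) / 2" using le by simp
  also have "\<dots> = sqrt_iter_bound (Suc (Suc n)) - ?x"
    by (simp only: sqrt_iter_bound.simps(2)) (simp add: field_simps)
  finally show ?case .
qed

lemma sqrt_iter_limit:
  fixes A :: "'a::banach \<Rightarrow>\<^sub>L 'a"
  assumes "norm A \<le> 1"
  obtains X where "sqrt_iter A \<longlonglongrightarrow> X" "norm X \<le> 1" "X + X = A + (X o\<^sub>L X)"
proof -
  have diff: "norm (sqrt_iter A (n + k) - sqrt_iter A n) \<le> sqrt_iter_bound (n + k) - sqrt_iter_bound n" for n k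
  proof (induction k)
    case (Suc k)
    have "sqrt_iter A (n + Suc k) - sqrt_iter A n =
      (sqrt_iter A (Suc (n + k)) - sqrt_iter A (n + k)) + (sqrt_iter A (n + k) - sqrt_iter A n)" by simp
    then show ?case
      using norm_triangle_ineq[of "sqrt_iter A (Suc (n + k)) - sqrt_iter A (n + k)"
          "sqrt_iter A (n + k) - sqrt_iter A n"] norm_sqrt_iter_Suc_diff_le[OF assms, of "n + k"] Suc
      by (simp only: add_Suc_right)
  qed simp
  \<comment> \<open>Monotone because every scalar increment dominates a norm.\<close>
  have "incseq sqrt_iter_bound"
    by (intro incseq_SucI) (meson norm_sqrt_iter_Suc_diff_le[OF assms] norm_ge_zero diff_ge_0_iff_ge order_trans)
  then have "convergent sqrt_iter_bound"
    using sqrt_iter_bound_le_1 incseq_convergent[of sqrt_iter_bound 1] convergent_def by blast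
  then have cb: "Cauchy sqrt_iter_bound" by (rule convergent_Cauchy)
  have "Cauchy (sqrt_iter A)"
  proof (rule CauchyI')
    fix e :: real assume "e > 0"
    then obtain M where M: "\<And>m n. m \<ge> M \<Longrightarrow> n \<ge> M \<Longrightarrow> norm (sqrt_iter_bound m - sqrt_iter_bound n) < e"
      using CauchyD[OF cb] by metis
    have "dist (sqrt_iter A m) (sqrt_iter A n) < e" if "m \<ge> M" "n > m" for m n
      using diff[of m "n - m"] M[of n m] that by (simp add: dist_norm norm_minus_commute)
    then show "\<exists>M. \<forall>m\<ge>M. \<forall>n>m. dist (sqrt_iter A m) (sqrt_iter A n) < e" by blast
  qed
  then obtain X where X: "sqrt_iter A \<longlonglongrightarrow> X" using Cauchy_convergent_iff convergent_def by blast
  have "norm X \<le> 1"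
    using norm_sqrt_iter_le[OF assms] sqrt_iter_bound_le_1
    by (intro tendsto_upperbound[OF tendsto_norm[OF X]] always_eventually) (auto intro: order_trans)
  moreover have "(\<lambda>n. sqrt_iter A (Suc n)) \<longlonglongrightarrow> (1/2) *\<^sub>R (A + (X o\<^sub>L X))"
    unfolding sqrt_iter.simps
    by (intro tendsto_intros X bounded_bilinear.tendsto[OF bounded_bilinear_blinfun_compose])
  then have "X = (1/2) *\<^sub>R (A + (X o\<^sub>L X))" using LIMSEQ_Suc[OF X] LIMSEQ_unique by blast
  then have "2 *\<^sub>R X = 2 *\<^sub>R ((1/2) *\<^sub>R (A + (X o\<^sub>L X)))" by (rule arg_cong)
  then have "X + X = A + (X o\<^sub>L X)" by (simp add: scaleR_2)
  ultimately show ?thesis using that X by blast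
qed

text \<open>The root is the identity minus the limit \<open>X\<close>, and
  \<open>norm X \<le> 1\<close> makes it positive. The commutation clause covers every bounded
  \<open>B\<close> commuting with \<open>A\<close>, because a competing root is such a
  \<open>B\<close>.\<close>

lemma defect_root_exists:
  fixes A :: "'a::{real_inner, banach} \<Rightarrow>\<^sub>L 'a"
  assumes "norm A \<le> 1" and sym: "\<And>x y. blinfun_apply A x \<bullet> y = x \<bullet> blinfun_apply A y"
  shows "\<exists>D. (\<forall>x. blinfun_apply D (blinfun_apply D x) = x - blinfun_apply A x) \<and>
    (\<forall>x y. blinfun_apply D x \<bullet> y = x \<bullet> blinfun_apply D y) \<and> (\<forall>x. blinfun_apply D x \<bullet> x \<ge> 0) \<and>
    (\<forall>B. bounded_linear B \<longrightarrow> (\<forall>x. B (blinfun_apply A x) = blinfun_apply A (B x)) \<longrightarrow>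
      (\<forall>x. B (blinfun_apply D x) = blinfun_apply D (B x)))"
proof -
  obtain X where X: "sqrt_iter A \<longlonglongrightarrow> X" "norm X \<le> 1" "X + X = A + (X o\<^sub>L X)"
    using sqrt_iter_limit[OF assms(1)] .
  have lim: "(\<lambda>n. blinfun_apply (sqrt_iter A n) x) \<longlonglongrightarrow> blinfun_apply X x" for x
    by (intro blinfun.tendsto X tendsto_const)
  have iter_sym: "blinfun_apply (sqrt_iter A n) x \<bullet> y = x \<bullet> blinfun_apply (sqrt_iter A n) y" for n x y
    by (induction n arbitrary: x y) (simp_all add: blinfun.bilinear_simps inner_simps sym)
  have X_sym: "blinfun_apply X x \<bullet> y = x \<bullet> blinfun_apply X y" for x y
  proof (rule LIMSEQ_unique)
    show "(\<lambda>n. blinfun_apply (sqrt_iter A n) x \<bullet> y) \<longlonglongrightarrow> blinfun_apply X x \<bullet> y"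
      by (intro tendsto_intros lim)
    show "(\<lambda>n. blinfun_apply (sqrt_iter A n) x \<bullet> y) \<longlonglongrightarrow> x \<bullet> blinfun_apply X y"
      unfolding iter_sym by (intro tendsto_intros lim)
  qed
  have X_comm: "B (blinfun_apply X x) = blinfun_apply X (B x)"
    if "bounded_linear B" "\<And>x. B (blinfun_apply A x) = blinfun_apply A (B x)" for B x
  proof (rule LIMSEQ_unique)
    show "(\<lambda>n. B (blinfun_apply (sqrt_iter A n) x)) \<longlonglongrightarrow> B (blinfun_apply X x)"
      by (intro bounded_linear.tendsto[OF that(1)] lim)
    show "(\<lambda>n. B (blinfun_apply (sqrt_iter A n) x)) \<longlonglongrightarrow> blinfun_apply X (B x)"
      unfolding sqrt_iter_commute[OF that] by (rule lim)
  qed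
  have app: "blinfun_apply X x + blinfun_apply X x = blinfun_apply A x + blinfun_apply X (blinfun_apply X x)" for x
    using arg_cong[OF X(3), of "\<lambda>T. blinfun_apply T x"] by (simp add: blinfun.bilinear_simps)
  define D where "D = id_blinfun - X"
  have D: "blinfun_apply D x = x - blinfun_apply X x" for x by (simp add: D_def blinfun.bilinear_simps)
  show ?thesis
  proof (intro exI[of _ D] conjI allI impI)
    show "blinfun_apply D (blinfun_apply D x) = x - blinfun_apply A x" for x
      using app[of x] by (simp add: D blinfun.bilinear_simps algebra_simps)
    show "blinfun_apply D x \<bullet> y = x \<bullet> blinfun_apply D y" for x y
      by (simp add: D inner_simps X_sym)
    show "blinfun_apply D x \<bullet> x \<ge> 0" for x
    proof -
      have "blinfun_apply X x \<bullet> x \<le> norm (blinfun_apply X x) * norm x" by (rule norm_cauchy_schwarz)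
      also have "\<dots> \<le> (norm X * norm x) * norm x" by (intro mult_right_mono norm_blinfun) auto
      also have "\<dots> \<le> 1 * norm x * norm x" using X(2) by (intro mult_right_mono) auto
      also have "\<dots> = x \<bullet> x" by (simp add: dot_square_norm power2_eq_square)
      finally show ?thesis by (simp add: D inner_simps)
    qed
    show "B (blinfun_apply D x) = blinfun_apply D (B x)"
      if "bounded_linear B" "\<forall>x. B (blinfun_apply A x) = blinfun_apply A (B x)" for B x
      using X_comm[OF that(1)] that(2) linear_simps(2)[OF that(1)] by (simp add: D)
  qed
qed

text \<open>Cauchy-Schwarz for the semi-definite form of \<open>S\<close>: moving from
  \<open>y\<close> along \<open>S y\<close> leaves a non-negative quadratic in \<open>t\<close>
  without constant term, whose linear coefficient is twice the square of
  \<open>norm (S y)\<close>.\<close>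

lemma positive_operator_kernel:
  fixes S :: "'a::real_inner \<Rightarrow> 'a"
  assumes "linear S" and sym: "\<And>x y. S x \<bullet> y = x \<bullet> S y" and pos: "\<And>x. S x \<bullet> x \<ge> 0"
    and "S y \<bullet> y = 0"
  shows "S y = 0"
proof -
  interpret linear S by fact
  have "S y \<bullet> S y = 0"
  proof (rule quadratic_nonneg_imp_linear_coeff_zero)
    fix t :: real
    have "S (y + t *\<^sub>R S y) \<bullet> (y + t *\<^sub>R S y) = S y \<bullet> y + t * (S y \<bullet> S y) + t * (S (S y) \<bullet> y) + t\<^sup>2 * (S (S y) \<bullet> S y)"
      by (simp add: add scale inner_simps power2_eq_square algebra_simps)
    then show "0 \<le> 2 * t * (S y \<bullet> S y) + t\<^sup>2 * (S (S y) \<bullet> S y)"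
      using pos[of "y + t *\<^sub>R S y"] assms(4) sym[of "S y" y] by simp
  qed (rule pos)
  then show ?thesis by simp
qed

text \<open>By commutation S + D annihilates \<open>y = S x - D x\<close>, so two non-negative forms
  add up to 0 and both vanish. Then \<open>S y = D y = 0\<close>, and symmetry gives
  \<open>y \<bullet> y = x \<bullet> (S y - D y)\<close>.\<close>

lemma positive_root_unique:
  fixes S D :: "'a::real_inner \<Rightarrow> 'a"
  assumes S: "linear S" "\<And>x y. S x \<bullet> y = x \<bullet> S y" "\<And>x. S x \<bullet> x \<ge> 0"
    and D: "linear D" "\<And>x y. D x \<bullet> y = x \<bullet> D y" "\<And>x. D x \<bullet> x \<ge> 0"
    and eq: "\<And>x. S (S x) = D (D x)" and comm: "\<And>x. S (D x) = D (S x)"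
  shows "S x = D x"
proof -
  interpret S: linear S by fact
  interpret D: linear D by fact
  define y where "y = S x - D x"
  have "S y \<bullet> y + D y \<bullet> y = 0"
    by (simp add: y_def S.diff D.diff eq comm inner_simps)
  then have "S y \<bullet> y = 0" "D y \<bullet> y = 0" using S(3)[of y] D(3)[of y] by linarith+
  then have "S y = 0" "D y = 0"
    using positive_operator_kernel[OF S] positive_operator_kernel[OF D] by blast+
  moreover have "y \<bullet> y = x \<bullet> (S y - D y)"
    by (subst (1) y_def) (simp add: inner_simps S(2) D(2))
  ultimately show ?thesis by (simp add: y_def)
qed

text \<open>Baire category: the closed sets \<open>F k\<close>, on which all \<open>T n\<close> are
  bounded by \<open>k\<close>, cover the space, so one of them contains a ball. A vector of length
  \<open>r\<close> is a difference of two points of that ball, hence the factor 2.\<close>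

lemma uniform_boundedness:
  fixes T :: "nat \<Rightarrow> 'a::banach \<Rightarrow> 'b::real_normed_vector"
  assumes lin: "\<And>n. bounded_linear (T n)" and pointwise: "\<And>x. \<exists>C. \<forall>n. norm (T n x) \<le> C"
  obtains C where "\<And>n x. norm (T n x) \<le> C * norm x"
proof -
  define F where "F k = {x. \<forall>n. norm (T n x) \<le> real k}" for k
  have F_closed: "closed (F k)" for k
  proof -
    have "F k = (\<Inter>n. {x. norm (T n x) \<le> real k})" by (auto simp: F_def)
    moreover have "closed {x. norm (T n x) \<le> real k}" for n
      by (intro closed_Collect_le continuous_intros linear_continuous_on[OF lin, unfolded o_def])
    ultimately show ?thesis by auto
  qed
  have UN: "\<Union>(range F) = UNIV"
  proof -
    have "\<exists>k. x \<in> F k" for x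
    proof -
      obtain C where C: "\<And>n. norm (T n x) \<le> C" using pointwise by blast
      obtain k where k: "C \<le> real k" using real_arch_simple by blast
      have "x \<in> F k" unfolding F_def mem_Collect_eq by (intro allI order_trans[OF C k])
      then show ?thesis ..
    qed
    then show ?thesis by blast
  qed
  have "\<exists>k. interior (F k) \<noteq> {}"
  proof (rule ccontr)
    assume "\<not> ?thesis"
    then have "Met_TC.mtopology interior_of \<Union>(range F) = ({}::'a set)"
      using F_closed
      by (intro Met_TC.metric_Baire_category_alt) (auto simp: mcomplete_iff_complete complete_UNIV)
    then show False by (simp add: UN)
  qed
  then obtain k a where "a \<in> interior (F k)" by blast
  then obtain r where r: "r > 0" "cball a r \<subseteq> F k"
    by (meson interior_subset open_contains_cball open_interior order_trans)
  have bound: "norm (T n x) \<le> 2 * real k / r * norm x" for n x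
  proof (cases "x = 0")
    case True
    then show ?thesis using linear_simps(3)[OF lin] by simp
  next
    case False
    interpret bounded_linear "T n" by (rule lin)
    define y where "y = (r / norm x) *\<^sub>R x"
    have "a \<in> F k" "a + y \<in> F k" using r False by (auto simp: y_def dist_norm intro!: subsetD[OF r(2)])
    then have "norm (T n a) \<le> k" "norm (T n (a + y)) \<le> k" by (auto simp: F_def)
    moreover have "T n y = T n (a + y) - T n a" by (simp add: add)
    ultimately have "norm (T n y) \<le> 2 * real k"
      using norm_triangle_ineq4[of "T n (a + y)" "T n a"] by simp
    then show ?thesis using r(1) False by (simp add: y_def scale field_simps)
  qed
  show ?thesis by (rule that[of "2 * real k / r"]) (rule bound)
qed

section \<open>Square-summable sequences\<close>


text \<open>A separate type, so that the classes of real inner product spaces and complete spaces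
  apply and operators can be handled as bounded linear maps. Only the real structure lives in the
  classes; complex scalars are added by \<open>ell2_scale\<close>.\<close>

typedef ell2 = "{a :: nat \<Rightarrow> complex. summable (\<lambda>n. (cmod (a n))\<^sup>2)}"
  morphisms ell2_nth Ell2
  by (rule exI[of _ "\<lambda>_. 0"]) simp

setup_lifting type_definition_ell2

lemma summable_ell2: "summable (\<lambda>n. (cmod (ell2_nth x n))\<^sup>2)"
  using ell2_nth by blast

lemma ell2_eqI: "(\<And>n. ell2_nth x n = ell2_nth y n) \<Longrightarrow> x = y"
  by (meson ell2_nth_inject ext)

lemma square_sum_le: "(cmod (a + b))\<^sup>2 \<le> 2 * (cmod a)\<^sup>2 + 2 * (cmod b)\<^sup>2"
proof -
  have "(cmod (a + b))\<^sup>2 \<le> (cmod a + cmod b)\<^sup>2"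
    by (intro power_mono norm_triangle_ineq norm_ge_zero)
  also have "\<dots> \<le> 2 * (cmod a)\<^sup>2 + 2 * (cmod b)\<^sup>2"
    using zero_le_power2[of "cmod a - cmod b"] by (simp add: power2_eq_square algebra_simps)
  finally show ?thesis .
qed

instantiation ell2 :: real_vector
begin

lift_definition zero_ell2 :: ell2 is "\<lambda>_. 0" by simp

lift_definition plus_ell2 :: "ell2 \<Rightarrow> ell2 \<Rightarrow> ell2" is "\<lambda>a b n. a n + b n"
proof -
  fix a b :: "nat \<Rightarrow> complex"
  assume "summable (\<lambda>n. (cmod (a n))\<^sup>2)" "summable (\<lambda>n. (cmod (b n))\<^sup>2)"
  then have "summable (\<lambda>n. 2 * (cmod (a n))\<^sup>2 + 2 * (cmod (b n))\<^sup>2)"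
    by (intro summable_add summable_mult)
  then show "summable (\<lambda>n. (cmod (a n + b n))\<^sup>2)"
    by (rule summable_comparison_test') (simp add: square_sum_le)
qed

lift_definition uminus_ell2 :: "ell2 \<Rightarrow> ell2" is "\<lambda>a n. - a n" by simp

definition minus_ell2 :: "ell2 \<Rightarrow> ell2 \<Rightarrow> ell2" where "x - y = x + - (y::ell2)"

lift_definition scaleR_ell2 :: "real \<Rightarrow> ell2 \<Rightarrow> ell2" is "\<lambda>r a n. r *\<^sub>R a n"
  by (simp add: power_mult_distrib summable_mult)

instance
  by standard (simp_all add: minus_ell2_def, (transfer; simp add: algebra_simps)+)

end

lemma ell2_nth_simps [simp]:
  "ell2_nth 0 n = 0" "ell2_nth (x + y) n = ell2_nth x n + ell2_nth y n"
  "ell2_nth (- x) n = - ell2_nth x n" "ell2_nth (x - y) n = ell2_nth x n - ell2_nth y n"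
  "ell2_nth (r *\<^sub>R x) n = r *\<^sub>R ell2_nth x n"
  unfolding minus_ell2_def by (transfer; simp)+

lemma summable_ell2_inner: "summable (\<lambda>n. ell2_nth x n \<bullet> ell2_nth y n)"
proof (rule summable_comparison_test'[OF summable_add[OF summable_ell2[of x] summable_ell2[of y]]])
  fix n
  have "\<bar>ell2_nth x n \<bullet> ell2_nth y n\<bar> \<le> cmod (ell2_nth x n) * cmod (ell2_nth y n)"
    by (rule Cauchy_Schwarz_ineq2)
  also have "\<dots> \<le> (cmod (ell2_nth x n))\<^sup>2 + (cmod (ell2_nth y n))\<^sup>2"
  proof -
    have "2 * (cmod (ell2_nth x n) * cmod (ell2_nth y n)) \<le> (cmod (ell2_nth x n))\<^sup>2 + (cmod (ell2_nth y n))\<^sup>2"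
      using sum_squares_bound[of "cmod (ell2_nth x n)" "cmod (ell2_nth y n)"] by (simp only: mult.assoc)
    moreover have "0 \<le> cmod (ell2_nth x n) * cmod (ell2_nth y n)" by simp
    ultimately show ?thesis by linarith
  qed
  finally show "norm (ell2_nth x n \<bullet> ell2_nth y n) \<le> (cmod (ell2_nth x n))\<^sup>2 + (cmod (ell2_nth y n))\<^sup>2"
    by simp
qed

instantiation ell2 :: real_inner
begin

definition inner_ell2 :: "ell2 \<Rightarrow> ell2 \<Rightarrow> real" where
  "inner_ell2 x y = (\<Sum>n. ell2_nth x n \<bullet> ell2_nth y n)"

definition norm_ell2 :: "ell2 \<Rightarrow> real" where "norm_ell2 x = sqrt (x \<bullet> x)"

definition sgn_ell2 :: "ell2 \<Rightarrow> ell2" where "sgn_ell2 x = x /\<^sub>R norm x"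

definition dist_ell2 :: "ell2 \<Rightarrow> ell2 \<Rightarrow> real" where "dist_ell2 x y = norm (x - y)"

definition uniformity_ell2 :: "(ell2 \<times> ell2) filter" where
  "uniformity_ell2 = (INF e\<in>{0<..}. principal {(x, y). dist x y < e})"

definition open_ell2 :: "ell2 set \<Rightarrow> bool" where
  "open_ell2 U \<longleftrightarrow> (\<forall>x\<in>U. eventually (\<lambda>(x', y). x' = x \<longrightarrow> y \<in> U) uniformity)"

instance
proof
  fix x y z :: ell2 and r :: real
  show "x \<bullet> y = y \<bullet> x" by (simp add: inner_ell2_def inner_commute)
  show "(x + y) \<bullet> z = x \<bullet> z + y \<bullet> z"
    by (simp add: inner_ell2_def inner_add_left suminf_add[OF summable_ell2_inner summable_ell2_inner])
  show "(r *\<^sub>R x) \<bullet> y = r * (x \<bullet> y)"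
    by (simp add: inner_ell2_def suminf_mult[OF summable_ell2_inner])
  show "0 \<le> x \<bullet> x" by (simp add: inner_ell2_def suminf_nonneg[OF summable_ell2_inner])
  show "x \<bullet> x = 0 \<longleftrightarrow> x = 0"
    unfolding inner_ell2_def suminf_eq_zero_iff[OF summable_ell2_inner inner_ge_zero]
    by (metis ell2_eqI ell2_nth_simps(1) inner_eq_zero_iff)
qed (simp_all add: norm_ell2_def sgn_ell2_def dist_ell2_def uniformity_ell2_def open_ell2_def)

end

lemma norm_ell2_squared: "(norm (x::ell2))\<^sup>2 = (\<Sum>n. (cmod (ell2_nth x n))\<^sup>2)"
  by (simp add: power2_norm_eq_inner inner_ell2_def)

lemma sum_le_norm_ell2: "(\<Sum>n<N. (cmod (ell2_nth x n))\<^sup>2) \<le> (norm x)\<^sup>2"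
  unfolding norm_ell2_squared by (intro sum_le_suminf summable_ell2) auto

lemma norm_ell2_le_iff: "(norm (x::ell2))\<^sup>2 \<le> C \<longleftrightarrow> (\<forall>N. (\<Sum>n<N. (cmod (ell2_nth x n))\<^sup>2) \<le> C)"
  using sum_le_norm_ell2[of x] suminf_le_const[OF summable_ell2[of x], of C]
  by (auto simp: norm_ell2_squared intro: order_trans)

lemma norm_ell2_nth_le: "cmod (ell2_nth x n) \<le> norm x"
proof -
  have "(cmod (ell2_nth x n))\<^sup>2 \<le> (\<Sum>n<Suc n. (cmod (ell2_nth x n))\<^sup>2)"
    by (simp add: sum_nonneg)
  also have "\<dots> \<le> (norm x)\<^sup>2" by (rule sum_le_norm_ell2)
  finally show ?thesis by (rule power2_le_imp_le) simp
qed

lemma summable_if_bounded_sums: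
  fixes f :: "nat \<Rightarrow> real"
  assumes "\<And>n. f n \<ge> 0" "\<And>N. (\<Sum>n<N. f n) \<le> C"
  shows "summable f"
  by (rule bounded_imp_summable[of _ C]) (use assms(1) assms(2)[of "Suc _"] in \<open>simp_all only: lessThan_Suc_atMost\<close>)

lemma ell2_nth_Ell2:
  assumes "\<And>N. (\<Sum>n<N. (cmod (a n))\<^sup>2) \<le> C"
  shows "ell2_nth (Ell2 a) = a"
  using summable_if_bounded_sums[of "\<lambda>n. (cmod (a n))\<^sup>2", OF _ assms] by (intro Ell2_inverse) auto

instance ell2 :: complete_space
proof
  fix X :: "nat \<Rightarrow> ell2" assume X: "Cauchy X"
  have "Cauchy (\<lambda>m. ell2_nth (X m) n)" for n
  proof (rule CauchyI)
    fix e :: real assume "e > 0"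
    then obtain M where "\<And>m k. m \<ge> M \<Longrightarrow> k \<ge> M \<Longrightarrow> norm (X m - X k) < e" using CauchyD[OF X] by metis
    then show "\<exists>M. \<forall>m\<ge>M. \<forall>k\<ge>M. norm (ell2_nth (X m) n - ell2_nth (X k) n) < e"
      using norm_ell2_nth_le by (metis ell2_nth_simps(4) le_less_trans)
  qed
  then have "\<exists>l. (\<lambda>m. ell2_nth (X m) n) \<longlonglongrightarrow> l" for n
    using Cauchy_convergent_iff convergent_def by blast
  then obtain l where l: "\<And>n. (\<lambda>m. ell2_nth (X m) n) \<longlonglongrightarrow> l n" by metis
  have near: "\<exists>M. \<forall>m\<ge>M. \<forall>N. (\<Sum>n<N. (cmod (ell2_nth (X m) n - l n))\<^sup>2) \<le> e\<^sup>2" if "e > 0" for e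
  proof -
    obtain M where M: "\<And>m k. m \<ge> M \<Longrightarrow> k \<ge> M \<Longrightarrow> norm (X m - X k) < e"
      using CauchyD[OF X \<open>e > 0\<close>] by metis
    have "(\<Sum>n<N. (cmod (ell2_nth (X m) n - l n))\<^sup>2) \<le> e\<^sup>2" if "m \<ge> M" for m N
    proof (rule tendsto_upperbound)
      show "(\<lambda>k. \<Sum>n<N. (cmod (ell2_nth (X m) n - ell2_nth (X k) n))\<^sup>2)
        \<longlonglongrightarrow> (\<Sum>n<N. (cmod (ell2_nth (X m) n - l n))\<^sup>2)"
        by (intro tendsto_intros l)
      have "(\<Sum>n<N. (cmod (ell2_nth (X m) n - ell2_nth (X k) n))\<^sup>2) \<le> e\<^sup>2" if "k \<ge> M" for k
      proof -
        have "(\<Sum>n<N. (cmod (ell2_nth (X m) n - ell2_nth (X k) n))\<^sup>2) \<le> (norm (X m - X k))\<^sup>2"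
          using sum_le_norm_ell2[where x = "X m - X k"] by simp
        also have "\<dots> \<le> e\<^sup>2" using M[OF \<open>m \<ge> M\<close> that] by (intro power_mono) auto
        finally show ?thesis .
      qed
      then show "\<forall>\<^sub>F k in sequentially. (\<Sum>n<N. (cmod (ell2_nth (X m) n - ell2_nth (X k) n))\<^sup>2) \<le> e\<^sup>2"
        using eventually_sequentially by blast
    qed simp
    then show ?thesis by blast
  qed
  obtain M where M: "\<And>N. (\<Sum>n<N. (cmod (ell2_nth (X M) n - l n))\<^sup>2) \<le> 1\<^sup>2"
    using near[of 1] by auto
  \<comment> \<open>The coordinatewise limit \<open>l\<close> is not yet known to be
    square-summable. The difference from \<open>X M\<close> is, by the choice of \<open>M\<close>,
    so the limit is recovered from that difference.\<close>
  define L where "L = X M - Ell2 (\<lambda>n. ell2_nth (X M) n - l n)"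
  have L: "ell2_nth L n = l n" for n using ell2_nth_Ell2[OF M] by (simp add: L_def)
  have "X \<longlonglongrightarrow> L"
  proof (rule LIMSEQ_I)
    fix e :: real assume "e > 0"
    then obtain M where M: "\<And>m N. m \<ge> M \<Longrightarrow> (\<Sum>n<N. (cmod (ell2_nth (X m) n - l n))\<^sup>2) \<le> (e/2)\<^sup>2"
      using near[of "e/2"] by auto
    have "norm (X m - L) < e" if "m \<ge> M" for m
    proof -
      have "(norm (X m - L))\<^sup>2 \<le> (e/2)\<^sup>2" unfolding norm_ell2_le_iff using M[OF that] by (simp add: L)
      then have "norm (X m - L) \<le> e/2" using \<open>e > 0\<close> by (elim power2_le_imp_le) simp
      then show ?thesis using \<open>e > 0\<close> by linarith
    qed
    then show "\<exists>M. \<forall>m\<ge>M. norm (X m - L) < e" by blast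
  qed
  then show "convergent X" by (auto simp: convergent_def)
qed

instance ell2 :: banach ..

section \<open>Truncation, weak convergence and compactness in the sequence space\<close>

definition ell2_trunc :: "nat \<Rightarrow> ell2 \<Rightarrow> ell2" where
  "ell2_trunc N x = Ell2 (\<lambda>n. if n < N then ell2_nth x n else 0)"

lemma ell2_nth_Ell2_finite: "ell2_nth (Ell2 (\<lambda>n. if n < N then a n else 0)) n = (if n < N then a n else 0)"
  by (subst Ell2_inverse) (auto intro!: summable_finite[of "{..<N}"] split: if_splits)

lemma ell2_nth_trunc [simp]: "ell2_nth (ell2_trunc N x) n = (if n < N then ell2_nth x n else 0)"
  unfolding ell2_trunc_def by (rule ell2_nth_Ell2_finite)

lemma ell2_trunc_tendsto: "(\<lambda>N. ell2_trunc N x) \<longlonglongrightarrow> x"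
proof -
  let ?f = "\<lambda>n. (cmod (ell2_nth x n))\<^sup>2"
  have eq: "(norm (ell2_trunc N x - x))\<^sup>2 = (\<Sum>n. ?f n) - (\<Sum>n<N. ?f n)" for N
  proof -
    have "(\<Sum>n. (cmod (ell2_nth (ell2_trunc N x - x) n))\<^sup>2)
      = (\<Sum>n. (cmod (ell2_nth (ell2_trunc N x - x) (n + N)))\<^sup>2) + (\<Sum>n<N. (cmod (ell2_nth (ell2_trunc N x - x) n))\<^sup>2)"
      by (rule suminf_split_initial_segment[OF summable_ell2])
    then show ?thesis
      using suminf_split_initial_segment[OF summable_ell2[of x], of N] by (simp add: norm_ell2_squared)
  qed
  have "(\<lambda>N. (\<Sum>n. ?f n) - (\<Sum>n<N. ?f n)) \<longlonglongrightarrow> (\<Sum>n. ?f n) - (\<Sum>n. ?f n)"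
    by (intro tendsto_intros summable_LIMSEQ summable_ell2)
  then have "(\<lambda>N. (norm (ell2_trunc N x - x))\<^sup>2) \<longlonglongrightarrow> 0" unfolding eq by simp
  then have "(\<lambda>N. sqrt ((norm (ell2_trunc N x - x))\<^sup>2)) \<longlonglongrightarrow> sqrt 0" by (intro tendsto_intros)
  then show ?thesis by (simp add: LIM_zero_iff tendsto_norm_zero_iff)
qed

lemma inner_ell2_trunc: "y \<bullet> ell2_trunc N x = (\<Sum>n<N. ell2_nth y n \<bullet> ell2_nth x n)"
proof -
  have "y \<bullet> ell2_trunc N x = (\<Sum>n<N. ell2_nth y n \<bullet> ell2_nth (ell2_trunc N x) n)"
    unfolding inner_ell2_def by (rule suminf_finite) auto
  then show ?thesis by simp
qed

text \<open>Replacing \<open>y\<close> by a truncation costs a small multiple of the bound,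
  uniformly in \<open>k\<close>, and against a truncation only finitely many coordinates
  matter.\<close>

lemma ell2_weakly_null:
  assumes bdd: "\<And>k. norm (f k) \<le> B" and coord: "\<And>n. (\<lambda>k. ell2_nth (f k) n) \<longlonglongrightarrow> 0"
  shows "(\<lambda>k. f k \<bullet> y) \<longlonglongrightarrow> 0"
proof (rule LIMSEQ_I)
  fix e :: real assume "e > 0"
  have "B \<ge> 0" using bdd norm_ge_zero order_trans by blast
  have "(e / 2) / (B + 1) > 0" using \<open>e > 0\<close> \<open>B \<ge> 0\<close> by simp
  from LIMSEQ_D[OF ell2_trunc_tendsto[of y] this]
  obtain N where N: "norm (ell2_trunc N y - y) < (e / 2) / (B + 1)" by blast
  have "(\<lambda>k. f k \<bullet> ell2_trunc N y) \<longlonglongrightarrow> (\<Sum>n<N. 0 \<bullet> ell2_nth y n)"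
    unfolding inner_ell2_trunc by (intro tendsto_intros coord)
  then obtain K where K: "\<And>k. k \<ge> K \<Longrightarrow> norm (f k \<bullet> ell2_trunc N y - 0) < e / 2"
    using LIMSEQ_D[where r = "e/2" and X = "\<lambda>k. f k \<bullet> ell2_trunc N y" and L = 0] \<open>e > 0\<close> by auto
  have "norm (f k \<bullet> y - 0) < e" if "k \<ge> K" for k
  proof -
    have "\<bar>f k \<bullet> (ell2_trunc N y - y)\<bar> \<le> norm (f k) * norm (ell2_trunc N y - y)"
      by (rule Cauchy_Schwarz_ineq2)
    also have "\<dots> \<le> (B + 1) * ((e / 2) / (B + 1))"
      using bdd[of k] N \<open>B \<ge> 0\<close> by (intro mult_mono) auto
    also have "\<dots> = e / 2" using \<open>B \<ge> 0\<close> by (intro nonzero_mult_div_cancel_left[THEN trans[OF times_divide_eq_right]]) auto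
    finally have "\<bar>f k \<bullet> ell2_trunc N y - f k \<bullet> y\<bar> \<le> e / 2" by (simp add: inner_diff_right)
    then show ?thesis using K[OF that] unfolding real_norm_def diff_zero by linarith
  qed
  then show "\<exists>K. \<forall>k\<ge>K. norm (f k \<bullet> y - 0) < e" by blast
qed

text \<open>Tychonoff's theorem in place of a diagonal argument: the product of the discs is
  compact, and sequentially so because the countable product is metrisable.\<close>

lemma bounded_pointwise_subsequence:
  fixes f :: "nat \<Rightarrow> nat \<Rightarrow> complex"
  assumes "\<And>k n. cmod (f k n) \<le> r n"
  obtains s a where "strict_mono s" "\<And>n. (\<lambda>k. f (s k) n) \<longlonglongrightarrow> a n"
proof -
  have "compactin (product_topology (\<lambda>_. euclidean) UNIV) (PiE UNIV (\<lambda>n. cball (0::complex) (r n)))"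
    by (simp add: compactin_PiE)
  then have "compact (PiE UNIV (\<lambda>n. cball (0::complex) (r n)))"
    by (simp add: euclidean_product_topology)
  then have "seq_compact (PiE UNIV (\<lambda>n. cball (0::complex) (r n)))"
    by (simp add: compact_eq_seq_compact_metric)
  moreover have "\<forall>k. f k \<in> PiE UNIV (\<lambda>n. cball 0 (r n))" using assms by auto
  ultimately obtain a s where s: "strict_mono s" and lim: "(f \<circ> s) \<longlonglongrightarrow> a"
    unfolding seq_compact_def by blast
  have "(\<lambda>k. f (s k) n) \<longlonglongrightarrow> a n" for n
    using continuous_on_tendsto_compose[OF continuous_on_product_coordinates[of n] lim]
    by (simp add: o_def)
  then show ?thesis using that s by blast
qed

text \<open>Growing weights make the tails uniformly small, while the finitely many remaining
  coordinates converge along a subsequence.\<close>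

lemma compact_weighted_ell2_ball:
  fixes v :: "nat \<Rightarrow> real"
  assumes v1: "\<And>n. v n \<ge> 1" and lim: "filterlim v at_top sequentially"
  shows "compact {x. \<forall>N. (\<Sum>n<N. v n * (cmod (ell2_nth x n))\<^sup>2) \<le> C}" (is "compact ?K")
  unfolding compact_eq_seq_compact_metric seq_compact_def
proof (intro allI impI)
  fix f :: "nat \<Rightarrow> ell2" assume fK: "\<forall>k. f k \<in> ?K"
  then have f: "(\<Sum>n<N. v n * (cmod (ell2_nth (f k) n))\<^sup>2) \<le> C" for k N by auto
  have le: "(\<Sum>n<N. (cmod (x n))\<^sup>2) \<le> (\<Sum>n<N. v n * (cmod (x n))\<^sup>2)" for N x
    using v1 by (intro sum_mono) (simp add: mult_le_cancel_right1)
  have "(norm (f k))\<^sup>2 \<le> C" for k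
    unfolding norm_ell2_le_iff using f le order_trans by blast
  then have "norm (f k) \<le> sqrt C" for k by (simp add: real_le_rsqrt)
  then have "cmod (ell2_nth (f k) n) \<le> sqrt C" for k n using norm_ell2_nth_le order_trans by blast
  then obtain s a where s: "strict_mono s" and a: "\<And>n. (\<lambda>k. ell2_nth (f (s k)) n) \<longlonglongrightarrow> a n"
    using bounded_pointwise_subsequence[of "\<lambda>k. ell2_nth (f k)" "\<lambda>_. sqrt C"] by blast
  have aC: "(\<Sum>n<N. v n * (cmod (a n))\<^sup>2) \<le> C" for N
  proof (rule tendsto_upperbound)
    show "(\<lambda>k. \<Sum>n<N. v n * (cmod (ell2_nth (f (s k)) n))\<^sup>2) \<longlonglongrightarrow> (\<Sum>n<N. v n * (cmod (a n))\<^sup>2)"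
      by (intro tendsto_intros a)
  qed (use f in auto)
  define x where "x = Ell2 a"
  have x: "ell2_nth x = a"
    unfolding x_def by (rule ell2_nth_Ell2[of _ C]) (rule order_trans[OF le aC])
  have "x \<in> ?K" by (simp add: x aC)
  have "(\<lambda>k. (norm (f (s k) - x))\<^sup>2) \<longlonglongrightarrow> 0"
  proof (rule LIMSEQ_I)
    fix e :: real assume "e > 0"
    have "C \<ge> 0" using f[of 0 0] by simp
    \<comment> \<open>The weighted sum of the squared differences is at most \<open>4 * C\<close>.
      With this threshold the unweighted tail is at most \<open>e / 2\<close>; the summand 1 makes
      the argument cover \<open>C = 0\<close>.\<close>
    obtain N where N: "\<And>n. n \<ge> N \<Longrightarrow> v n \<ge> 1 + 8 * C / e"
      using lim unfolding filterlim_at_top eventually_sequentially by blast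
    have "(\<lambda>k. \<Sum>n<N. (cmod (ell2_nth (f (s k)) n - a n))\<^sup>2) \<longlonglongrightarrow> (\<Sum>n<N. (cmod (a n - a n))\<^sup>2)"
      by (intro tendsto_intros a)
    from order_tendstoD(2)[OF this, of "e / 4"] \<open>e > 0\<close>
    obtain K where K: "\<And>k. k \<ge> K \<Longrightarrow> (\<Sum>n<N. (cmod (ell2_nth (f (s k)) n - a n))\<^sup>2) < e / 4"
      unfolding eventually_sequentially by auto
    have "(norm (f (s k) - x))\<^sup>2 \<le> e / 4 + e / 2" if "k \<ge> K" for k
      unfolding norm_ell2_le_iff
    proof
      fix M
      let ?d = "\<lambda>n. (cmod (ell2_nth (f (s k)) n - a n))\<^sup>2"
      have "(\<Sum>n<M. ?d n) \<le> (\<Sum>n<N. ?d n) + (\<Sum>n\<in>{N..<M}. ?d n)"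
      proof -
        have "(\<Sum>n<M. ?d n) \<le> (\<Sum>n\<in>{..<N} \<union> {N..<M}. ?d n)" by (intro sum_mono2) auto
        also have "\<dots> = (\<Sum>n<N. ?d n) + (\<Sum>n\<in>{N..<M}. ?d n)" by (intro sum.union_disjoint) auto
        finally show ?thesis .
      qed
      moreover have "(1 + 8 * C / e) * (\<Sum>n\<in>{N..<M}. ?d n) \<le> 4 * C"
      proof -
        have "(1 + 8 * C / e) * (\<Sum>n\<in>{N..<M}. ?d n) \<le> (\<Sum>n\<in>{N..<M}. v n * ?d n)"
          unfolding sum_distrib_left using N by (intro sum_mono mult_right_mono) auto
        also have "\<dots> \<le> (\<Sum>n<M. v n * ?d n)"
          using v1 by (intro sum_mono2) (auto intro!: mult_nonneg_nonneg order_trans[OF zero_le_one v1])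
        also have "\<dots> \<le> (\<Sum>n<M. 2 * (v n * (cmod (ell2_nth (f (s k)) n))\<^sup>2) + 2 * (v n * (cmod (a n))\<^sup>2))"
        proof (intro sum_mono)
          fix n
          have "v n * ?d n \<le> v n * (2 * (cmod (ell2_nth (f (s k)) n))\<^sup>2 + 2 * (cmod (a n))\<^sup>2)"
            using square_sum_le[of "ell2_nth (f (s k)) n" "- a n"] order_trans[OF zero_le_one v1[of n]]
            by (intro mult_left_mono) auto
          then show "v n * ?d n \<le> 2 * (v n * (cmod (ell2_nth (f (s k)) n))\<^sup>2) + 2 * (v n * (cmod (a n))\<^sup>2)"
            by (simp add: algebra_simps)
        qed
        also have "\<dots> \<le> 4 * C"
          using f[of "s k" M] aC[of M] by (simp add: sum.distrib sum_distrib_left[symmetric])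
        finally show ?thesis .
      qed
      then have "(\<Sum>n\<in>{N..<M}. ?d n) \<le> e / 2"
      proof -
        assume le: "(1 + 8 * C / e) * (\<Sum>n\<in>{N..<M}. ?d n) \<le> 4 * C"
        also have "4 * C \<le> (1 + 8 * C / e) * (e / 2)" using \<open>e > 0\<close> by (simp add: field_simps)
        finally show ?thesis
          using \<open>C \<ge> 0\<close> \<open>e > 0\<close> by (subst (asm) mult_le_cancel_left_pos) (auto intro: add_pos_nonneg)
      qed
      ultimately show "(\<Sum>n<M. (cmod (ell2_nth (f (s k) - x) n))\<^sup>2) \<le> e / 4 + e / 2"
        using K[OF that] by (simp add: x)
    qed
    then show "\<exists>K. \<forall>k\<ge>K. norm ((norm (f (s k) - x))\<^sup>2 - 0) < e"
    proof (intro exI[of _ K] allI impI)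
      fix k assume "K \<le> k"
      then have "(norm (f (s k) - x))\<^sup>2 \<le> e / 4 + e / 2" by fact
      then show "norm ((norm (f (s k) - x))\<^sup>2 - 0) < e" using \<open>e > 0\<close> by simp
    qed
  qed
  then have "(\<lambda>k. sqrt ((norm (f (s k) - x))\<^sup>2)) \<longlonglongrightarrow> sqrt 0" by (intro tendsto_intros)
  then have "(f \<circ> s) \<longlonglongrightarrow> x" by (simp add: LIM_zero_iff tendsto_norm_zero_iff o_def)
  then show "\<exists>l\<in>?K. \<exists>r. strict_mono r \<and> (f \<circ> r) \<longlonglongrightarrow> l" using \<open>x \<in> ?K\<close> s by blast
qed

section \<open>Area measure on the disc\<close>


text \<open>Boxes determine Lebesgue measure. Through this identification with the plane, integrals
  over the complex numbers become iterated real integrals, in either order.\<close>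

lemma lborel_complex_distr:
  "lborel = distr (lborel :: (real \<times> real) measure) borel (\<lambda>p. complex_of_real (fst p) + \<i> * of_real (snd p))"
    (is "_ = distr _ _ ?c")
proof (rule lborel_eqI)
  fix l u :: complex assume le: "\<And>b. b \<in> Basis \<Longrightarrow> l \<bullet> b \<le> u \<bullet> b"
  have le': "Re l \<le> Re u" "Im l \<le> Im u"
    using le[of 1] le[of \<i>] by (auto simp: Basis_complex_def)
  have B: "(Basis :: (real \<times> real) set) = {(1, 0), (0, 1)}" by (auto simp: Basis_prod_def)
  have "?c -` box l u = box (Re l, Im l) (Re u, Im u)"
    by (auto simp: box_def Basis_complex_def B)
  moreover have "?c \<in> borel_measurable borel" by (intro borel_measurable_continuous_onI continuous_intros)
  ultimately have "emeasure (distr lborel borel ?c) (box l u) = emeasure lborel (box (Re l, Im l) (Re u, Im u))"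
    by (subst emeasure_distr) auto
  also have "\<dots> = (\<Prod>b\<in>Basis. ((Re u, Im u) - (Re l, Im l)) \<bullet> b)"
    by (rule emeasure_lborel_box) (use le' in \<open>auto simp: B\<close>)
  also have "(\<Prod>b\<in>Basis. ((Re u, Im u) - (Re l, Im l)) \<bullet> b) = (\<Prod>b\<in>Basis. (u - l) \<bullet> b)"
    by (simp add: B Basis_complex_def)
  finally show "emeasure (distr lborel borel ?c) (box l u) = (\<Prod>b\<in>Basis. (u - l) \<bullet> b)" .
qed simp

lemma
  assumes [measurable]: "f \<in> borel_measurable (borel :: complex measure)"
  shows nn_integral_complex_xy: "(\<integral>\<^sup>+z. f z \<partial>lborel) = (\<integral>\<^sup>+x. \<integral>\<^sup>+y. f (of_real x + \<i> * of_real y) \<partial>lborel \<partial>lborel)"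
    and nn_integral_complex_yx: "(\<integral>\<^sup>+z. f z \<partial>lborel) = (\<integral>\<^sup>+y. \<integral>\<^sup>+x. f (of_real x + \<i> * of_real y) \<partial>lborel \<partial>lborel)"
proof -
  let ?c = "\<lambda>p. complex_of_real (fst p) + \<i> * of_real (snd p)"
  have [measurable]: "?c \<in> borel_measurable (borel :: (real \<times> real) measure)"
    by (intro borel_measurable_continuous_onI continuous_intros)
  have m: "(\<lambda>p. f (?c p)) \<in> borel_measurable (lborel \<Otimes>\<^sub>M lborel)" unfolding lborel_prod by measurable
  have eq: "(\<integral>\<^sup>+z. f z \<partial>lborel) = (\<integral>\<^sup>+p. f (?c p) \<partial>(lborel \<Otimes>\<^sub>M lborel))"
    unfolding lborel_prod by (subst lborel_complex_distr, subst nn_integral_distr) simp_all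
  show "(\<integral>\<^sup>+z. f z \<partial>lborel) = (\<integral>\<^sup>+x. \<integral>\<^sup>+y. f (of_real x + \<i> * of_real y) \<partial>lborel \<partial>lborel)"
    unfolding eq using lborel.nn_integral_fst[OF m] by simp
  show "(\<integral>\<^sup>+z. f z \<partial>lborel) = (\<integral>\<^sup>+y. \<integral>\<^sup>+x. f (of_real x + \<i> * of_real y) \<partial>lborel \<partial>lborel)"
    unfolding eq using lborel_pair.nn_integral_snd[OF m] by simp
qed

lemma nn_integral_real_translate:
  "f \<in> borel_measurable borel \<Longrightarrow> (\<integral>\<^sup>+x. f (x + c) \<partial>lborel) = (\<integral>\<^sup>+x. f x \<partial>(lborel :: real measure))"
  using nn_integral_real_affine[of f 1 c] by (simp add: add.commute)

text \<open>On each horizontal line the shear is a translation by a constant.\<close>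

lemma nn_integral_shear_Re:
  assumes [measurable]: "f \<in> borel_measurable (borel :: complex measure)"
  shows "(\<integral>\<^sup>+z. f (z + of_real (t * Im z)) \<partial>lborel) = (\<integral>\<^sup>+z. f z \<partial>lborel)"
proof -
  have [measurable]: "(\<lambda>z. z + complex_of_real (t * Im z)) \<in> borel_measurable borel"
    by (intro borel_measurable_continuous_onI continuous_intros)
  have "(\<integral>\<^sup>+x. f (of_real x + \<i> * of_real y + of_real (t * y)) \<partial>lborel)
      = (\<integral>\<^sup>+x. f (of_real x + \<i> * of_real y) \<partial>lborel)" for y
    using nn_integral_real_translate[of "\<lambda>x. f (of_real x + \<i> * of_real y)" "t * y"] by (simp add: algebra_simps)
  then show ?thesis by (simp add: nn_integral_complex_yx)
qed

lemma nn_integral_shear_Im: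
  assumes [measurable]: "f \<in> borel_measurable (borel :: complex measure)"
  shows "(\<integral>\<^sup>+z. f (z + \<i> * of_real (t * Re z)) \<partial>lborel) = (\<integral>\<^sup>+z. f z \<partial>lborel)"
proof -
  have [measurable]: "(\<lambda>z. z + \<i> * complex_of_real (t * Re z)) \<in> borel_measurable borel"
    by (intro borel_measurable_continuous_onI continuous_intros)
  have "(\<integral>\<^sup>+y. f (of_real x + \<i> * of_real y + \<i> * of_real (t * x)) \<partial>lborel)
      = (\<integral>\<^sup>+y. f (of_real x + \<i> * of_real y) \<partial>lborel)" for x
    using nn_integral_real_translate[of "\<lambda>y. f (of_real x + \<i> * of_real y)" "t * x"] by (simp add: algebra_simps)
  then show ?thesis by (simp add: nn_integral_complex_xy)
qed

text \<open>A rotation with non-real multiplier is a product of three shears.\<close>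

lemma nn_integral_rotate:
  assumes f: "f \<in> borel_measurable (borel :: complex measure)" and u: "cmod u = 1" "Im u \<noteq> 0"
  shows "(\<integral>\<^sup>+z. f (u * z) \<partial>lborel) = (\<integral>\<^sup>+z. f z \<partial>lborel)"
proof -
  \<comment> \<open>For \<open>u = cis \<theta>\<close> these are sin \<theta> and -tan(\<theta> /
    2). A horizontal shear by \<open>p\<close>, a vertical one by \<open>s\<close> and the
    horizontal one again compose to the rotation.\<close>
  define s p where "s = Im u" and "p = (Re u - 1) / Im u"
  define S T where "S z = z + complex_of_real (p * Im z)" and "T z = z + \<i> * complex_of_real (s * Re z)" for z
  have S [measurable]: "S \<in> borel_measurable borel" and T [measurable]: "T \<in> borel_measurable borel"
    unfolding S_def[abs_def] T_def[abs_def] by (intro borel_measurable_continuous_onI continuous_intros)+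
  have n: "(Re u)\<^sup>2 + (Im u)\<^sup>2 = 1" using u(1) by (metis cmod_power2 power_one)
  have 1: "1 + p * s = Re u" using u(2) by (simp add: p_def s_def)
  have 2: "p + p * Re u = - s"
  proof -
    have "(Re u - 1) * (1 + Re u) = - (s * s)" using n by (simp add: s_def power2_eq_square algebra_simps)
    moreover have "p + p * Re u = (Re u - 1) * (1 + Re u) / s" by (simp add: p_def s_def add_divide_distrib distrib_left)
    ultimately show ?thesis using u(2) by (simp add: s_def)
  qed
  have eq: "S (T (S z)) = u * z" for z
  proof (rule complex_eqI)
    have "Re (S (T (S z))) = (1 + p * s) * Re z + (p + p * (1 + p * s)) * Im z"
      by (simp add: S_def T_def algebra_simps)
    then show "Re (S (T (S z))) = Re (u * z)" unfolding 1 2 by (simp add: s_def)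
    have "Im (S (T (S z))) = s * Re z + (1 + p * s) * Im z"
      by (simp add: S_def T_def algebra_simps)
    then show "Im (S (T (S z))) = Im (u * z)" unfolding 1 by (simp add: s_def)
  qed
  have "(\<integral>\<^sup>+z. f (u * z) \<partial>lborel) = (\<integral>\<^sup>+z. f (S (T (S z))) \<partial>lborel)" by (simp add: eq)
  also have "\<dots> = (\<integral>\<^sup>+z. f (S (T z)) \<partial>lborel)"
    using nn_integral_shear_Re[of "\<lambda>z. f (S (T z))" p] f by (simp add: S_def)
  also have "\<dots> = (\<integral>\<^sup>+z. f (S z) \<partial>lborel)"
    using nn_integral_shear_Im[of "\<lambda>z. f (S z)" s] f by (simp add: T_def)
  also have "\<dots> = (\<integral>\<^sup>+z. f z \<partial>lborel)"
    using nn_integral_shear_Re[of f p] f by (simp add: S_def)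
  finally show ?thesis .
qed

lemma emeasure_disc_of_radius: "r \<ge> 0 \<Longrightarrow> emeasure lborel (cball (0::complex) r) = ennreal (pi * r\<^sup>2)"
  "r \<ge> 0 \<Longrightarrow> emeasure lborel (ball (c::complex) r) = ennreal (pi * r\<^sup>2)"
  using emeasure_cball[of r "0::complex"] emeasure_ball[of r c] by (simp_all add: unit_ball_vol_2)

lemma sets_dA [simp, measurable_cong]: "sets dA = sets borel" by (simp add: dA_def)

lemma space_dA [simp]: "space dA = UNIV" by (simp add: dA_def)

lemma emeasure_dA: "A \<in> sets borel \<Longrightarrow> emeasure dA A = emeasure lborel (disc \<inter> A) / ennreal pi"
  using emeasure_disc_of_radius(2)[of 1 0] by (simp add: dA_def)

interpretation dA: finite_measure dA
  by (rule finite_measureI) (simp add: emeasure_dA emeasure_disc_of_radius)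

lemma AE_dA_disc: "AE z in dA. z \<in> disc"
  unfolding dA_def by (rule AE_uniform_measureI) auto

lemma nn_integral_dA:
  "f \<in> borel_measurable borel \<Longrightarrow> (\<integral>\<^sup>+z. f z \<partial>dA) = (\<integral>\<^sup>+z. f z * indicator disc z \<partial>lborel) / ennreal pi"
  using emeasure_disc_of_radius(2)[of 1 0] by (simp add: dA_def nn_integral_uniform_measure)

lemma distr_dA_rotate:
  assumes "cmod u = 1" "Im u \<noteq> 0"
  shows "distr dA borel (\<lambda>z. u * z) = dA"
proof (rule measure_eqI)
  fix A assume "A \<in> sets (distr dA borel (\<lambda>z. u * z))"
  then have A [measurable]: "A \<in> sets borel" by simp
  have m [measurable]: "(\<lambda>z. u * z) \<in> borel_measurable borel"
    by (intro borel_measurable_continuous_onI continuous_intros)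
  have "emeasure (distr dA borel (\<lambda>z. u * z)) A = emeasure dA ((\<lambda>z. u * z) -` A)"
    by (subst emeasure_distr) auto
  also have "\<dots> = emeasure lborel (disc \<inter> (\<lambda>z. u * z) -` A) / ennreal pi"
    using measurable_sets[OF m A] by (intro emeasure_dA) simp
  also have "emeasure lborel (disc \<inter> (\<lambda>z. u * z) -` A) = (\<integral>\<^sup>+z. indicator (disc \<inter> A) (u * z) \<partial>lborel)"
  proof -
    have "(\<integral>\<^sup>+z. indicator (disc \<inter> A) (u * z) \<partial>lborel) = (\<integral>\<^sup>+z. indicator (disc \<inter> (\<lambda>z. u * z) -` A) z \<partial>lborel)"
      using assms(1) by (intro nn_integral_cong) (auto simp: indicator_def norm_mult)
    also have "\<dots> = emeasure lborel (disc \<inter> (\<lambda>z. u * z) -` A)"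
      using measurable_sets[OF m A] by (intro nn_integral_indicator) simp
    finally show ?thesis by simp
  qed
  also have "\<dots> = (\<integral>\<^sup>+z. indicator (disc \<inter> A) z \<partial>lborel)"
    using assms A by (intro nn_integral_rotate borel_measurable_indicator sets.Int) auto
  also have "\<dots> = emeasure lborel (disc \<inter> A)" by (intro nn_integral_indicator) simp
  finally show "emeasure (distr dA borel (\<lambda>z. u * z)) A = emeasure dA A"
    by (simp add: emeasure_dA)
qed simp

text \<open>The disc of radius sqrt(t) has the fraction t of the total area, so the squared modulus
  is uniformly distributed on the unit interval. This takes the place of polar coordinates for
  radial integrands.\<close>

lemma distr_dA_norm_squared:
  "distr dA borel (\<lambda>z. (cmod z)\<^sup>2) = uniform_measure lborel {0..1}"
proof (rule measure_eqI_lessThan)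
  fix x :: real
  have m [measurable]: "(\<lambda>z. (cmod z)\<^sup>2) \<in> borel_measurable borel" by measurable
  have eq: "emeasure (distr dA borel (\<lambda>z. (cmod z)\<^sup>2)) {x<..} = emeasure lborel (disc \<inter> {z. x < (cmod z)\<^sup>2}) / ennreal pi"
    by (subst emeasure_distr) (auto simp: emeasure_dA vimage_def)
  show "emeasure (distr dA borel (\<lambda>z. (cmod z)\<^sup>2)) {x<..} < \<infinity>"
    using finite_measure.emeasure_finite[OF dA.finite_measure_distr[of "\<lambda>z. (cmod z)\<^sup>2" borel]] by (simp add: less_top[symmetric])
  consider "x < 0" | "0 \<le> x" "x < 1" | "1 \<le> x" by linarith
  then show "emeasure (distr dA borel (\<lambda>z. (cmod z)\<^sup>2)) {x<..} = emeasure (uniform_measure lborel {0..1}) {x<..}"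
  proof cases
    case 1
    then have "disc \<inter> {z. x < (cmod z)\<^sup>2} = disc" "{0..1} \<inter> {x<..} = {0..1}"
      by (auto intro: less_le_trans[OF _ zero_le_power2])
    then show ?thesis by (simp add: eq emeasure_disc_of_radius)
  next
    case 2
    have "disc \<inter> {z. x < (cmod z)\<^sup>2} = disc - cball 0 (sqrt x)"
    proof -
      have "x < (cmod z)\<^sup>2 \<longleftrightarrow> sqrt x < cmod z" for z
        using real_sqrt_less_iff[of x "(cmod z)\<^sup>2"] by simp
      then have "{z::complex. x < (cmod z)\<^sup>2} = {z. sqrt x < cmod z}" by (intro Collect_cong)
      then show ?thesis by (auto simp: not_le)
    qed
    moreover have "cball (0::complex) (sqrt x) \<subseteq> disc"
    proof
      fix z :: complex assume "z \<in> cball 0 (sqrt x)"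
      then have "cmod z \<le> sqrt x" by simp
      also have "sqrt x < 1" using 2 by simp
      finally show "z \<in> disc" by simp
    qed
    moreover from this have "emeasure lborel (disc - cball 0 (sqrt x)) = ennreal (pi * 1\<^sup>2) - ennreal (pi * (sqrt x)\<^sup>2)"
      using 2 by (subst emeasure_Diff) (simp_all add: emeasure_disc_of_radius)
    ultimately have "emeasure (distr dA borel (\<lambda>z. (cmod z)\<^sup>2)) {x<..} = ennreal ((pi - pi * x) / pi)"
      using 2 by (simp add: eq ennreal_minus divide_ennreal mult_le_cancel_left1)
    also have "(pi - pi * x) / pi = 1 - x" by (simp add: field_simps)
    also have "{0..1} \<inter> {x<..} = {x<..1}" using 2 by auto
    then have "ennreal (1 - x) = emeasure (uniform_measure lborel {0..1}) {x<..}"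
      using 2 by (simp add: divide_ennreal_def)
    finally show ?thesis .
  next
    case 3
    have "\<not> x < (cmod z)\<^sup>2" if "z \<in> disc" for z
      using power_le_one[of "cmod z" 2] that 3 by simp
    then have "disc \<inter> {z. x < (cmod z)\<^sup>2} = {}" by blast
    moreover have "{0..1} \<inter> {x<..} = {}" using 3 by auto
    ultimately show ?thesis by (simp add: eq)
  qed
qed simp_all

lemma nn_integral_dA_radial:
  assumes [measurable]: "h \<in> borel_measurable borel"
  shows "(\<integral>\<^sup>+z. h ((cmod z)\<^sup>2) \<partial>dA) = (\<integral>\<^sup>+t. h t * indicator {0..1} t \<partial>lborel)"
proof -
  have "(\<integral>\<^sup>+z. h ((cmod z)\<^sup>2) \<partial>dA) = (\<integral>\<^sup>+t. h t \<partial>distr dA borel (\<lambda>z. (cmod z)\<^sup>2))"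
    by (subst nn_integral_distr) simp_all
  then show ?thesis
    unfolding distr_dA_norm_squared by (simp add: nn_integral_uniform_measure divide_ennreal_def)
qed

section \<open>The Parseval identity\<close>


lemma integrable_dA_bounded:
  fixes f :: "complex \<Rightarrow> 'a::{banach, second_countable_topology}"
  assumes "f \<in> borel_measurable borel" "\<And>z. z \<in> disc \<Longrightarrow> norm (f z) \<le> B"
  shows "integrable dA f"
proof (rule dA.integrable_const_bound)
  show "AE z in dA. norm (f z) \<le> B" using AE_dA_disc by eventually_elim (rule assms(2))
qed (use assms(1) in simp)

text \<open>A suitable rotation preserves the measure and multiplies the integrand by a constant
  other than 1.\<close>

lemma monomial_orthogonality_dA:
  assumes [measurable]: "w \<in> borel_measurable borel" and "n \<noteq> m"
  shows "(LINT z|dA. of_real (w ((cmod z)\<^sup>2)) * (z ^ n * cnj z ^ m)) = (0::complex)"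
proof -
  define d where "d = nat \<bar>int n - int m\<bar>"
  \<comment> \<open>With this angle \<open>u ^ d = \<i>\<close>, so the multiplier is
    \<open>\<i>\<close> or its conjugate. The angle lies strictly between 0 and pi, so
    \<open>u\<close> is not real, as the rotation lemma demands.\<close>
  define \<theta> where "\<theta> = pi / (2 * real d)"
  define u where "u = cis \<theta>"
  have d: "d \<ge> 1" using assms(2) by (simp add: d_def)
  have "\<theta> > 0" "\<theta> < pi" using d by (auto simp: \<theta>_def field_simps intro: less_le_trans[of _ "pi * 2"])
  then have Im: "Im u \<noteq> 0" using sin_gt_zero[of \<theta>] by (simp add: u_def)
  have norm_u: "cmod u = 1" by (simp add: u_def)
  have d\<theta>: "real d * \<theta> = pi / 2" using d by (simp add: \<theta>_def)
  have ud: "u ^ d = \<i>" unfolding u_def Complex.DeMoivre d\<theta> by (rule cis_pi_half)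
  have cu: "u * cnj u = 1" by (simp add: u_def cis_cnj cis_mult)
  have ne: "u ^ n * cnj u ^ m \<noteq> 1"
  proof (cases "n \<ge> m")
    case True
    then have "n = m + d" by (simp add: d_def)
    then have "u ^ n * cnj u ^ m = u ^ d * (u * cnj u) ^ m" by (simp add: power_add power_mult_distrib)
    then show ?thesis by (simp add: cu ud complex_eq_iff)
  next
    case False
    then have "m = n + d" by (simp add: d_def)
    then have "u ^ n * cnj u ^ m = cnj (u ^ d) * (u * cnj u) ^ n" by (simp add: power_add power_mult_distrib)
    then show ?thesis by (simp add: cu ud complex_eq_iff)
  qed
  define F where "F z = complex_of_real (w ((cmod z)\<^sup>2)) * (z ^ n * cnj z ^ m)" for z
  have cm [measurable]: "cnj \<in> borel_measurable borel" "(\<lambda>z. u * z) \<in> borel_measurable borel"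
    by (intro borel_measurable_continuous_onI continuous_intros)+
  have Fm [measurable]: "F \<in> borel_measurable borel" unfolding F_def[abs_def] by measurable
  have "(LINT z|dA. F z) = (LINT z|distr dA borel (\<lambda>z. u * z). F z)"
    by (simp add: distr_dA_rotate norm_u Im)
  also have "\<dots> = (LINT z|dA. F (u * z))" by (rule integral_distr) measurable
  also have "\<dots> = (LINT z|dA. (u ^ n * cnj u ^ m) * F z)"
    by (rule Bochner_Integration.integral_cong)
      (simp_all add: F_def norm_mult norm_u power_mult_distrib)
  also have "\<dots> = (u ^ n * cnj u ^ m) * (LINT z|dA. F z)" by simp
  finally have "(1 - u ^ n * cnj u ^ m) * (LINT z|dA. F z) = 0" by (simp add: algebra_simps)
  then have "(LINT z|dA. F z) = 0" using ne by simp
  then show ?thesis by (simp only: F_def)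
qed

abbreviation taylor_coeff :: "(complex \<Rightarrow> complex) \<Rightarrow> nat \<Rightarrow> complex" where
  "taylor_coeff f n \<equiv> (deriv ^^ n) f 0 / fact n"

lemma taylor_sums: "f holomorphic_on disc \<Longrightarrow> z \<in> disc \<Longrightarrow> (\<lambda>n. taylor_coeff f n * z ^ n) sums f z"
  using holomorphic_power_series[of f 0 1 z] by simp

lemma taylor_summable_norm:
  assumes "f holomorphic_on disc" "0 \<le> r" "r < 1"
  shows "summable (\<lambda>n. cmod (taylor_coeff f n) * r ^ n)"
proof -
  define s where "s = (1 + r) / 2"
  have s: "r < s" "s < 1" "0 \<le> s" using assms by (auto simp: s_def field_simps)
  have "summable (\<lambda>n. taylor_coeff f n * (of_real s) ^ n)"
    using taylor_sums[OF assms(1), of "of_real s"] s by (simp add: sums_iff)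
  then have "summable (\<lambda>n. norm (taylor_coeff f n * (of_real r) ^ n))"
    by (rule powser_insidea) (use s assms in simp)
  then show ?thesis using assms(2) by (simp only: norm_mult norm_power norm_of_real abs_of_nonneg)
qed

lemma borel_measurable_disc_indicator:
  assumes "f holomorphic_on disc"
  shows "(\<lambda>z. if z \<in> disc then f z else 0) \<in> borel_measurable borel"
proof -
  have "(\<lambda>z. indicator disc z *\<^sub>R f z) \<in> borel_measurable borel"
    by (intro borel_measurable_continuous_on_indicator holomorphic_on_imp_continuous_on assms) simp
  moreover have "(\<lambda>z. indicator disc z *\<^sub>R f z) = (\<lambda>z. if z \<in> disc then f z else 0)"
    by (auto simp: indicator_def)
  ultimately show ?thesis by simp
qed

lemma norm_power_cnj: "complex_of_real ((cmod z)\<^sup>2 ^ n) = z ^ n * cnj z ^ n"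
  by (metis complex_norm_square of_real_power power_mult_distrib)

text \<open>A bounded weight vanishing beyond radius \<open>r\<close> confines the integral to a
  disc on which the Taylor sums are uniformly bounded. Dominated convergence then applies, and
  orthogonality leaves only the diagonal of each partial sum.\<close>

lemma parseval_bounded_weight:
  assumes f: "f holomorphic_on disc" and w [measurable]: "w \<in> borel_measurable borel"
    and bdd: "\<And>t. 0 \<le> w t" "\<And>t. w t \<le> B" and supp: "\<And>t. t > r\<^sup>2 \<Longrightarrow> w t = 0" and r: "0 \<le> r" "r < 1"
  shows "(\<lambda>n. (cmod (taylor_coeff f n))\<^sup>2 * (LINT z|dA. w ((cmod z)\<^sup>2) * (cmod z)\<^sup>2 ^ n)) sums
    (LINT z|dA. w ((cmod z)\<^sup>2) * (cmod (if z \<in> disc then f z else 0))\<^sup>2)"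
proof -
  define a where "a n = taylor_coeff f n" for n
  let ?f = "\<lambda>z. if z \<in> disc then f z else 0"
  define s where "s N z = (\<Sum>n<N. a n * z ^ n)" for N z
  have B: "B \<ge> 0" using bdd order_trans by blast
  have cm [measurable]: "cnj \<in> borel_measurable borel"
    by (intro borel_measurable_continuous_onI continuous_intros)
  have fm [measurable]: "?f \<in> borel_measurable borel" by (rule borel_measurable_disc_indicator[OF f])
  have sm [measurable]: "s N \<in> borel_measurable borel" for N unfolding s_def[abs_def] by measurable
  have int: "integrable dA (\<lambda>z. of_real (w ((cmod z)\<^sup>2)) * (z ^ n * cnj z ^ m) :: complex)" for n m
  proof (rule integrable_dA_bounded[where B = B])
    fix z :: complex assume "z \<in> disc"
    then have "cmod z ^ n * cmod z ^ m \<le> 1" by (simp add: mult_le_one power_le_one)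
    then have "w ((cmod z)\<^sup>2) * (cmod z ^ n * cmod z ^ m) \<le> B * 1"
      using bdd B by (intro mult_mono) auto
    then show "norm (of_real (w ((cmod z)\<^sup>2)) * (z ^ n * cnj z ^ m) :: complex) \<le> B"
      using bdd by (simp add: norm_mult norm_power)
  qed measurable
  have part: "(LINT z|dA. w ((cmod z)\<^sup>2) * (cmod (s N z))\<^sup>2)
    = (\<Sum>n<N. (cmod (a n))\<^sup>2 * (LINT z|dA. w ((cmod z)\<^sup>2) * (cmod z)\<^sup>2 ^ n))" for N
  proof -
    have "of_real (w ((cmod z)\<^sup>2) * (cmod (s N z))\<^sup>2)
      = (\<Sum>n<N. \<Sum>m<N. (a n * cnj (a m)) * (of_real (w ((cmod z)\<^sup>2)) * (z ^ n * cnj z ^ m)))" for z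
      unfolding of_real_mult complex_norm_square
      by (simp add: s_def sum_product sum_distrib_left mult_ac) (rule sum.swap)
    then have "of_real (LINT z|dA. w ((cmod z)\<^sup>2) * (cmod (s N z))\<^sup>2)
      = (LINT z|dA. (\<Sum>n<N. \<Sum>m<N. (a n * cnj (a m)) * (of_real (w ((cmod z)\<^sup>2)) * (z ^ n * cnj z ^ m))))"
      by (simp only: integral_complex_of_real[symmetric])
    also have "\<dots> = (\<Sum>n<N. \<Sum>m<N. (a n * cnj (a m)) * (LINT z|dA. of_real (w ((cmod z)\<^sup>2)) * (z ^ n * cnj z ^ m)))"
      by (simp add: Bochner_Integration.integral_sum int)
    also have "\<dots> = (\<Sum>n<N. \<Sum>m<N. if m = n then (a n * cnj (a n)) * (LINT z|dA. of_real (w ((cmod z)\<^sup>2)) * (z ^ n * cnj z ^ n)) else 0)"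
      by (intro sum.cong refl) (auto simp: monomial_orthogonality_dA[OF w])
    also have "\<dots> = (\<Sum>n<N. (a n * cnj (a n)) * (LINT z|dA. of_real (w ((cmod z)\<^sup>2)) * (z ^ n * cnj z ^ n)))"
      by simp
    also have "\<dots> = (\<Sum>n<N. of_real ((cmod (a n))\<^sup>2) * (LINT z|dA. of_real (w ((cmod z)\<^sup>2) * (cmod z)\<^sup>2 ^ n)))"
      by (simp only: of_real_mult complex_norm_square norm_power_cnj)
    also have "\<dots> = of_real (\<Sum>n<N. (cmod (a n))\<^sup>2 * (LINT z|dA. w ((cmod z)\<^sup>2) * (cmod z)\<^sup>2 ^ n))"
      unfolding integral_complex_of_real by (simp only: of_real_sum of_real_mult)
    finally show ?thesis by (simp only: of_real_eq_iff)
  qed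
  define S where "S = (\<Sum>n. cmod (a n) * r ^ n)"
  have s_le: "cmod (s N z) \<le> S" if "cmod z \<le> r" for N z
  proof -
    have "cmod (s N z) \<le> (\<Sum>n<N. cmod (a n) * cmod z ^ n)"
      unfolding s_def by (rule order_trans[OF norm_sum]) (simp add: norm_mult norm_power)
    also have "\<dots> \<le> (\<Sum>n<N. cmod (a n) * r ^ n)"
      using that by (intro sum_mono mult_left_mono power_mono) auto
    also have "\<dots> \<le> S" unfolding S_def
      by (intro sum_le_suminf taylor_summable_norm[OF f r, folded a_def]) (use r in auto)
    finally show ?thesis .
  qed
  have "S \<ge> 0" using s_le[of 0 0] r by (simp add: s_def)
  have bound: "norm (w ((cmod z)\<^sup>2) * (cmod (s N z))\<^sup>2) \<le> B * S\<^sup>2" for N z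
  proof (cases "cmod z \<le> r")
    case True
    then show ?thesis using bdd s_le[OF True] B
      by (auto simp: norm_mult intro!: mult_mono power_mono)
  next
    case False
    then have "w ((cmod z)\<^sup>2) = 0" using r by (intro supp power_strict_mono) auto
    then show ?thesis using B by simp
  qed
  have "(\<lambda>N. LINT z|dA. w ((cmod z)\<^sup>2) * (cmod (s N z))\<^sup>2) \<longlonglongrightarrow> (LINT z|dA. w ((cmod z)\<^sup>2) * (cmod (?f z))\<^sup>2)"
  proof (rule integral_dominated_convergence[where w = "\<lambda>_. B * S\<^sup>2"])
    show "AE z in dA. (\<lambda>N. w ((cmod z)\<^sup>2) * (cmod (s N z))\<^sup>2) \<longlonglongrightarrow> w ((cmod z)\<^sup>2) * (cmod (?f z))\<^sup>2"
      using AE_dA_disc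
    proof (rule AE_mp, intro AE_I2 impI)
      fix z assume "z \<in> disc"
      then have "(\<lambda>N. s N z) \<longlonglongrightarrow> ?f z" using taylor_sums[OF f] by (simp add: s_def sums_def a_def)
      then show "(\<lambda>N. w ((cmod z)\<^sup>2) * (cmod (s N z))\<^sup>2) \<longlonglongrightarrow> w ((cmod z)\<^sup>2) * (cmod (?f z))\<^sup>2"
        by (intro tendsto_intros)
    qed
    show "(\<lambda>z. w ((cmod z)\<^sup>2) * (cmod (?f z))\<^sup>2) \<in> borel_measurable dA" by measurable
    show "(\<lambda>z. w ((cmod z)\<^sup>2) * (cmod (s N z))\<^sup>2) \<in> borel_measurable dA" for N by measurable
    show "integrable dA (\<lambda>_. B * S\<^sup>2)" by simp
    show "AE z in dA. norm (w ((cmod z)\<^sup>2) * (cmod (s N z))\<^sup>2) \<le> B * S\<^sup>2" for N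
      by (intro AE_I2 bound)
  qed
  then show ?thesis unfolding part sums_def a_def .
qed

text \<open>Monotone convergence from weights \<open>v k\<close> cut at height \<open>k\<close> and
  at radius 1 - 1 / (k + 1), applied to the function on one side and to every monomial on the other.
  With values in the extended non-negative reals the identity also covers divergent sums, so it can
  decide membership in the spaces.\<close>

lemma parseval_weight:
  assumes f: "f holomorphic_on disc" and w [measurable]: "w \<in> borel_measurable borel" and w0: "\<And>t. 0 \<le> w t"
  shows "(\<integral>\<^sup>+z. ennreal (w ((cmod z)\<^sup>2) * (cmod (f z))\<^sup>2) \<partial>dA) =
    (\<Sum>n. ennreal ((cmod (taylor_coeff f n))\<^sup>2) * (\<integral>\<^sup>+z. ennreal (w ((cmod z)\<^sup>2) * (cmod z)\<^sup>2 ^ n) \<partial>dA))"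
proof -
  let ?f = "\<lambda>z. if z \<in> disc then f z else 0"
  have fm [measurable]: "?f \<in> borel_measurable borel" by (rule borel_measurable_disc_indicator[OF f])
  define v where "v k t = (if t \<le> (1 - 1 / real (Suc k))\<^sup>2 then min (w t) (real k) else 0)" for k t
  have vm [measurable]: "v k \<in> borel_measurable borel" for k unfolding v_def[abs_def] by measurable
  have v: "0 \<le> v k t" "v k t \<le> real k" for k t using w0 by (auto simp: v_def)
  have mono_r: "(1 - 1 / real (Suc k))\<^sup>2 \<le> (1 - 1 / real (Suc (Suc k)))\<^sup>2" for k
    by (intro power_mono diff_left_mono divide_left_mono) auto
  have v_mono: "v k t \<le> v (Suc k) t" for k t
  proof (cases "t \<le> (1 - 1 / real (Suc k))\<^sup>2")
    case True
    then show ?thesis using order_trans[OF True mono_r] by (simp add: v_def del: of_nat_Suc)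
  next
    case False
    then have "v k t = 0" by (simp add: v_def)
    then show ?thesis using v(1) by simp
  qed
  have v_lim: "(\<lambda>k. v k t) \<longlonglongrightarrow> w t" if "0 \<le> t" "t < 1" for t
  proof (rule tendsto_eventually)
    have "(\<lambda>k. (1 - 1 / real (Suc k))\<^sup>2) \<longlonglongrightarrow> (1 - 0)\<^sup>2"
      by (intro tendsto_intros LIMSEQ_Suc[OF lim_1_over_n])
    then have "\<forall>\<^sub>F k in sequentially. (1 - 1 / real (Suc k))\<^sup>2 > t" using that(2) by (auto dest: order_tendstoD(1))
    moreover have "\<forall>\<^sub>F k in sequentially. real k \<ge> w t"
      using filterlim_real_sequentially unfolding filterlim_at_top by blast
    ultimately show "\<forall>\<^sub>F k in sequentially. v k t = w t" by eventually_elim (auto simp: v_def)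
  qed
  have step: "(\<integral>\<^sup>+z. ennreal (v k ((cmod z)\<^sup>2) * (cmod (?f z))\<^sup>2) \<partial>dA) =
      (\<Sum>n. ennreal ((cmod (taylor_coeff f n))\<^sup>2) * (\<integral>\<^sup>+z. ennreal (v k ((cmod z)\<^sup>2) * (cmod z)\<^sup>2 ^ n) \<partial>dA))" for k
  proof -
    let ?r = "1 - 1 / real (Suc k)"
    have r: "0 \<le> ?r" "?r < 1" by auto
    have sums: "(\<lambda>n. (cmod (taylor_coeff f n))\<^sup>2 * (LINT z|dA. v k ((cmod z)\<^sup>2) * (cmod z)\<^sup>2 ^ n)) sums
      (LINT z|dA. v k ((cmod z)\<^sup>2) * (cmod (?f z))\<^sup>2)"
      by (rule parseval_bounded_weight[OF f vm, where B = k and r = ?r])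
        (use v r in \<open>auto simp: v_def\<close>)
    have int1: "integrable dA (\<lambda>z. v k ((cmod z)\<^sup>2) * (cmod z)\<^sup>2 ^ n)" for n
    proof (rule integrable_dA_bounded[where B = k])
      fix z assume "z \<in> disc"
      then have "v k ((cmod z)\<^sup>2) * (cmod z)\<^sup>2 ^ n \<le> real k * 1"
        using v by (intro mult_mono power_le_one) auto
      then show "norm (v k ((cmod z)\<^sup>2) * (cmod z)\<^sup>2 ^ n) \<le> real k" using v by simp
    qed measurable
    have "cball 0 ?r \<subseteq> disc"
    proof
      fix z :: complex assume "z \<in> cball 0 ?r"
      then have "cmod z \<le> ?r" by simp
      also have "?r < 1" by (rule r)
      finally show "z \<in> disc" by simp
    qed
    then have "bounded (f ` cball 0 ?r)"
      by (intro compact_imp_bounded compact_continuous_image holomorphic_on_imp_continuous_on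
          holomorphic_on_subset[OF f] compact_cball)
    then obtain C where C: "\<And>z. z \<in> cball 0 ?r \<Longrightarrow> cmod (f z) \<le> C" unfolding bounded_iff by blast
    have int2: "integrable dA (\<lambda>z. v k ((cmod z)\<^sup>2) * (cmod (?f z))\<^sup>2)"
    proof (rule integrable_dA_bounded[where B = "k * C\<^sup>2"])
      fix z assume z: "z \<in> disc"
      show "norm (v k ((cmod z)\<^sup>2) * (cmod (?f z))\<^sup>2) \<le> k * C\<^sup>2"
      proof (cases "cmod z \<le> ?r")
        case True
        then show ?thesis using v C[of z] z by (auto simp: norm_mult intro!: mult_mono power_mono)
      next
        case False
        then have "(cmod z)\<^sup>2 > ?r\<^sup>2" using r by (intro power_strict_mono) auto
        then have "\<not> (cmod z)\<^sup>2 \<le> ?r\<^sup>2" by (simp only: not_le not_False_eq_True)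
        then have "v k ((cmod z)\<^sup>2) = 0" unfolding v_def by (rule if_not_P)
        then show ?thesis by simp
      qed
    qed measurable
    have nn1: "(\<integral>\<^sup>+z. ennreal (v k ((cmod z)\<^sup>2) * (cmod z)\<^sup>2 ^ n) \<partial>dA) = ennreal (LINT z|dA. v k ((cmod z)\<^sup>2) * (cmod z)\<^sup>2 ^ n)" for n
      using v by (intro nn_integral_eq_integral int1) auto
    have nn2: "(\<integral>\<^sup>+z. ennreal (v k ((cmod z)\<^sup>2) * (cmod (?f z))\<^sup>2) \<partial>dA) = ennreal (LINT z|dA. v k ((cmod z)\<^sup>2) * (cmod (?f z))\<^sup>2)"
      using v by (intro nn_integral_eq_integral int2) auto
    have nonneg: "0 \<le> (LINT z|dA. v k ((cmod z)\<^sup>2) * (cmod z)\<^sup>2 ^ n)" for n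
      using v by (intro Bochner_Integration.integral_nonneg) auto
    have "(\<Sum>n. ennreal ((cmod (taylor_coeff f n))\<^sup>2 * (LINT z|dA. v k ((cmod z)\<^sup>2) * (cmod z)\<^sup>2 ^ n)))
      = ennreal (LINT z|dA. v k ((cmod z)\<^sup>2) * (cmod (?f z))\<^sup>2)"
      using nonneg by (intro suminf_ennreal_eq sums) auto
    then show ?thesis unfolding nn1 nn2 using nonneg by (simp add: ennreal_mult)
  qed
  have lim_gen: "(\<integral>\<^sup>+z. ennreal (w ((cmod z)\<^sup>2) * h z) \<partial>dA) = (SUP k. \<integral>\<^sup>+z. ennreal (v k ((cmod z)\<^sup>2) * h z) \<partial>dA)"
    if [measurable]: "h \<in> borel_measurable borel" and h0: "\<And>z. 0 \<le> h z" for h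
  proof -
    have "(\<integral>\<^sup>+z. ennreal (w ((cmod z)\<^sup>2) * h z) \<partial>dA) = (\<integral>\<^sup>+z. (SUP k. ennreal (v k ((cmod z)\<^sup>2) * h z)) \<partial>dA)"
    proof (rule nn_integral_cong_AE, rule AE_mp[OF AE_dA_disc], intro AE_I2 impI)
      fix z assume "z \<in> disc"
      then have "(\<lambda>k. v k ((cmod z)\<^sup>2) * h z) \<longlonglongrightarrow> w ((cmod z)\<^sup>2) * h z"
        by (intro tendsto_intros v_lim) (auto simp: power_less_one_iff)
      then have "(\<lambda>k. ennreal (v k ((cmod z)\<^sup>2) * h z)) \<longlonglongrightarrow> ennreal (w ((cmod z)\<^sup>2) * h z)"
        by (rule tendsto_ennrealI)
      moreover have "incseq (\<lambda>k. ennreal (v k ((cmod z)\<^sup>2) * h z))"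
        by (intro incseq_SucI ennreal_leI mult_right_mono v_mono h0)
      ultimately show "ennreal (w ((cmod z)\<^sup>2) * h z) = (SUP k. ennreal (v k ((cmod z)\<^sup>2) * h z))"
        using LIMSEQ_SUP LIMSEQ_unique by blast
    qed
    also have "\<dots> = (SUP k. \<integral>\<^sup>+z. ennreal (v k ((cmod z)\<^sup>2) * h z) \<partial>dA)"
      by (intro nn_integral_monotone_convergence_SUP incseq_SucI le_funI ennreal_leI mult_right_mono v_mono h0) measurable
    finally show ?thesis .
  qed
  have "(\<integral>\<^sup>+z. ennreal (w ((cmod z)\<^sup>2) * (cmod (f z))\<^sup>2) \<partial>dA) = (\<integral>\<^sup>+z. ennreal (w ((cmod z)\<^sup>2) * (cmod (?f z))\<^sup>2) \<partial>dA)"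
    by (rule nn_integral_cong_AE, rule AE_mp[OF AE_dA_disc]) auto
  also have "\<dots> = (SUP k. \<integral>\<^sup>+z. ennreal (v k ((cmod z)\<^sup>2) * (cmod (?f z))\<^sup>2) \<partial>dA)"
    by (rule lim_gen[OF borel_measurable_power[OF measurable_compose[OF fm borel_measurable_norm]]]) simp
  also have "\<dots> = (SUP k. \<Sum>n. ennreal ((cmod (taylor_coeff f n))\<^sup>2) * (\<integral>\<^sup>+z. ennreal (v k ((cmod z)\<^sup>2) * (cmod z)\<^sup>2 ^ n) \<partial>dA))"
    by (simp only: step)
  also have "\<dots> = (\<Sum>n. SUP k. ennreal ((cmod (taylor_coeff f n))\<^sup>2) * (\<integral>\<^sup>+z. ennreal (v k ((cmod z)\<^sup>2) * (cmod z)\<^sup>2 ^ n) \<partial>dA))"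
    by (intro ennreal_suminf_SUP_eq[symmetric] incseq_SucI mult_left_mono nn_integral_mono ennreal_leI mult_right_mono v_mono) auto
  also have "\<dots> = (\<Sum>n. ennreal ((cmod (taylor_coeff f n))\<^sup>2) * (SUP k. \<integral>\<^sup>+z. ennreal (v k ((cmod z)\<^sup>2) * (cmod z)\<^sup>2 ^ n) \<partial>dA))"
    by (simp add: SUP_mult_left_ennreal)
  also have "\<dots> = (\<Sum>n. ennreal ((cmod (taylor_coeff f n))\<^sup>2) * (\<integral>\<^sup>+z. ennreal (w ((cmod z)\<^sup>2) * (cmod z)\<^sup>2 ^ n) \<partial>dA))"
    by (subst lim_gen) auto
  finally show ?thesis .
qed

lemma moment_dA:
  assumes "\<beta> > -1"
  shows "(\<integral>\<^sup>+z. ennreal ((1 - (cmod z)\<^sup>2) powr \<beta> * (cmod z)\<^sup>2 ^ n) \<partial>dA) = ennreal (Beta (real n + 1) (\<beta> + 1))"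
proof -
  have "((\<lambda>t. t powr (real n + 1 - 1) * (1 - t) powr (\<beta> + 1 - 1)) has_integral Beta (real n + 1) (\<beta> + 1)) {0..1}"
    using assms by (intro has_integral_Beta_real) auto
  \<comment> \<open>The integrands can differ at 0: for \<open>n = 0\<close>,
    \<open>0 powr 0\<close> is 0 but \<open>0 ^ 0\<close> is 1.\<close>
  then have "((\<lambda>t. (1 - t) powr \<beta> * t ^ n) has_integral Beta (real n + 1) (\<beta> + 1)) {0..1}"
    by (rule has_integral_spike_finite[of "{0}", rotated 2]) (auto simp: powr_realpow)
  then have "(\<integral>\<^sup>+t. ennreal ((1 - t) powr \<beta> * t ^ n) * indicator {0..1} t \<partial>lborel) = ennreal (Beta (real n + 1) (\<beta> + 1))"
    using nn_integral_has_integral_lebesgue[of "{0..1}" "\<lambda>t. (1 - t) powr \<beta> * t ^ n"]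
    by (simp add: ennreal_mult' ennreal_indicator mult.commute)
  then show ?thesis
    by (subst nn_integral_dA_radial[where h = "\<lambda>t. ennreal ((1 - t) powr \<beta> * t ^ n)"]) auto
qed

theorem parseval_dA:
  assumes "f holomorphic_on disc" "\<beta> > -1"
  shows "(\<integral>\<^sup>+z. ennreal ((1 - (cmod z)\<^sup>2) powr \<beta> * (cmod (f z))\<^sup>2) \<partial>dA) =
    (\<Sum>n. ennreal ((cmod (taylor_coeff f n))\<^sup>2 * Beta (real n + 1) (\<beta> + 1)))"
proof -
  have "Beta (real n + 1) (\<beta> + 1) \<ge> 0" for n
    using assms(2) by (simp add: Beta_def Gamma_real_pos less_imp_le)
  then show ?thesis
    using parseval_weight[OF assms(1), of "\<lambda>t. (1 - t) powr \<beta>"] moment_dA[OF assms(2)]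
    by (simp add: ennreal_mult')
qed

section \<open>Weighted Bergman spaces in coordinates\<close>


lemma taylor_coeff_unique:
  assumes "\<And>z. z \<in> disc \<Longrightarrow> (\<lambda>n. a n * z ^ n) sums f z"
  shows "taylor_coeff f n = a n"
proof -
  have "f has_fps_expansion Abs_fps a"
  proof (rule has_fps_expansionI)
    have "\<forall>\<^sub>F u in nhds 0. u \<in> (disc :: complex set)" by (intro eventually_nhds_in_open) auto
    then show "\<forall>\<^sub>F u in nhds 0. (\<lambda>n. fps_nth (Abs_fps a) n * u ^ n) sums f u"
      by eventually_elim (simp add: assms)
  qed
  from fps_nth_fps_expansion[OF this, of n] show ?thesis by simp
qed

lemma analytic_disc_eqI:
  assumes "f \<in> analytic_disc" "g \<in> analytic_disc" "\<And>n. taylor_coeff f n = taylor_coeff g n"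
  shows "f = g"
proof
  fix z
  show "f z = g z"
  proof (cases "z \<in> disc")
    case True
    then have "(\<lambda>n. taylor_coeff f n * z ^ n) sums f z" "(\<lambda>n. taylor_coeff f n * z ^ n) sums g z"
      using taylor_sums[of f z] taylor_sums[of g z] assms by (auto simp: analytic_disc_def)
    then show ?thesis by (rule sums_unique2)
  next
    case False
    then show ?thesis using assms by (simp add: analytic_disc_def)
  qed
qed

lemma analytic_disc_measurable [measurable_dest]:
  assumes "f \<in> analytic_disc" shows "f \<in> borel_measurable borel"
proof -
  have "(\<lambda>z. if z \<in> disc then f z else 0) = f" using assms by (auto simp: analytic_disc_def)
  then show ?thesis using borel_measurable_disc_indicator[of f] assms by (simp add: analytic_disc_def)
qed

lemma analytic_disc_mult:
  "\<phi> holomorphic_on disc \<Longrightarrow> g \<in> analytic_disc \<Longrightarrow> (\<lambda>z. \<phi> z * g z) \<in> analytic_disc"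
  by (auto simp: analytic_disc_def intro: holomorphic_intros)

lemma ennreal_suminf_finite_iff:
  assumes "\<And>n. 0 \<le> f n"
  shows "(\<Sum>n. ennreal (f n)) < \<infinity> \<longleftrightarrow> summable f"
proof
  assume "(\<Sum>n. ennreal (f n)) < \<infinity>"
  then show "summable f" by (intro summable_suminf_not_top assms) simp
next
  assume "summable f"
  then show "(\<Sum>n. ennreal (f n)) < \<infinity>" by (subst suminf_ennreal2[OF assms]) simp_all
qed

lemma Beta_nonneg: "x > 0 \<Longrightarrow> y > 0 \<Longrightarrow> Beta x y > (0::real)"
  by (simp add: Beta_def Gamma_real_pos)

text \<open>Off the closed disc \<open>f\<close> vanishes identically and so do its derivatives. On
  the unit circle, where \<open>deriv\<close> has no controlled value, the weight is
  \<open>0 powr \<gamma> = 0\<close>.\<close>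

lemma higher_deriv_measurable:
  assumes "f \<in> analytic_disc"
  shows "(\<lambda>z. (1 - (cmod z)\<^sup>2) powr \<gamma> * (cmod ((deriv ^^ k) f z))\<^sup>2) \<in> borel_measurable borel"
proof -
  have hol: "(deriv ^^ k) f holomorphic_on disc"
    using assms by (intro holomorphic_higher_deriv) (auto simp: analytic_disc_def)
  have "(deriv ^^ k) f z = 0" if "cmod z > 1" for z
  proof -
    have "(deriv ^^ k) f z = (deriv ^^ k) (\<lambda>_. 0) z"
      by (rule higher_deriv_transform_within_open[where S = "- cball 0 1"])
        (use that assms in \<open>auto simp: analytic_disc_def intro: holomorphic_transform[of "\<lambda>_. 0"]\<close>)
    then show ?thesis by simp
  qed
  then have eq: "(1 - (cmod z)\<^sup>2) powr \<gamma> * (cmod ((deriv ^^ k) f z))\<^sup>2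
      = (1 - (cmod z)\<^sup>2) powr \<gamma> * (cmod (if z \<in> disc then (deriv ^^ k) f z else 0))\<^sup>2" for z
    by (cases "cmod z = 1") auto
  show ?thesis unfolding eq
    by (intro borel_measurable_times borel_measurable_power
        measurable_compose[OF borel_measurable_disc_indicator[OF hol] borel_measurable_norm]) measurable
qed

lemma A2_iff:
  assumes "f \<in> analytic_disc" "2 * real k + \<gamma> > -1"
  shows "f \<in> A2 k \<gamma> \<longleftrightarrow>
    summable (\<lambda>n. (cmod (taylor_coeff ((deriv ^^ k) f) n))\<^sup>2 * Beta (real n + 1) (2 * real k + \<gamma> + 1))"
proof -
  have hol: "(deriv ^^ k) f holomorphic_on disc"
    using assms by (intro holomorphic_higher_deriv) (auto simp: analytic_disc_def)
  have nonneg: "0 \<le> (cmod (taylor_coeff ((deriv ^^ k) f) n))\<^sup>2 * Beta (real n + 1) (2 * real k + \<gamma> + 1)" for n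
    using assms(2) by (intro mult_nonneg_nonneg less_imp_le[OF Beta_nonneg]) auto
  have "f \<in> A2 k \<gamma> \<longleftrightarrow> (\<integral>\<^sup>+z. ennreal ((1 - (cmod z)\<^sup>2) powr (2 * real k + \<gamma>) * (cmod ((deriv ^^ k) f z))\<^sup>2) \<partial>dA) < \<infinity>"
    unfolding A2_def using assms(1) higher_deriv_measurable[OF assms(1)]
    by (simp add: integrable_iff_bounded)
  also have "\<dots> \<longleftrightarrow> summable (\<lambda>n. (cmod (taylor_coeff ((deriv ^^ k) f) n))\<^sup>2 * Beta (real n + 1) (2 * real k + \<gamma> + 1))"
    unfolding parseval_dA[OF hol assms(2)] by (rule ennreal_suminf_finite_iff[OF nonneg])
  finally show ?thesis .
qed

section \<open>Norms of monomials and the coordinate maps\<close>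

locale bergman_weight =
  fixes \<alpha> :: real
  assumes \<alpha>: "\<alpha> > -1"
begin

text \<open>The squared norm of the monomial of degree \<open>n\<close> in
  \<open>bergman \<alpha>\<close>, equal to n! Gamma(\<alpha> + 2) / Gamma(n + \<alpha> +
  2).\<close>

definition wt :: "nat \<Rightarrow> real" where "wt n = (\<alpha> + 1) * Beta (real n + 1) (\<alpha> + 1)"

lemma wt_pos: "wt n > 0"
  using \<alpha> by (simp add: wt_def Beta_nonneg)

lemma wt_Suc: "(real n + \<alpha> + 2) * wt (Suc n) = (real n + 1) * wt n"
proof -
  have "real n + 1 \<notin> \<int>\<^sub>\<le>\<^sub>0" by (auto elim!: nonpos_Ints_cases)
  from Beta_plus1_left[OF this, of "\<alpha> + 1"]
  have "(real n + \<alpha> + 2) * Beta (real n + 2) (\<alpha> + 1) = (real n + 1) * Beta (real n + 1) (\<alpha> + 1)"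
    by (simp add: algebra_simps)
  from arg_cong[OF this, of "\<lambda>x. (\<alpha> + 1) * x"] show ?thesis by (simp add: wt_def algebra_simps)
qed

lemma wt_0: "wt 0 = 1"
proof -
  have "\<alpha> + 1 \<notin> \<int>\<^sub>\<le>\<^sub>0"
  proof
    assume "\<alpha> + 1 \<in> \<int>\<^sub>\<le>\<^sub>0"
    then have "\<alpha> + 1 \<le> 0" by (rule nonpos_Ints_nonpos)
    then show False using \<alpha> by simp
  qed
  then have "Gamma (1 + (\<alpha> + 1)) = (\<alpha> + 1) * Gamma (\<alpha> + 1)"
    by (subst add.commute) (rule Gamma_plus1)
  moreover have "Gamma (\<alpha> + 1) > 0" using \<alpha> by (intro Gamma_real_pos) simp
  ultimately have "Beta (1::real) (\<alpha> + 1) = 1 / (\<alpha> + 1)"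
    unfolding Beta_def by simp
  then show ?thesis using \<alpha> by (simp add: wt_def)
qed

lemma wt_eq: "1 / wt n = pochhammer (\<alpha> + 2) n / fact n"
proof (induction n)
  case (Suc n)
  have "1 / wt (Suc n) = (real n + \<alpha> + 2) / (real n + 1) * (1 / wt n)"
  proof -
    have "wt (Suc n) = (real n + 1) * wt n / (real n + \<alpha> + 2)"
      using wt_Suc[of n] \<alpha> by (simp add: eq_divide_eq mult.commute)
    then show ?thesis by simp
  qed
  also have "\<dots> = pochhammer (\<alpha> + 2) (Suc n) / fact (Suc n)"
    unfolding Suc by (simp add: pochhammer_Suc field_simps)
  finally show ?case .
qed (simp add: wt_0)

lemma wt_le_1: "wt n \<le> 1"
proof (induction n)
  case (Suc n)
  have "(real n + \<alpha> + 2) * wt (Suc n) \<le> (real n + \<alpha> + 2) * 1"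
    unfolding wt_Suc using \<alpha> Suc wt_pos[of n] mult_mono[of "real n + 1" "real n + \<alpha> + 2" "wt n" 1] by auto
  then show ?case using \<alpha> by (subst (asm) mult_le_cancel_left_pos) auto
qed (simp add: wt_0)

text \<open>The generalised binomial series. At \<open>x = cnj a * z\<close> the sum is the
  reproducing kernel at \<open>a\<close>; at \<open>x = cmod z\<close> the series also provides a
  majorant for \<open>Psi\<close>.\<close>

lemma kernel_sums:
  assumes "cmod x < 1"
  shows "(\<lambda>n. of_real (1 / wt n) * x ^ n) sums ((1 - x) powr of_real (- (\<alpha> + 2)))"
proof -
  have "(\<lambda>n. (of_real (- (\<alpha> + 2)) gchoose n) * (- x) ^ n) sums ((1 + - x) powr of_real (- (\<alpha> + 2)))"
    using assms by (intro gen_binomial_complex) simp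
  moreover have "(of_real (- (\<alpha> + 2)) gchoose n) * (- x) ^ n = of_real (1 / wt n) * x ^ n" for n
  proof -
    have "(of_real (- (\<alpha> + 2)) gchoose n) = (-1) ^ n * (of_real (pochhammer (\<alpha> + 2) n) / fact n :: complex)"
      by (simp add: gbinomial_pochhammer pochhammer_of_real[symmetric] add.commute)
    moreover have "(- x) ^ n = (-1) ^ n * x ^ n" by (rule power_minus)
    ultimately show ?thesis unfolding wt_eq by (simp add: mult_ac power_mult_distrib[symmetric])
  qed
  ultimately show ?thesis by simp
qed

lemma bergman_iff:
  "f \<in> bergman \<alpha> \<longleftrightarrow> f \<in> analytic_disc \<and> summable (\<lambda>n. wt n * (cmod (taylor_coeff f n))\<^sup>2)"
proof -
  have "summable (\<lambda>n. wt n * (cmod (taylor_coeff f n))\<^sup>2) \<longleftrightarrow>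
    summable (\<lambda>n. (\<alpha> + 1) * ((cmod (taylor_coeff f n))\<^sup>2 * Beta (real n + 1) (\<alpha> + 1)))"
    by (simp only: wt_def mult_ac)
  also have "\<dots> \<longleftrightarrow> summable (\<lambda>n. (cmod (taylor_coeff f n))\<^sup>2 * Beta (real n + 1) (\<alpha> + 1))"
    using \<alpha> by (subst summable_cmult_iff) auto
  finally show ?thesis using A2_iff[of f 0 \<alpha>] \<alpha> by (auto simp: A2_def)
qed

lemma bergman_analytic: "f \<in> bergman \<alpha> \<Longrightarrow> f \<in> analytic_disc"
  by (simp add: A2_def)

text \<open>Coordinates with respect to the monomials divided by their norms
  \<open>sqrt (wt n)\<close>. The inverse map \<open>Psi\<close> has all of \<open>ell2\<close> as
  its domain, so later statements quantify over sequences and speak of \<open>Psi x\<close>.\<close>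

definition Phi :: "(complex \<Rightarrow> complex) \<Rightarrow> ell2" where
  "Phi f = Ell2 (\<lambda>n. of_real (sqrt (wt n)) * taylor_coeff f n)"

definition Psi :: "ell2 \<Rightarrow> complex \<Rightarrow> complex" where
  "Psi x z = (if z \<in> disc then \<Sum>n. ell2_nth x n / of_real (sqrt (wt n)) * z ^ n else 0)"

lemma nth_Phi:
  assumes "f \<in> bergman \<alpha>"
  shows "ell2_nth (Phi f) n = of_real (sqrt (wt n)) * taylor_coeff f n"
proof -
  have "(cmod (of_real (sqrt (wt n)) * taylor_coeff f n))\<^sup>2 = wt n * (cmod (taylor_coeff f n))\<^sup>2" for n
    using wt_pos[of n] by (simp only: norm_mult norm_of_real power_mult_distrib power2_abs real_sqrt_pow2 less_imp_le)
  then show ?thesis using assms unfolding Phi_def bergman_iff by (subst Ell2_inverse) auto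
qed

text \<open>Coordinates are bounded by \<open>norm x\<close>, and \<open>wt n \<le> 1\<close> gives
  \<open>1 / sqrt (wt n) \<le> 1 / wt n\<close>, so the kernel series at \<open>cmod z\<close> is a
  majorant.\<close>

lemma Psi_sums:
  assumes "z \<in> disc"
  shows "(\<lambda>n. ell2_nth x n / of_real (sqrt (wt n)) * z ^ n) sums Psi x z"
proof -
  have "summable (\<lambda>n. of_real (1 / wt n) * (of_real (cmod z)) ^ n :: complex)"
    using kernel_sums[of "of_real (cmod z)"] assms by (auto simp: sums_iff)
  then have "summable (\<lambda>n. Re (of_real (1 / wt n) * (of_real (cmod z)) ^ n))"
    by (rule summable_Re)
  then have "summable (\<lambda>n. 1 / wt n * cmod z ^ n)"
    by (simp only: of_real_power[symmetric] of_real_mult[symmetric] Re_complex_of_real)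
  from summable_mult[OF this, of "norm x"]
  have "summable (\<lambda>n. ell2_nth x n / of_real (sqrt (wt n)) * z ^ n)"
  proof (rule summable_comparison_test')
    fix n
    have "wt n \<le> sqrt (wt n)"
    proof (rule real_le_rsqrt)
      show "(wt n)\<^sup>2 \<le> wt n" using wt_pos[of n] wt_le_1[of n] by (simp add: power2_eq_square mult_left_le)
    qed
    then have "1 / sqrt (wt n) \<le> 1 / wt n" using wt_pos[of n] by (intro divide_left_mono) auto
    then have "cmod (ell2_nth x n) * (1 / sqrt (wt n)) * cmod z ^ n \<le> norm x * (1 / wt n) * cmod z ^ n"
      using wt_pos[of n] by (intro mult_mono norm_ell2_nth_le) auto
    then show "norm (ell2_nth x n / of_real (sqrt (wt n)) * z ^ n) \<le> norm x * (1 / wt n * cmod z ^ n)"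
      using wt_pos[of n] by (simp add: norm_mult norm_divide norm_power mult.assoc)
  qed
  then show ?thesis using assms by (simp add: Psi_def summable_sums)
qed

lemma Psi_analytic: "Psi x \<in> analytic_disc"
proof -
  have "Psi x holomorphic_on disc"
    by (rule power_series_holomorphic[where a = "\<lambda>n. ell2_nth x n / of_real (sqrt (wt n))"])
      (use Psi_sums in simp)
  then show ?thesis by (simp add: analytic_disc_def Psi_def)
qed

lemma taylor_coeff_Psi: "taylor_coeff (Psi x) n = ell2_nth x n / of_real (sqrt (wt n))"
  by (rule taylor_coeff_unique) (rule Psi_sums)

lemma wt_taylor_coeff_Psi: "wt n * (cmod (taylor_coeff (Psi x) n))\<^sup>2 = (cmod (ell2_nth x n))\<^sup>2"
  unfolding taylor_coeff_Psi using wt_pos[of n] by (simp add: norm_divide power_divide)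

lemma Psi_bergman [simp]: "Psi x \<in> bergman \<alpha>"
  unfolding bergman_iff wt_taylor_coeff_Psi using Psi_analytic summable_ell2 by blast

lemma Phi_Psi [simp]: "Phi (Psi x) = x"
  using wt_pos by (intro ell2_eqI) (simp add: nth_Phi taylor_coeff_Psi less_imp_neq[symmetric] del: of_nat_Suc)

lemma Psi_Phi: "f \<in> bergman \<alpha> \<Longrightarrow> Psi (Phi f) = f"
proof (rule analytic_disc_eqI[OF Psi_analytic])
  fix n assume f: "f \<in> bergman \<alpha>"
  have "sqrt (wt n) \<noteq> 0" using wt_pos[of n] by simp
  then show "taylor_coeff (Psi (Phi f)) n = taylor_coeff f n"
    unfolding taylor_coeff_Psi nth_Phi[OF f] by simp
qed (rule bergman_analytic)

lemma bergman_eq_range: "bergman \<alpha> = range Psi"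
  using Psi_Phi by (metis Psi_bergman image_iff subsetI subset_antisym rangeI range_subsetD image_subset_iff)

lemma Psi_add: "Psi (x + y) = (\<lambda>z. Psi x z + Psi y z)"
proof
  fix z
  show "Psi (x + y) z = Psi x z + Psi y z"
  proof (cases "z \<in> disc")
    case True
    from sums_add[OF Psi_sums[OF True, of x] Psi_sums[OF True, of y]]
    have "(\<lambda>n. ell2_nth (x + y) n / of_real (sqrt (wt n)) * z ^ n) sums (Psi x z + Psi y z)"
      by (simp add: add_divide_distrib distrib_right)
    then show ?thesis using Psi_sums[OF True, of "x + y"] sums_unique2 by blast
  qed (simp add: Psi_def)
qed

end

text \<open>Complex multiplication is a separate operation because the classes provide real scalars
  only. For a real-linear map, complex linearity means commuting with
  \<open>ell2_scale \<i>\<close>.\<close>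

lift_definition ell2_scale :: "complex \<Rightarrow> ell2 \<Rightarrow> ell2" is "\<lambda>c a n. c * a n"
  by (simp add: norm_mult power_mult_distrib summable_mult)

lemma ell2_nth_scale [simp]: "ell2_nth (ell2_scale c x) n = c * ell2_nth x n"
  by transfer simp

lemma norm_ell2_scale: "norm (ell2_scale c x) = cmod c * norm x"
proof -
  have "(norm (ell2_scale c x))\<^sup>2 = (cmod c * norm x)\<^sup>2"
    by (simp add: norm_ell2_squared norm_mult power_mult_distrib suminf_mult summable_ell2)
  then show ?thesis by (simp add: power2_eq_iff_nonneg)
qed

lemma ell2_scale_of_real: "ell2_scale (of_real r) x = r *\<^sub>R x"
  by (rule ell2_eqI) (simp add: scaleR_conv_of_real)

lemma bounded_linear_ell2_scale: "bounded_linear (ell2_scale c)"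
  by (rule bounded_linear_intro[where K = "cmod c"])
    (auto intro!: ell2_eqI simp: norm_ell2_scale distrib_left mult.commute scaleR_conv_of_real)

lemma ell2_scale_i_inner: "ell2_scale \<i> x \<bullet> y = - (x \<bullet> ell2_scale \<i> y)"
proof -
  have "(\<i> * a) \<bullet> b = - (a \<bullet> (\<i> * b))" for a b :: complex by (simp add: inner_complex_def)
  then show ?thesis by (simp add: inner_ell2_def suminf_minus summable_ell2_inner[of x "ell2_scale \<i> y", simplified])
qed

context bergman_weight
begin

lemma Psi_scale: "Psi (ell2_scale c x) = (\<lambda>z. c * Psi x z)"
proof
  fix z
  show "Psi (ell2_scale c x) z = c * Psi x z"
  proof (cases "z \<in> disc")
    case True
    from sums_mult[OF Psi_sums[OF True, of x], of c]
    have "(\<lambda>n. ell2_nth (ell2_scale c x) n / of_real (sqrt (wt n)) * z ^ n) sums (c * Psi x z)"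
      by (simp add: mult.assoc)
    then show ?thesis using Psi_sums[OF True, of "ell2_scale c x"] sums_unique2 by blast
  qed (simp add: Psi_def)
qed

lemma Psi_scaleR: "Psi (r *\<^sub>R x) = (\<lambda>z. of_real r * Psi x z)"
  using Psi_scale[of "of_real r" x] by (simp add: ell2_scale_of_real)

lemma Psi_diff: "Psi (x - y) = (\<lambda>z. Psi x z - Psi y z)"
  using Psi_add[of x "(-1) *\<^sub>R y"] Psi_scaleR[of "-1" y] by simp

lemma nn_integral_dA_weighted:
  assumes [measurable]: "g \<in> borel_measurable borel" and "\<And>z. 0 \<le> g z"
  shows "(\<integral>\<^sup>+z. ennreal (g z) \<partial>dA_weighted \<alpha>)
    = ennreal (\<alpha> + 1) * (\<integral>\<^sup>+z. ennreal ((1 - (cmod z)\<^sup>2) powr \<alpha> * g z) \<partial>dA)"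
  unfolding dA_weighted_def using \<alpha> assms(2)
  by (subst nn_integral_density) (auto simp: ennreal_mult mult.assoc nn_integral_cmult)

lemma sets_dA_weighted [simp, measurable_cong]: "sets (dA_weighted \<alpha>) = sets borel"
  by (simp add: dA_weighted_def)

lemma AE_dA_weighted_disc: "AE z in dA_weighted \<alpha>. z \<in> disc"
  unfolding dA_weighted_def by (subst AE_density) (use AE_dA_disc in auto)

lemma nn_norm_Psi: "(\<integral>\<^sup>+z. ennreal ((cmod (Psi x z))\<^sup>2) \<partial>dA_weighted \<alpha>) = ennreal ((norm x)\<^sup>2)"
proof -
  have [measurable]: "Psi x \<in> borel_measurable borel" using Psi_analytic by measurable
  have hol: "Psi x holomorphic_on disc" using Psi_analytic by (simp add: analytic_disc_def)
  have nonneg: "0 \<le> (cmod (taylor_coeff (Psi x) n))\<^sup>2 * Beta (real n + 1) (\<alpha> + 1)" for n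
    using \<alpha> by (intro mult_nonneg_nonneg less_imp_le[OF Beta_nonneg]) auto
  have "(\<integral>\<^sup>+z. ennreal ((cmod (Psi x z))\<^sup>2) \<partial>dA_weighted \<alpha>)
    = ennreal (\<alpha> + 1) * (\<Sum>n. ennreal ((cmod (taylor_coeff (Psi x) n))\<^sup>2 * Beta (real n + 1) (\<alpha> + 1)))"
    using parseval_dA[OF hol \<alpha>] by (subst nn_integral_dA_weighted) auto
  also have "\<dots> = (\<Sum>n. ennreal ((\<alpha> + 1) * ((cmod (taylor_coeff (Psi x) n))\<^sup>2 * Beta (real n + 1) (\<alpha> + 1))))"
    using \<alpha> nonneg by (subst ennreal_suminf_cmult[symmetric]) (simp add: ennreal_mult)
  also have "\<dots> = (\<Sum>n. ennreal ((cmod (ell2_nth x n))\<^sup>2))"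
    unfolding wt_taylor_coeff_Psi[symmetric] by (simp only: wt_def mult_ac)
  also have "\<dots> = ennreal ((norm x)\<^sup>2)"
    unfolding norm_ell2_squared by (intro suminf_ennreal2 summable_ell2) auto
  finally show ?thesis .
qed

lemma integrable_norm_Psi: "integrable (dA_weighted \<alpha>) (\<lambda>z. (cmod (Psi x z))\<^sup>2)"
proof -
  have [measurable]: "Psi x \<in> borel_measurable borel" using Psi_analytic by measurable
  show ?thesis by (rule integrableI_bounded) (use nn_norm_Psi[of x] in auto)
qed

lemma integral_norm_Psi: "(LINT z|dA_weighted \<alpha>. (cmod (Psi x z))\<^sup>2) = (norm x)\<^sup>2"
proof -
  have [measurable]: "Psi x \<in> borel_measurable borel" using Psi_analytic by measurable
  show ?thesis by (subst integral_eq_nn_integral) (use nn_norm_Psi[of x] in auto)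
qed

lemma integrable_Psi_product: "integrable (dA_weighted \<alpha>) (\<lambda>z. Psi x z * cnj (Psi y z))"
proof (rule Bochner_Integration.integrable_bound)
  have [measurable]: "Psi x \<in> borel_measurable borel" "Psi y \<in> borel_measurable borel"
    "cnj \<in> borel_measurable borel"
    using Psi_analytic analytic_disc_measurable
    by (auto intro!: borel_measurable_continuous_onI continuous_intros)
  show "(\<lambda>z. Psi x z * cnj (Psi y z)) \<in> borel_measurable (dA_weighted \<alpha>)" by measurable
  show "integrable (dA_weighted \<alpha>) (\<lambda>z. (cmod (Psi x z))\<^sup>2 + (cmod (Psi y z))\<^sup>2)"
    by (intro Bochner_Integration.integrable_add integrable_norm_Psi)
  have "norm (Psi x z * cnj (Psi y z)) \<le> norm ((cmod (Psi x z))\<^sup>2 + (cmod (Psi y z))\<^sup>2)" for z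
  proof -
    have "cmod (Psi x z) * cmod (Psi y z) \<le> (cmod (Psi x z))\<^sup>2 + (cmod (Psi y z))\<^sup>2"
      using sum_squares_bound[of "cmod (Psi x z)" "cmod (Psi y z)"]
        mult_nonneg_nonneg[OF norm_ge_zero norm_ge_zero, of "Psi x z" "Psi y z"] by linarith
    then show ?thesis by (simp add: norm_mult)
  qed
  then show "AE z in dA_weighted \<alpha>. norm (Psi x z * cnj (Psi y z)) \<le> norm ((cmod (Psi x z))\<^sup>2 + (cmod (Psi y z))\<^sup>2)"
    by (intro AE_I2)
qed

text \<open>Parseval yields norms only; polarisation, of the integrand and of the norm, recovers the
  inner product.\<close>

lemma Re_inner_Psi: "Re (bergman_inner \<alpha> (Psi x) (Psi y)) = x \<bullet> y"
proof -
  have "Re (bergman_inner \<alpha> (Psi x) (Psi y)) = (LINT z|dA_weighted \<alpha>. Re (Psi x z * cnj (Psi y z)))"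
    unfolding bergman_inner_def by (rule integral_Re[OF integrable_Psi_product, symmetric])
  also have "\<dots> = (LINT z|dA_weighted \<alpha>. ((cmod (Psi (x + y) z))\<^sup>2 - (cmod (Psi (x - y) z))\<^sup>2) / 4)"
  proof -
    have "Re (a * cnj b) = ((cmod (a + b))\<^sup>2 - (cmod (a - b))\<^sup>2) / 4" for a b
      unfolding cmod_power2 by (simp add: power2_eq_square algebra_simps)
    then show ?thesis by (simp only: Psi_add Psi_diff)
  qed
  also have "\<dots> = ((norm (x + y))\<^sup>2 - (norm (x - y))\<^sup>2) / 4"
    by (simp add: Bochner_Integration.integral_diff integrable_norm_Psi integral_norm_Psi)
  also have "\<dots> = x \<bullet> y"
    by (simp add: power2_norm_eq_inner inner_simps inner_commute)
  finally show ?thesis .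
qed

text \<open>Conjugation in the second slot turns a factor \<open>\<i>\<close> into
  \<open>- \<i>\<close>, and the real part of \<open>- \<i> * w\<close> is
  \<open>Im w\<close>.\<close>

lemma Im_inner_Psi: "Im (bergman_inner \<alpha> (Psi x) (Psi y)) = x \<bullet> ell2_scale \<i> y"
proof -
  have "bergman_inner \<alpha> (Psi x) (Psi (ell2_scale \<i> y)) = - \<i> * bergman_inner \<alpha> (Psi x) (Psi y)"
    unfolding bergman_inner_def Psi_scale
    by (simp add: mult.left_commute[of _ \<i>] integrable_Psi_product
        flip: Bochner_Integration.integral_mult_right_zero Bochner_Integration.integral_minus)
  then show ?thesis using Re_inner_Psi[of x "ell2_scale \<i> y"] by simp
qed

lemma bergman_norm_Psi: "bergman_norm \<alpha> (Psi x) = norm x"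
  by (simp add: bergman_norm_def Re_inner_Psi norm_eq_sqrt_inner)

end

section \<open>Finite Blaschke products\<close>


abbreviation blaschke_factor :: "complex \<Rightarrow> complex \<Rightarrow> complex" where
  "blaschke_factor a z \<equiv> (a - z) / (1 - cnj a * z)"

abbreviation blaschke_product :: "complex list \<Rightarrow> complex \<Rightarrow> complex" where
  "blaschke_product as z \<equiv> (\<Prod>a\<leftarrow>as. blaschke_factor a z)"

lemma blaschke_denominator:
  assumes "a \<in> disc" "z \<in> disc"
  shows "1 - cnj a * z \<noteq> 0" "1 - cmod a \<le> cmod (1 - cnj a * z)" "cmod (1 - cnj a * z) \<le> 2"
proof -
  have le: "cmod (cnj a * z) \<le> cmod a" using assms by (simp add: norm_mult mult_left_le)
  then show ge: "1 - cmod a \<le> cmod (1 - cnj a * z)"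
    using norm_triangle_ineq2[of 1 "cnj a * z"] by simp
  show "cmod (1 - cnj a * z) \<le> 2"
    using norm_triangle_ineq4[of 1 "cnj a * z"] le assms by simp
  show "1 - cnj a * z \<noteq> 0"
  proof
    assume "1 - cnj a * z = 0"
    then show False using ge assms by simp
  qed
qed

lemma one_minus_blaschke_factor:
  assumes "a \<in> disc" "z \<in> disc"
  shows "1 - (cmod (blaschke_factor a z))\<^sup>2 = (1 - (cmod a)\<^sup>2) * (1 - (cmod z)\<^sup>2) / (cmod (1 - cnj a * z))\<^sup>2"
proof -
  have "complex_of_real ((cmod (1 - cnj a * z))\<^sup>2 - (cmod (a - z))\<^sup>2) = of_real ((1 - (cmod a)\<^sup>2) * (1 - (cmod z)\<^sup>2))"
    unfolding of_real_diff of_real_mult complex_norm_square by (simp add: algebra_simps)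
  then have "(cmod (1 - cnj a * z))\<^sup>2 - (cmod (a - z))\<^sup>2 = (1 - (cmod a)\<^sup>2) * (1 - (cmod z)\<^sup>2)"
    by (simp only: of_real_eq_iff)
  moreover have "(cmod (1 - cnj a * z))\<^sup>2 \<noteq> 0" using blaschke_denominator(1)[OF assms] by simp
  ultimately show ?thesis by (simp add: norm_divide power_divide field_simps)
qed

text \<open>The denominator has modulus between \<open>1 - cmod a\<close> and 2; the squares of
  these two values give the two constants.\<close>

lemma blaschke_factor_bounds:
  assumes "a \<in> disc" "z \<in> disc"
  shows "(1 - (cmod a)\<^sup>2) / 4 * (1 - (cmod z)\<^sup>2) \<le> 1 - (cmod (blaschke_factor a z))\<^sup>2"
    and "1 - (cmod (blaschke_factor a z))\<^sup>2 \<le> (1 - (cmod a)\<^sup>2) / (1 - cmod a)\<^sup>2 * (1 - (cmod z)\<^sup>2)"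
    and "cmod (blaschke_factor a z) < 1"
proof -
  note d = blaschke_denominator[OF assms]
  have lt: "(cmod a)\<^sup>2 < 1" "(cmod z)\<^sup>2 < 1" using assms by (auto simp: abs_square_less_1)
  have a1: "0 < 1 - cmod a" using assms by simp
  then have pos: "0 < cmod (1 - cnj a * z)" using d(2) by linarith
  have num: "0 < (1 - (cmod a)\<^sup>2) * (1 - (cmod z)\<^sup>2)" using lt by (intro mult_pos_pos) simp_all
  have "(cmod (1 - cnj a * z))\<^sup>2 \<le> 2\<^sup>2" by (intro power_mono d) simp
  then have "(1 - (cmod a)\<^sup>2) * (1 - (cmod z)\<^sup>2) / 4 \<le> (1 - (cmod a)\<^sup>2) * (1 - (cmod z)\<^sup>2) / (cmod (1 - cnj a * z))\<^sup>2"
    using num pos by (intro divide_left_mono mult_pos_pos) (simp_all add: less_imp_le)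
  then show "(1 - (cmod a)\<^sup>2) / 4 * (1 - (cmod z)\<^sup>2) \<le> 1 - (cmod (blaschke_factor a z))\<^sup>2"
    unfolding one_minus_blaschke_factor[OF assms] by simp
  have "(1 - cmod a)\<^sup>2 \<le> (cmod (1 - cnj a * z))\<^sup>2" using a1 by (intro power_mono d) simp
  then have "(1 - (cmod a)\<^sup>2) * (1 - (cmod z)\<^sup>2) / (cmod (1 - cnj a * z))\<^sup>2 \<le> (1 - (cmod a)\<^sup>2) * (1 - (cmod z)\<^sup>2) / (1 - cmod a)\<^sup>2"
    using num pos a1 by (intro divide_left_mono mult_pos_pos) (simp_all add: less_imp_le)
  then show "1 - (cmod (blaschke_factor a z))\<^sup>2 \<le> (1 - (cmod a)\<^sup>2) / (1 - cmod a)\<^sup>2 * (1 - (cmod z)\<^sup>2)"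
    unfolding one_minus_blaschke_factor[OF assms] by simp
  have "0 < (1 - (cmod a)\<^sup>2) * (1 - (cmod z)\<^sup>2) / (cmod (1 - cnj a * z))\<^sup>2"
    using num pos by (intro divide_pos_pos) simp_all
  then have "(cmod (blaschke_factor a z))\<^sup>2 < 1"
    unfolding one_minus_blaschke_factor[OF assms, symmetric] by linarith
  then show "cmod (blaschke_factor a z) < 1" by (simp only: abs_square_less_1 abs_norm_cancel)
qed

lemma norm_blaschke_product_le_1:
  "set as \<subseteq> disc \<Longrightarrow> z \<in> disc \<Longrightarrow> cmod (blaschke_product as z) \<le> 1"
proof (induction as)
  case (Cons a as)
  then have "cmod (blaschke_factor a z) * cmod (blaschke_product as z) \<le> 1"
    by (intro mult_le_one less_imp_le[OF blaschke_factor_bounds(3)] norm_ge_zero) auto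
  then show ?case by (simp only: list.map prod_list.Cons norm_mult)
qed simp

text \<open>By 1 - x^2 y^2 = (1 - x^2) + x^2 (1 - y^2) with x at most 1, the constants of the
  factors add up.\<close>

lemma one_minus_blaschke_product_upper:
  assumes "set as \<subseteq> disc"
  obtains C where "C \<ge> 0" "\<And>z. z \<in> disc \<Longrightarrow> 1 - (cmod (blaschke_product as z))\<^sup>2 \<le> C * (1 - (cmod z)\<^sup>2)"
  using assms
proof (induction as arbitrary: thesis)
  case Nil
  show ?case by (rule Nil(1)[of 0]) auto
next
  case (Cons a as)
  obtain C where C: "C \<ge> 0" "\<And>z. z \<in> disc \<Longrightarrow> 1 - (cmod (blaschke_product as z))\<^sup>2 \<le> C * (1 - (cmod z)\<^sup>2)"
    using Cons.IH Cons.prems(2) by auto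
  let ?K = "(1 - (cmod a)\<^sup>2) / (1 - cmod a)\<^sup>2"
  have a: "a \<in> disc" using Cons.prems by simp
  show ?case
  proof (rule Cons.prems(1)[of "?K + C"])
    show "?K + C \<ge> 0" using C(1) a by (intro add_nonneg_nonneg divide_nonneg_nonneg) (auto simp: power_le_one)
    fix z assume z: "z \<in> disc"
    let ?x = "cmod (blaschke_factor a z)" and ?y = "cmod (blaschke_product as z)"
    have "1 - (cmod (blaschke_product (a # as) z))\<^sup>2 = (1 - ?x\<^sup>2) + ?x\<^sup>2 * (1 - ?y\<^sup>2)"
      by (simp only: list.map prod_list.Cons norm_mult power_mult_distrib) (simp add: algebra_simps)
    also have "\<dots> \<le> (1 - ?x\<^sup>2) + 1 * (1 - ?y\<^sup>2)"
    proof (intro add_left_mono mult_right_mono)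
      show "?x\<^sup>2 \<le> 1" using blaschke_factor_bounds(3)[OF a z] by (intro power_le_one norm_ge_zero less_imp_le)
      show "0 \<le> 1 - ?y\<^sup>2" using norm_blaschke_product_le_1[of as z] Cons.prems z
        by (simp add: power_le_one)
    qed
    also have "\<dots> \<le> ?K * (1 - (cmod z)\<^sup>2) + C * (1 - (cmod z)\<^sup>2)"
      unfolding mult_1 by (intro add_mono blaschke_factor_bounds a z C)
    finally show "1 - (cmod (blaschke_product (a # as) z))\<^sup>2 \<le> (?K + C) * (1 - (cmod z)\<^sup>2)"
      by (simp only: distrib_right)
  qed
qed

lemma finite_blaschke_upper:
  assumes "finite_blaschke \<phi>"
  obtains C where "C \<ge> 0" "\<And>z. z \<in> disc \<Longrightarrow> 1 - (cmod (\<phi> z))\<^sup>2 \<le> C * (1 - (cmod z)\<^sup>2)"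
proof -
  obtain c as where c: "cmod c = 1" and as: "set as \<subseteq> disc"
    and \<phi>: "\<And>z. z \<in> disc \<Longrightarrow> \<phi> z = c * blaschke_product as z"
    using assms by (auto simp: finite_blaschke_def)
  obtain C where "C \<ge> 0" "\<And>z. z \<in> disc \<Longrightarrow> 1 - (cmod (blaschke_product as z))\<^sup>2 \<le> C * (1 - (cmod z)\<^sup>2)"
    by (rule one_minus_blaschke_product_upper[OF as]) blast
  then show ?thesis using that[of C] \<phi> c by (simp add: norm_mult)
qed

text \<open>One factor suffices, since the remaining product has modulus at most 1; excluding
  unimodular constants rules out the empty list and so provides that factor.\<close>

lemma finite_blaschke_lower:
  assumes "finite_blaschke \<phi>" "\<not> unimodular_constant \<phi>"
  obtains C where "C > 0" "\<And>z. z \<in> disc \<Longrightarrow> C * (1 - (cmod z)\<^sup>2) \<le> 1 - (cmod (\<phi> z))\<^sup>2"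
proof -
  obtain c as where c: "cmod c = 1" and as: "set as \<subseteq> disc"
    and \<phi>: "\<And>z. z \<in> disc \<Longrightarrow> \<phi> z = c * blaschke_product as z"
    using assms by (auto simp: finite_blaschke_def)
  have "as \<noteq> []" using assms(2) c \<phi> by (auto simp: unimodular_constant_def)
  then obtain a bs where ab: "as = a # bs" by (cases as) auto
  have a: "a \<in> disc" and bs: "set bs \<subseteq> disc" using as ab by auto
  show ?thesis
  proof (rule that)
    show "(1 - (cmod a)\<^sup>2) / 4 > 0" using a by (simp add: abs_square_less_1)
    fix z assume z: "z \<in> disc"
    have "cmod (\<phi> z) = cmod (blaschke_factor a z) * cmod (blaschke_product bs z)"
      unfolding \<phi>[OF z] ab using c by (simp only: list.map prod_list.Cons norm_mult mult_1)
    also have "\<dots> \<le> cmod (blaschke_factor a z)"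
      using norm_blaschke_product_le_1[OF bs z] by (intro mult_left_le) auto
    finally have "(cmod (\<phi> z))\<^sup>2 \<le> (cmod (blaschke_factor a z))\<^sup>2" by (intro power_mono) auto
    then show "(1 - (cmod a)\<^sup>2) / 4 * (1 - (cmod z)\<^sup>2) \<le> 1 - (cmod (\<phi> z))\<^sup>2"
      using blaschke_factor_bounds(1)[OF a z] by linarith
  qed
qed

section \<open>Maximum principle and removal of zeros\<close>

text \<open>Maximum principle on a circle between \<open>z\<close> and the boundary. The hypothesis
  says that the limit superior of the modulus at the boundary is at most 1, without reference to
  boundary values.\<close>

lemma max_modulus_disc:
  assumes g: "g holomorphic_on disc"
    and bd: "\<And>e. e > 0 \<Longrightarrow> \<exists>r<1. \<forall>z. r \<le> cmod z \<and> cmod z < 1 \<longrightarrow> cmod (g z) \<le> 1 + e"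
    and z: "z \<in> disc"
  shows "cmod (g z) \<le> 1"
proof (rule field_le_epsilon)
  fix e :: real assume "e > 0"
  then obtain r where r: "r < 1" "\<And>z. r \<le> cmod z \<Longrightarrow> cmod z < 1 \<Longrightarrow> cmod (g z) \<le> 1 + e" using bd by blast
  define s where "s = (1 + max r (cmod z)) / 2"
  have s: "r < s" "cmod z < s" "s < 1" using r(1) z by (auto simp: s_def max_def)
  then have "0 < s" using norm_ge_zero[of z] by linarith
  show "cmod (g z) \<le> 1 + e"
  proof (rule maximum_modulus_frontier[of g "cball 0 s"])
    show "g holomorphic_on interior (cball 0 s)" using s by (intro holomorphic_on_subset[OF g]) auto
    show "continuous_on (closure (cball 0 s)) g"
      using s by (intro holomorphic_on_imp_continuous_on holomorphic_on_subset[OF g]) auto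
    show "cmod (g w) \<le> 1 + e" if "w \<in> frontier (cball 0 s)" for w
    proof -
      have "cmod w = s" using that \<open>0 < s\<close> by (simp add: frontier_cball)
      then show ?thesis using s by (intro r(2)) auto
    qed
  qed (use s in auto)
qed

text \<open>Only the lower half of |f| -> 1, uniformly at the boundary; the upper half is supplied
  by membership in \<open>Hinf_ball\<close>.\<close>

definition boundary_unimodular :: "(complex \<Rightarrow> complex) \<Rightarrow> bool" where
  "boundary_unimodular f \<longleftrightarrow> (\<forall>e>0. \<exists>r<1. \<forall>z. r \<le> cmod z \<and> cmod z < 1 \<longrightarrow> 1 - e \<le> cmod (f z))"

text \<open>The threshold satisfies \<open>1 - e / (1 + e) = 1 / (1 + e)\<close>. It turns lower
  bounds for a modulus near the boundary into upper bounds for its reciprocal.\<close>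

lemma inverse_le_one_plus:
  fixes x e :: real
  assumes "e > 0" "x \<ge> 1 - e / (1 + e)"
  shows "1 / x \<le> 1 + e"
proof -
  have "1 - e / (1 + e) = 1 / (1 + e)" using assms(1) by (simp add: field_simps)
  then have "1 / (1 + e) \<le> x" using assms(2) by simp
  moreover have "0 < 1 / (1 + e)" using assms(1) by simp
  ultimately have "1 / x \<le> 1 / (1 / (1 + e))" by (intro divide_left_mono mult_pos_pos) linarith+
  then show ?thesis by simp
qed

text \<open>The maximum principle bounds the reciprocal by 1 as well, so the modulus is 1 everywhere
  and attains its maximum inside the disc.\<close>

lemma zero_free_unimodular_constant:
  assumes "\<phi> \<in> Hinf_ball" "boundary_unimodular \<phi>" and nz: "\<And>z. z \<in> disc \<Longrightarrow> \<phi> z \<noteq> 0"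
  obtains c where "cmod c = 1" "\<And>z. z \<in> disc \<Longrightarrow> \<phi> z = c"
proof -
  have hol: "\<phi> holomorphic_on disc" and le: "\<And>z. z \<in> disc \<Longrightarrow> cmod (\<phi> z) \<le> 1"
    using assms(1) by (auto simp: Hinf_ball_def)
  have "cmod (1 / \<phi> z) \<le> 1" if "z \<in> disc" for z
  proof (rule max_modulus_disc[OF _ _ that])
    show "(\<lambda>z. 1 / \<phi> z) holomorphic_on disc" by (intro holomorphic_intros hol nz)
    fix e :: real assume "e > 0"
    then obtain r where r: "r < 1" "\<And>z. r \<le> cmod z \<Longrightarrow> cmod z < 1 \<Longrightarrow> 1 - e / (1 + e) \<le> cmod (\<phi> z)"
      using assms(2) unfolding boundary_unimodular_def by (metis add_pos_pos divide_pos_pos zero_less_one)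
    have "cmod (1 / \<phi> z) \<le> 1 + e" if "r \<le> cmod z \<and> cmod z < 1" for z
      using inverse_le_one_plus[OF \<open>e > 0\<close> r(2)[of z]] that by (simp add: norm_divide)
    then show "\<exists>r<1. \<forall>z. r \<le> cmod z \<and> cmod z < 1 \<longrightarrow> cmod (1 / \<phi> z) \<le> 1 + e" using r(1) by blast
  qed
  then have one: "cmod (\<phi> z) = 1" if "z \<in> disc" for z
    using that le[OF that] nz[OF that] by (force simp: norm_divide divide_le_eq)
  have "\<phi> constant_on disc"
    by (rule maximum_modulus_principle[OF hol, of disc 0]) (use one in auto)
  then obtain c where "\<And>z. z \<in> disc \<Longrightarrow> \<phi> z = c" by (auto simp: constant_on_def)
  moreover have "cmod c = 1" using one[of 0] calculation[of 0] by simp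
  ultimately show ?thesis using that by blast
qed

text \<open>The zero is removed through the difference quotient. Near the boundary the factor has
  modulus close to 1, so the quotient has limit superior at most 1 there and the maximum principle
  keeps it in the ball. Dividing by a factor of modulus below 1 preserves the lower bound near the
  boundary.\<close>

lemma divide_blaschke_factor:
  assumes "\<phi> \<in> Hinf_ball" "boundary_unimodular \<phi>" and a: "a \<in> disc" "\<phi> a = 0"
  obtains \<psi> where "\<psi> \<in> Hinf_ball" "boundary_unimodular \<psi>" "\<And>z. z \<in> disc \<Longrightarrow> \<phi> z = blaschke_factor a z * \<psi> z"
proof -
  have hol: "\<phi> holomorphic_on disc" and le: "\<And>z. z \<in> disc \<Longrightarrow> cmod (\<phi> z) \<le> 1"
    using assms(1) by (auto simp: Hinf_ball_def)
  define h where "h z = (if z = a then deriv \<phi> a else (\<phi> z - \<phi> a) / (z - a))" for z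
  have h: "h holomorphic_on disc" unfolding h_def[abs_def] by (rule pole_lemma_open[OF hol]) simp
  \<comment> \<open>The sign arises because the factor has numerator \<open>a - z\<close>, while
    \<open>h\<close> divides by \<open>z - a\<close>.\<close>
  define \<psi> where "\<psi> z = - (1 - cnj a * z) * h z" for z
  have \<psi>: "\<psi> holomorphic_on disc" unfolding \<psi>_def[abs_def] by (intro holomorphic_intros h)
  have eq: "\<phi> z = blaschke_factor a z * \<psi> z" if "z \<in> disc" for z
  proof -
    have "blaschke_factor a z * \<psi> z = (z - a) * h z"
      using blaschke_denominator(1)[OF a(1) that] by (simp add: \<psi>_def field_simps)
    also have "\<dots> = \<phi> z" using a(2) by (simp add: h_def)
    finally show ?thesis ..
  qed
  obtain C where C: "C \<ge> 0" "\<And>z. z \<in> disc \<Longrightarrow> 1 - (cmod (blaschke_factor a z))\<^sup>2 \<le> C * (1 - (cmod z)\<^sup>2)"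
    using one_minus_blaschke_product_upper[of "[a]"] a(1) by auto
  have factor: "\<exists>r<1. \<forall>z. r \<le> cmod z \<and> cmod z < 1 \<longrightarrow> 1 - e \<le> cmod (blaschke_factor a z)" if "e > 0" for e
  proof -
    \<comment> \<open>Since 1 - |z|^2 is at most 2 (1 - |z|), it is at most e / (C + 1) beyond this
      radius; \<open>C + 1\<close> keeps the divisor positive when \<open>C = 0\<close>.\<close>
    define r where "r = 1 - e / (2 * (C + 1))"
    have "r < 1" using that C(1) by (simp add: r_def)
    moreover have "1 - e \<le> cmod (blaschke_factor a z)" if "r \<le> cmod z \<and> cmod z < 1" for z
    proof -
      have z: "z \<in> disc" using that by simp
      have "1 - (cmod z)\<^sup>2 = (1 - cmod z) * (1 + cmod z)" by (simp add: power2_eq_square algebra_simps)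
      also have "\<dots> \<le> (1 - cmod z) * 2" using that by (intro mult_left_mono) auto
      also have "\<dots> \<le> e / (2 * (C + 1)) * 2" using that by (intro mult_right_mono) (auto simp: r_def)
      also have "\<dots> = e / (C + 1)" using C(1) by (simp add: field_simps)
      finally have "1 - (cmod z)\<^sup>2 \<le> e / (C + 1)" .
      then have "C * (1 - (cmod z)\<^sup>2) \<le> C * (e / (C + 1))" using C(1) by (intro mult_left_mono)
      also have "\<dots> \<le> e" using C(1) \<open>e > 0\<close> by (simp add: field_simps)
      finally have "1 - (cmod (blaschke_factor a z))\<^sup>2 \<le> e" using C(2)[OF z] by linarith
      moreover have "(cmod (blaschke_factor a z))\<^sup>2 \<le> cmod (blaschke_factor a z)"
        using blaschke_factor_bounds(3)[OF a(1) z] by (simp only: power2_eq_square) (intro mult_left_le norm_ge_zero, linarith)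
      ultimately show ?thesis by linarith
    qed
    ultimately show ?thesis by blast
  qed
  have "cmod (\<psi> z) \<le> 1" if "z \<in> disc" for z
  proof (rule max_modulus_disc[OF \<psi> _ that])
    fix e :: real assume "e > 0"
    then have "e / (1 + e) > 0" by simp
    from factor[OF this] obtain r where r: "r < 1"
      "\<And>z. r \<le> cmod z \<Longrightarrow> cmod z < 1 \<Longrightarrow> 1 - e / (1 + e) \<le> cmod (blaschke_factor a z)" by blast
    have "cmod (\<psi> z) \<le> 1 + e" if "r \<le> cmod z \<and> cmod z < 1" for z
    proof -
      have z: "z \<in> disc" using that by simp
      let ?b = "cmod (blaschke_factor a z)"
      have ge: "1 - e / (1 + e) \<le> ?b" using r(2) that by blast
      have "1 - e / (1 + e) > 0" using \<open>e > 0\<close> by (simp add: field_simps)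
      then have b: "?b > 0" using ge by linarith
      have "?b * cmod (\<psi> z) \<le> 1" using le[OF z] unfolding eq[OF z] norm_mult .
      then have "cmod (\<psi> z) \<le> 1 / ?b" using b by (simp only: pos_le_divide_eq mult.commute)
      also have "\<dots> \<le> 1 + e" by (rule inverse_le_one_plus[OF \<open>e > 0\<close> ge])
      finally show ?thesis .
    qed
    then show "\<exists>r<1. \<forall>z. r \<le> cmod z \<and> cmod z < 1 \<longrightarrow> cmod (\<psi> z) \<le> 1 + e" using r(1) by blast
  qed
  then have "\<psi> \<in> Hinf_ball" using \<psi> by (simp add: Hinf_ball_def)
  moreover have "boundary_unimodular \<psi>" unfolding boundary_unimodular_def
  proof (intro allI impI)
    fix e :: real assume "e > 0"
    then obtain r where r: "r < 1" "\<And>z. r \<le> cmod z \<Longrightarrow> cmod z < 1 \<Longrightarrow> 1 - e \<le> cmod (\<phi> z)"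
      using assms(2) unfolding boundary_unimodular_def by blast
    have "1 - e \<le> cmod (\<psi> z)" if "r \<le> cmod z \<and> cmod z < 1" for z
    proof -
      have z: "z \<in> disc" using that by simp
      have "cmod (\<phi> z) = cmod (blaschke_factor a z) * cmod (\<psi> z)" unfolding eq[OF z] norm_mult ..
      also have "\<dots> \<le> cmod (\<psi> z)"
        using blaschke_factor_bounds(3)[OF a(1) z] by (intro mult_left_le_one_le) auto
      finally show ?thesis using r(2)[of z] that by linarith
    qed
    then show "\<exists>r<1. \<forall>z. r \<le> cmod z \<and> cmod z < 1 \<longrightarrow> 1 - e \<le> cmod (\<psi> z)" using r(1) by blast
  qed
  ultimately show ?thesis using that eq by blast
qed

text \<open>Zeros are divided out one at a time. This stops because each division lowers the modulus at a
  fixed non-zero point by a factor bounded away from 1, all zeros lying in a smaller disc.\<close>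

lemma boundary_unimodular_imp_finite_blaschke:
  assumes \<phi>: "\<phi> \<in> Hinf_ball" and bd: "boundary_unimodular \<phi>"
  shows "finite_blaschke \<phi>"
proof (rule ccontr)
  assume not: "\<not> finite_blaschke \<phi>"
  define Q where "Q as \<psi> \<longleftrightarrow> set as \<subseteq> disc \<and> \<psi> \<in> Hinf_ball \<and> boundary_unimodular \<psi> \<and>
    (\<forall>z\<in>disc. \<phi> z = blaschke_product as z * \<psi> z)" for as \<psi>
  \<comment> \<open>If \<open>\<phi>\<close> is not a finite Blaschke product, every quotient still
    has a zero, since a zero-free one would be a unimodular constant. Arbitrarily many factors can
    therefore be split off.\<close>
  have Q: "\<exists>as \<psi>. length as = m \<and> Q as \<psi>" for m
  proof (induction m)
    case 0
    show ?case by (rule exI[of _ "[]"], rule exI[of _ \<phi>]) (simp add: Q_def \<phi> bd)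
  next
    case (Suc m)
    then obtain as \<psi> where as: "length as = m" "Q as \<psi>" by blast
    have "\<exists>a\<in>disc. \<psi> a = 0"
    proof (rule ccontr)
      assume "\<not> ?thesis"
      then obtain c where c: "cmod c = 1" "\<And>z. z \<in> disc \<Longrightarrow> \<psi> z = c"
        using zero_free_unimodular_constant[of \<psi>] as(2) unfolding Q_def by metis
      have "finite_blaschke \<phi>" unfolding finite_blaschke_def
        by (rule exI[of _ c], rule exI[of _ as]) (use as(2) c in \<open>simp add: Q_def mult.commute\<close>)
      then show False using not by simp
    qed
    then obtain a where a: "a \<in> disc" "\<psi> a = 0" by blast
    obtain \<eta> where \<eta>: "\<eta> \<in> Hinf_ball" "boundary_unimodular \<eta>" "\<And>z. z \<in> disc \<Longrightarrow> \<psi> z = blaschke_factor a z * \<eta> z"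
      using divide_blaschke_factor[of \<psi> a] as(2) a unfolding Q_def by metis
    have "Q (a # as) \<eta>" using as(2) \<eta> a unfolding Q_def by (simp add: mult_ac)
    then show ?case using as(1) by (metis length_Cons)
  qed
  \<comment> \<open>No zero of \<open>\<phi>\<close> in the disc has modulus \<open>R\<close> or
    more. Hence all zeros lie strictly inside radius \<open>s\<close>, and the point
    \<open>p\<close> of modulus \<open>s\<close> is not one of them.\<close>
  obtain R where R: "R < 1" "\<And>z. R \<le> cmod z \<Longrightarrow> cmod z < 1 \<Longrightarrow> 1 - 1/2 \<le> cmod (\<phi> z)"
    using bd unfolding boundary_unimodular_def by (metis half_gt_zero zero_less_one)
  define s where "s = (1 + max R 0) / 2"
  have s: "R \<le> s" "0 < s" "s < 1" using R(1) by (auto simp: s_def max_def)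
  define p where "p = complex_of_real s"
  have p: "p \<in> disc" "cmod p = s" using s by (auto simp: p_def)
  have \<phi>p: "\<phi> p \<noteq> 0" using R(2)[of p] s p by auto
  \<comment> \<open>One minus the lower bound on 1 - |b|^2 for a factor b at \<open>p\<close>, with
    \<open>cmod a\<close> replaced by its bound \<open>s\<close>, so that the same \<open>q\<close>
    serves every zero.\<close>
  define q where "q = 1 - (1 - s\<^sup>2) / 4 * (1 - s\<^sup>2)"
  have s2: "s\<^sup>2 < 1" using s by (simp add: abs_square_less_1)
  then have q: "q < 1" by (simp add: q_def)
  have factor: "(cmod (blaschke_factor a p))\<^sup>2 \<le> q" if "a \<in> disc" "\<phi> a = 0" for a
  proof -
    have "cmod a < s" using R(2)[of a] that s by fastforce
    then have "(cmod a)\<^sup>2 \<le> s\<^sup>2" by (intro power_mono) auto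
    then have "(1 - s\<^sup>2) / 4 * (1 - s\<^sup>2) \<le> (1 - (cmod a)\<^sup>2) / 4 * (1 - s\<^sup>2)"
      using s2 by (intro mult_right_mono divide_right_mono) auto
    then show ?thesis using blaschke_factor_bounds(1)[OF that(1) p(1)] by (simp add: q_def p(2))
  qed
  have "0 \<le> q" using factor zero_le_power2
  proof -
    obtain as \<psi> where "length as = 1" "Q as \<psi>" using Q by blast
    then obtain a where "a \<in> disc" "\<phi> a = 0" by (auto simp: Q_def length_Suc_conv)
    from factor[OF this] show ?thesis using zero_le_power2 order_trans by blast
  qed
  have "(cmod (\<phi> p))\<^sup>2 \<le> q ^ m" for m
  proof -
    obtain as \<psi> where as: "length as = m" "Q as \<psi>" using Q by blast
    have zero: "\<phi> a = 0" if "a \<in> set as" for a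
    proof -
      have "blaschke_product as a = 0" using that by (simp add: prod_list_zero_iff) force
      then show ?thesis using as(2) that by (auto simp: Q_def)
    qed
    have prod: "(cmod (blaschke_product bs p))\<^sup>2 \<le> q ^ length bs" if "set bs \<subseteq> set as" for bs
      using that
    proof (induction bs)
      case (Cons b bs)
      have "(cmod (blaschke_factor b p))\<^sup>2 * (cmod (blaschke_product bs p))\<^sup>2 \<le> q * q ^ length bs"
        using Cons zero as(2) \<open>0 \<le> q\<close> by (intro mult_mono factor) (auto simp: Q_def)
      then show ?case by (simp only: list.map prod_list.Cons norm_mult power_mult_distrib length_Cons power_Suc)
    qed simp
    have "(cmod (\<phi> p))\<^sup>2 = (cmod (blaschke_product as p))\<^sup>2 * (cmod (\<psi> p))\<^sup>2"
      using as(2) p(1) by (simp add: Q_def norm_mult power_mult_distrib)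
    also have "\<dots> \<le> (cmod (blaschke_product as p))\<^sup>2"
      using as(2) p(1) by (intro mult_left_le) (auto simp: Q_def Hinf_ball_def power_le_one)
    also have "\<dots> \<le> q ^ m" using prod[of as] as(1) by simp
    finally show ?thesis .
  qed
  then have "(cmod (\<phi> p))\<^sup>2 \<le> 0"
    by (intro tendsto_lowerbound[OF LIMSEQ_realpow_zero[OF \<open>0 \<le> q\<close> q]] always_eventually) auto
  then show False using \<phi>p by simp
qed

section \<open>The defect operator\<close>


context bergman_weight
begin

text \<open>Non-negativity and symmetry of the distance are required for arbitrary functions, not
  only for members of the space, so they are read off from an integral formula. The other axioms are
  transported from \<open>ell2\<close>.\<close>

lemma Metric_space_bergman: "Metric_space (bergman \<alpha>) (bergman_dist \<alpha>)"
proof -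
  have dist: "bergman_dist \<alpha> (Psi x) (Psi y) = dist x y" for x y
    by (simp add: bergman_dist_def Psi_diff[symmetric] bergman_norm_Psi dist_norm)
  have inj: "Psi x = Psi y \<longleftrightarrow> x = y" for x y by (metis Phi_Psi)
  show ?thesis
    unfolding bergman_eq_range
  proof
    fix f g
    have eq: "bergman_dist \<alpha> f g = sqrt (LINT z|dA_weighted \<alpha>. (cmod (f z - g z))\<^sup>2)" for f g
      unfolding bergman_dist_def bergman_norm_def bergman_inner_def
        complex_norm_square[symmetric] integral_complex_of_real by simp
    show "0 \<le> bergman_dist \<alpha> f g" by (simp add: eq)
    show "bergman_dist \<alpha> f g = bergman_dist \<alpha> g f" unfolding eq by (simp only: norm_minus_commute)
  qed (auto simp: dist inj dist_triangle)
qed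

lemma homeomorphic_map_Psi: "homeomorphic_map euclidean (bergman_topology \<alpha>) Psi"
proof -
  have "Metric_space12 (UNIV :: ell2 set) dist (bergman \<alpha>) (bergman_dist \<alpha>)"
    using Metric_space_bergman Met_TC.Metric_space_axioms by (rule Metric_space12.intro[rotated])
  then have "homeomorphic_map Met_TC.mtopology (Metric_space.mtopology (bergman \<alpha>) (bergman_dist \<alpha>)) Psi"
    by (rule Metric_space12.isometry_imp_homeomorphic_map)
      (auto simp: bergman_eq_range bergman_dist_def Psi_diff[symmetric] bergman_norm_Psi dist_norm)
  then show ?thesis by (simp add: bergman_topology_def)
qed

lemma compactin_closure_Psi:
  "compactin (bergman_topology \<alpha>) (bergman_topology \<alpha> closure_of (Psi ` A)) \<longleftrightarrow> compact (closure A)"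
  using homeomorphic_map_closure_of[OF homeomorphic_map_Psi, of A]
    homeomorphic_map_compactness[OF homeomorphic_map_Psi, of "closure A"]
  by simp

lemma bounded_operator_transfer:
  assumes "bounded_operator \<alpha> S"
  defines "T \<equiv> \<lambda>x. Phi (S (Psi x))"
  shows "Psi (T x) = S (Psi x)" "bounded_linear T" "T (ell2_scale c x) = ell2_scale c (T x)"
proof -
  have S: "S (Psi x) \<in> bergman \<alpha>" for x using assms(1) by (auto simp: bounded_operator_def)
  show PT: "Psi (T x) = S (Psi x)" for x unfolding T_def by (rule Psi_Phi[OF S])
  have add: "T (x + y) = T x + T y" for x y
  proof -
    have "S (\<lambda>z. Psi x z + Psi y z) = (\<lambda>z. S (Psi x) z + S (Psi y) z)"
      using assms(1) unfolding bounded_operator_def by simp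
    then have "Psi (T (x + y)) = Psi (T x + T y)" by (simp add: PT Psi_add)
    then show ?thesis by (metis Phi_Psi)
  qed
  show scale: "T (ell2_scale c x) = ell2_scale c (T x)" for c x
  proof -
    have "S (\<lambda>z. c * Psi x z) = (\<lambda>z. c * S (Psi x) z)"
      using assms(1) unfolding bounded_operator_def by simp
    then have "Psi (T (ell2_scale c x)) = Psi (ell2_scale c (T x))" by (simp add: PT Psi_scale)
    then show ?thesis by (metis Phi_Psi)
  qed
  obtain C where C: "bergman_norm \<alpha> (S f) \<le> C * bergman_norm \<alpha> f" if "f \<in> bergman \<alpha>" for f
    using assms(1) unfolding bounded_operator_def by blast
  show "bounded_linear T"
  proof (rule bounded_linear_intro[OF add, where K = C])
    show "T (r *\<^sub>R x) = r *\<^sub>R T x" for r x using scale[of "of_real r" x] by (simp add: ell2_scale_of_real)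
    show "norm (T x) \<le> norm x * C" for x
      using C[OF Psi_bergman, of x] by (simp add: PT[symmetric] bergman_norm_Psi mult.commute)
  qed
qed

text \<open>The restriction makes the operator extensional, as the description in
  \<open>sqrt_operator\<close> demands.\<close>

lemma bounded_operator_from_ell2:
  assumes "bounded_linear T" "\<And>c x. T (ell2_scale c x) = ell2_scale c (T x)"
  shows "bounded_operator \<alpha> (restrict (\<lambda>f. Psi (T (Phi f))) (bergman \<alpha>))"
proof -
  interpret bounded_linear T by fact
  have sum: "(\<lambda>z. Psi x z + Psi y z) \<in> bergman \<alpha>" for x y
    unfolding Psi_add[symmetric] by (rule Psi_bergman)
  have scale: "(\<lambda>z. c * Psi x z) \<in> bergman \<alpha>" for x c
    unfolding Psi_scale[symmetric] by (rule Psi_bergman)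
  show ?thesis unfolding bounded_operator_def
  proof (intro conjI ballI allI)
    show "restrict (\<lambda>f. Psi (T (Phi f))) (bergman \<alpha>) \<in> bergman \<alpha> \<rightarrow> bergman \<alpha>" by auto
    fix f assume "f \<in> bergman \<alpha>"
    then obtain x where x: "f = Psi x" unfolding bergman_eq_range by blast
    show "restrict (\<lambda>f. Psi (T (Phi f))) (bergman \<alpha>) (\<lambda>z. c * f z)
      = (\<lambda>z. c * restrict (\<lambda>f. Psi (T (Phi f))) (bergman \<alpha>) f z)" for c
      using scale[of c x] by (simp add: x Psi_scale[symmetric] assms(2))
    fix g assume "g \<in> bergman \<alpha>"
    then obtain y where y: "g = Psi y" unfolding bergman_eq_range by blast
    show "restrict (\<lambda>f. Psi (T (Phi f))) (bergman \<alpha>) (\<lambda>z. f z + g z)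
      = (\<lambda>z. restrict (\<lambda>f. Psi (T (Phi f))) (bergman \<alpha>) f z + restrict (\<lambda>f. Psi (T (Phi f))) (bergman \<alpha>) g z)"
      using sum[of x y] by (simp add: x y Psi_add[symmetric] add)
  next
    obtain K where "\<And>x. norm (T x) \<le> norm x * K" using bounded by blast
    then have "bergman_norm \<alpha> (restrict (\<lambda>f. Psi (T (Phi f))) (bergman \<alpha>) f) \<le> K * bergman_norm \<alpha> f"
      if "f \<in> bergman \<alpha>" for f
      using that unfolding bergman_eq_range by (auto simp: bergman_norm_Psi mult.commute)
    then show "\<exists>C. \<forall>f\<in>bergman \<alpha>. bergman_norm \<alpha> (restrict (\<lambda>f. Psi (T (Phi f))) (bergman \<alpha>) f) \<le> C * bergman_norm \<alpha> f"
      by blast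
  qed
qed

text \<open>Over the complex scalars positivity of the quadratic form already forces symmetry.\<close>

lemma complex_positive_symmetric:
  assumes add: "\<And>x y. T (x + y) = T x + T y" and i: "\<And>x. T (ell2_scale \<i> x) = ell2_scale \<i> (T x)"
    and real: "\<And>x. T x \<bullet> ell2_scale \<i> x = 0"
  shows "T x \<bullet> y = x \<bullet> T y"
proof -
  interpret i: bounded_linear "ell2_scale \<i>" by (rule bounded_linear_ell2_scale)
  have polar: "T x \<bullet> ell2_scale \<i> y + T y \<bullet> ell2_scale \<i> x = 0" for x y
    using real[of "x + y"] by (simp add: add i.add inner_simps real)
  have ii: "ell2_scale \<i> (ell2_scale \<i> z) = - z" for z by (rule ell2_eqI) simp
  have "ell2_scale \<i> (T x) \<bullet> ell2_scale \<i> y - T y \<bullet> x = 0"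
    using polar[of "ell2_scale \<i> x" y] by (simp add: i ii)
  then show ?thesis by (simp add: ell2_scale_i_inner ii inner_commute)
qed

end

section \<open>The multiplication operator, its Gram operator and the positive root of the
  defect\<close>

locale bergman_symbol = bergman_weight +
  fixes \<phi> :: "complex \<Rightarrow> complex"
  assumes \<phi>: "\<phi> \<in> Hinf_ball"
begin

lemma \<phi>_holomorphic: "\<phi> holomorphic_on disc" and \<phi>_le_1: "z \<in> disc \<Longrightarrow> cmod (\<phi> z) \<le> 1"
  using \<phi> by (auto simp: Hinf_ball_def)

lemma mult_bergman:
  assumes "f \<in> bergman \<alpha>" shows "mult_operator \<phi> f \<in> bergman \<alpha>"
proof -
  have an: "(\<lambda>z. \<phi> z * f z) \<in> analytic_disc"
    using bergman_analytic[OF assms] \<phi>_holomorphic by (rule analytic_disc_mult[rotated])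
  have le: "(cmod (\<phi> z * f z))\<^sup>2 \<le> (cmod (f z))\<^sup>2" for z
  proof (cases "z \<in> disc")
    case True
    then show ?thesis using \<phi>_le_1[OF True] by (intro power_mono) (auto simp: norm_mult mult_left_le_one_le)
  next
    case False
    then show ?thesis using bergman_analytic[OF assms] by (simp add: analytic_disc_def)
  qed
  have "integrable dA (\<lambda>z. (1 - (cmod z)\<^sup>2) powr (2 * real 0 + \<alpha>) * (cmod (\<phi> z * f z))\<^sup>2)"
  proof (rule Bochner_Integration.integrable_bound)
    show "integrable dA (\<lambda>z. (1 - (cmod z)\<^sup>2) powr (2 * real 0 + \<alpha>) * (cmod (f z))\<^sup>2)"
      using assms by (simp add: A2_def)
    show "(\<lambda>z. (1 - (cmod z)\<^sup>2) powr (2 * real 0 + \<alpha>) * (cmod (\<phi> z * f z))\<^sup>2) \<in> borel_measurable dA"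
      using higher_deriv_measurable[OF an, of _ 0] by simp
    have "norm ((1 - (cmod z)\<^sup>2) powr (2 * real 0 + \<alpha>) * (cmod (\<phi> z * f z))\<^sup>2)
      \<le> norm ((1 - (cmod z)\<^sup>2) powr (2 * real 0 + \<alpha>) * (cmod (f z))\<^sup>2)" for z
      using mult_left_mono[OF le[of z], of "(1 - (cmod z)\<^sup>2) powr (2 * real 0 + \<alpha>)"]
      by (simp only: real_norm_def abs_mult abs_power2 abs_of_nonneg powr_ge_zero)
    then show "AE z in dA. norm ((1 - (cmod z)\<^sup>2) powr (2 * real 0 + \<alpha>) * (cmod (\<phi> z * f z))\<^sup>2)
      \<le> norm ((1 - (cmod z)\<^sup>2) powr (2 * real 0 + \<alpha>) * (cmod (f z))\<^sup>2)" by (intro AE_I2)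
  qed
  then show ?thesis using an by (simp add: A2_def mult_operator_def)
qed

definition mult_ell2 :: "ell2 \<Rightarrow> ell2" where "mult_ell2 x = Phi (mult_operator \<phi> (Psi x))"

lemma Psi_mult_ell2: "Psi (mult_ell2 x) = mult_operator \<phi> (Psi x)"
  unfolding mult_ell2_def by (intro Psi_Phi mult_bergman Psi_bergman)

lemma mult_ell2_scale: "mult_ell2 (ell2_scale c x) = ell2_scale c (mult_ell2 x)"
proof -
  have "Psi (mult_ell2 (ell2_scale c x)) = Psi (ell2_scale c (mult_ell2 x))"
    by (simp add: Psi_mult_ell2 Psi_scale mult_operator_def mult_ac)
  then show ?thesis by (metis Phi_Psi)
qed

text \<open>The isometry turns a difference of squared norms into one integral. This is the
  quadratic form of the identity minus the Gram operator, hence |D x|^2 for the defect operator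
  D.\<close>

lemma norm_diff_mult_ell2:
  "integrable (dA_weighted \<alpha>) (\<lambda>z. (1 - (cmod (\<phi> z))\<^sup>2) * (cmod (Psi x z))\<^sup>2)"
  "(norm x)\<^sup>2 - (norm (mult_ell2 x))\<^sup>2 = (LINT z|dA_weighted \<alpha>. (1 - (cmod (\<phi> z))\<^sup>2) * (cmod (Psi x z))\<^sup>2)"
proof -
  have eq: "(1 - (cmod (\<phi> z))\<^sup>2) * (cmod (Psi x z))\<^sup>2 = (cmod (Psi x z))\<^sup>2 - (cmod (Psi (mult_ell2 x) z))\<^sup>2" for z
    by (simp add: Psi_mult_ell2 mult_operator_def norm_mult power_mult_distrib algebra_simps)
  show "integrable (dA_weighted \<alpha>) (\<lambda>z. (1 - (cmod (\<phi> z))\<^sup>2) * (cmod (Psi x z))\<^sup>2)"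
    unfolding eq by (intro Bochner_Integration.integrable_diff integrable_norm_Psi)
  show "(norm x)\<^sup>2 - (norm (mult_ell2 x))\<^sup>2 = (LINT z|dA_weighted \<alpha>. (1 - (cmod (\<phi> z))\<^sup>2) * (cmod (Psi x z))\<^sup>2)"
    unfolding eq by (simp add: Bochner_Integration.integral_diff integrable_norm_Psi integral_norm_Psi)
qed

lemma norm_mult_ell2_le: "norm (mult_ell2 x) \<le> norm x"
proof -
  have "0 \<le> (LINT z|dA_weighted \<alpha>. (1 - (cmod (\<phi> z))\<^sup>2) * (cmod (Psi x z))\<^sup>2)"
  proof (rule integral_nonneg_AE)
    show "AE z in dA_weighted \<alpha>. 0 \<le> (1 - (cmod (\<phi> z))\<^sup>2) * (cmod (Psi x z))\<^sup>2"
      using AE_dA_weighted_disc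
      by eventually_elim (intro mult_nonneg_nonneg, auto simp: power_le_one \<phi>_le_1)
  qed
  then have "(norm (mult_ell2 x))\<^sup>2 \<le> (norm x)\<^sup>2" using norm_diff_mult_ell2(2)[of x] by linarith
  then show ?thesis by (rule power2_le_imp_le) simp
qed

lemma bounded_linear_mult_ell2: "bounded_linear mult_ell2"
proof (rule bounded_linear_intro[where K = 1])
  fix x y
  have "Psi (mult_ell2 (x + y)) = Psi (mult_ell2 x + mult_ell2 y)"
    by (simp add: Psi_mult_ell2 Psi_add mult_operator_def distrib_left)
  then show "mult_ell2 (x + y) = mult_ell2 x + mult_ell2 y" by (metis Phi_Psi)
  show "mult_ell2 (r *\<^sub>R x) = r *\<^sub>R mult_ell2 x" for r
    using mult_ell2_scale[of "of_real r" x] by (simp add: ell2_scale_of_real)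
qed (simp add: norm_mult_ell2_le)

text \<open>Riesz representation of the functional \<open>mult_ell2 x \<bullet> mult_ell2 y\<close>
  of \<open>y\<close> gives the Gram operator at once; putting \<open>y = A x\<close> gives the norm
  bound.\<close>

lemma mult_gram_exists:
  obtains A :: "ell2 \<Rightarrow>\<^sub>L ell2" where "norm A \<le> 1" "\<And>x y. blinfun_apply A x \<bullet> y = mult_ell2 x \<bullet> mult_ell2 y"
proof -
  interpret M: bounded_linear mult_ell2 by (rule bounded_linear_mult_ell2)
  have "\<exists>h. \<forall>y. mult_ell2 x \<bullet> mult_ell2 y = y \<bullet> h" for x
  proof -
    have "linear (\<lambda>y. mult_ell2 x \<bullet> mult_ell2 y)"
      by (rule linearI) (simp_all add: M.add M.scaleR inner_simps)
    moreover have "\<bar>mult_ell2 x \<bullet> mult_ell2 y\<bar> \<le> norm (mult_ell2 x) * norm y" for y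
      by (rule order_trans[OF Cauchy_Schwarz_ineq2]) (intro mult_left_mono norm_mult_ell2_le norm_ge_zero)
    ultimately show ?thesis
      using functional_dominated_by_operator[of "\<lambda>y. y" "\<lambda>y. mult_ell2 x \<bullet> mult_ell2 y" "norm (mult_ell2 x)"]
        linear_ident by metis
  qed
  then obtain A where A: "\<And>x y. mult_ell2 x \<bullet> mult_ell2 y = y \<bullet> A x" by metis
  have le: "norm (A x) \<le> norm x" for x
  proof (cases "A x = 0")
    case False
    have "norm (A x) * norm (A x) = mult_ell2 x \<bullet> mult_ell2 (A x)" by (simp add: A dot_square_norm power2_eq_square)
    also have "\<dots> \<le> norm (mult_ell2 x) * norm (mult_ell2 (A x))" by (rule norm_cauchy_schwarz)
    also have "\<dots> \<le> norm x * norm (A x)" by (intro mult_mono norm_mult_ell2_le norm_ge_zero)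
    finally show ?thesis using False by simp
  qed simp
  have "bounded_linear A"
  proof (rule bounded_linear_intro[where K = 1])
    show "A (x + y) = A x + A y" for x y
      by (rule vector_eq_ldot[THEN iffD1]) (simp add: A[symmetric] inner_simps M.add)
    show "A (r *\<^sub>R x) = r *\<^sub>R A x" for r x
      by (rule vector_eq_ldot[THEN iffD1]) (simp add: A[symmetric] inner_simps M.scaleR)
  qed (simp add: le)
  then have app: "blinfun_apply (Blinfun A) = A" by (rule bounded_linear_Blinfun_apply)
  show ?thesis
  proof (rule that[of "Blinfun A"])
    show "norm (Blinfun A) \<le> 1" by (rule norm_blinfun_bound) (simp_all add: app le)
    show "blinfun_apply (Blinfun A) x \<bullet> y = mult_ell2 x \<bullet> mult_ell2 y" for x y
      by (simp add: app A inner_commute)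
  qed
qed

text \<open>Both definite descriptions are evaluated in coordinates: the adjoint, at functions of
  the form \<open>mult_operator \<phi> f\<close>, is given by the Gram operator, and the square root
  is the constructed root of the identity minus that operator. Later arguments use D only through
  linearity, boundedness, symmetry and the form |D x|^2.\<close>

lemma defect_operator_transfer:
  obtains D where "bounded_linear D" "\<And>x y. D x \<bullet> y = x \<bullet> D y"
    "\<And>x. (norm (D x))\<^sup>2 = (LINT z|dA_weighted \<alpha>. (1 - (cmod (\<phi> z))\<^sup>2) * (cmod (Psi x z))\<^sup>2)"
    "\<And>x. defect_operator \<alpha> \<phi> (Psi x) = Psi (D x)"
    "bounded_operator \<alpha> (defect_operator \<alpha> \<phi>)"
proof -
  interpret i: bounded_linear "ell2_scale \<i>" by (rule bounded_linear_ell2_scale)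
  obtain A where A: "norm A \<le> 1" "\<And>x y. blinfun_apply A x \<bullet> y = mult_ell2 x \<bullet> mult_ell2 y"
    using mult_gram_exists by blast
  have A': "y \<bullet> blinfun_apply A x = mult_ell2 y \<bullet> mult_ell2 x" for x y
    using A(2)[of x y] by (simp add: inner_commute)
  have A_sym: "blinfun_apply A x \<bullet> y = x \<bullet> blinfun_apply A y" for x y by (simp add: A(2) A')
  have A_i: "ell2_scale \<i> (blinfun_apply A x) = blinfun_apply A (ell2_scale \<i> x)" for x
    by (rule vector_eq_rdot[THEN iffD1]) (simp add: A ell2_scale_i_inner mult_ell2_scale)
  have A_scale: "ell2_scale c (blinfun_apply A x) = blinfun_apply A (ell2_scale c x)" for c x
  proof -
    \<comment> \<open>Real linearity plus commutation with \<open>\<i>\<close> gives commutation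
      with every complex scalar.\<close>
    have "ell2_scale c y = Re c *\<^sub>R y + Im c *\<^sub>R ell2_scale \<i> y" for y
      by (rule ell2_eqI) (simp add: scaleR_conv_of_real complex_eq_iff algebra_simps)
    then show ?thesis by (simp add: blinfun.bilinear_simps A_i)
  qed
  obtain D where D: "\<forall>x. blinfun_apply D (blinfun_apply D x) = x - blinfun_apply A x"
    "\<forall>x y. blinfun_apply D x \<bullet> y = x \<bullet> blinfun_apply D y" "\<forall>x. blinfun_apply D x \<bullet> x \<ge> 0"
    "\<forall>B. bounded_linear B \<longrightarrow> (\<forall>x. B (blinfun_apply A x) = blinfun_apply A (B x)) \<longrightarrow>
      (\<forall>x. B (blinfun_apply D x) = blinfun_apply D (B x))"
    using defect_root_exists[OF A(1) A_sym] by (elim exE conjE)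
  note D = D(1)[rule_format] D(2)[rule_format] D(3)[rule_format] D(4)[rule_format]
  define P where "P f z = f z - adjoint_operator \<alpha> (mult_operator \<phi>) (mult_operator \<phi> f) z" for f z
  have P: "P (Psi x) = Psi (x - blinfun_apply A x)" for x
  proof -
    \<comment> \<open>The description is evaluated only at arguments of this form, where the Gram
      operator already supplies the required vector.\<close>
    have "adjoint_operator \<alpha> (mult_operator \<phi>) (mult_operator \<phi> (Psi x)) = Psi (blinfun_apply A x)"
      unfolding adjoint_operator_def
    proof (rule the_equality)
      show "Psi (blinfun_apply A x) \<in> bergman \<alpha> \<and> (\<forall>f\<in>bergman \<alpha>.
        bergman_inner \<alpha> (mult_operator \<phi> f) (mult_operator \<phi> (Psi x)) = bergman_inner \<alpha> f (Psi (blinfun_apply A x)))"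
      proof (intro conjI ballI)
        fix f assume "f \<in> bergman \<alpha>"
        then obtain y where y: "f = Psi y" unfolding bergman_eq_range by blast
        show "bergman_inner \<alpha> (mult_operator \<phi> f) (mult_operator \<phi> (Psi x)) = bergman_inner \<alpha> f (Psi (blinfun_apply A x))"
          by (rule complex_eqI) (simp_all add: y Psi_mult_ell2[symmetric] Re_inner_Psi Im_inner_Psi A_i A' mult_ell2_scale)
      qed simp
      fix h assume h: "h \<in> bergman \<alpha> \<and> (\<forall>f\<in>bergman \<alpha>.
        bergman_inner \<alpha> (mult_operator \<phi> f) (mult_operator \<phi> (Psi x)) = bergman_inner \<alpha> f h)"
      then obtain w where w: "h = Psi w" unfolding bergman_eq_range by blast
      have "y \<bullet> w = y \<bullet> blinfun_apply A x" for y
      proof -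
        have "bergman_inner \<alpha> (mult_operator \<phi> (Psi y)) (mult_operator \<phi> (Psi x)) = bergman_inner \<alpha> (Psi y) (Psi w)"
          using h w by simp
        from arg_cong[OF this, of Re] show ?thesis
          by (simp add: Psi_mult_ell2[symmetric] Re_inner_Psi A')
      qed
      then have "w = blinfun_apply A x" by (metis vector_eq_ldot)
      then show "h = Psi (blinfun_apply A x)" by (simp add: w)
    qed
    then show ?thesis by (simp add: P_def[abs_def] Psi_diff)
  qed
  define S where "S = restrict (\<lambda>f. Psi (blinfun_apply D (Phi f))) (bergman \<alpha>)"
  have S: "S (Psi x) = Psi (blinfun_apply D x)" for x by (simp add: S_def)
  have D_scale: "blinfun_apply D (ell2_scale c x) = ell2_scale c (blinfun_apply D x)" for c x
    using D(4)[OF bounded_linear_ell2_scale A_scale] by simp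
  have S_bdd: "bounded_operator \<alpha> S"
    unfolding S_def by (rule bounded_operator_from_ell2[OF blinfun.bounded_linear_right D_scale])
  have "sqrt_operator \<alpha> P = S"
    unfolding sqrt_operator_def
  proof (rule the_equality)
    have "bergman_inner \<alpha> (S f) f \<in> \<real>\<^sub>\<ge>\<^sub>0" if "f \<in> bergman \<alpha>" for f
    proof -
      obtain x where x: "f = Psi x" using \<open>f \<in> bergman \<alpha>\<close> unfolding bergman_eq_range by blast
      \<comment> \<open>\<open>D\<close> is symmetric and commutes with
        \<open>ell2_scale \<i>\<close>, which is skew for the real inner product; hence the
        imaginary part of the form vanishes.\<close>
      have "blinfun_apply D x \<bullet> ell2_scale \<i> x = - (blinfun_apply D x \<bullet> ell2_scale \<i> x)"
        by (metis D(2) D_scale ell2_scale_i_inner inner_commute)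
      then have "blinfun_apply D x \<bullet> ell2_scale \<i> x = 0" by simp
      then show ?thesis
        by (simp add: x S complex_nonneg_Reals_iff Re_inner_Psi Im_inner_Psi D(3))
    qed
    moreover have "S (S f) = P f" if "f \<in> bergman \<alpha>" for f
      using that unfolding bergman_eq_range by (auto simp: S D(1) P)
    ultimately show "S \<in> extensional (bergman \<alpha>) \<and> positive_operator \<alpha> S \<and> (\<forall>f\<in>bergman \<alpha>. S (S f) = P f)"
      using S_bdd by (simp add: positive_operator_def S_def restrict_extensional)
  next
    fix R assume R: "R \<in> extensional (bergman \<alpha>) \<and> positive_operator \<alpha> R \<and> (\<forall>f\<in>bergman \<alpha>. R (R f) = P f)"
    define T where "T x = Phi (R (Psi x))" for x
    have "bounded_operator \<alpha> R" using R by (simp add: positive_operator_def)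
    from bounded_operator_transfer[OF this, folded T_def]
    have PT: "\<And>x. Psi (T x) = R (Psi x)" and T: "bounded_linear T" and
      T_scale: "\<And>c x. T (ell2_scale c x) = ell2_scale c (T x)" by auto
    interpret T: bounded_linear T by fact
    have "bergman_inner \<alpha> (Psi (T x)) (Psi x) \<in> \<real>\<^sub>\<ge>\<^sub>0" for x
      using R by (simp add: positive_operator_def PT)
    then have T_pos: "T x \<bullet> x \<ge> 0" and T_real: "T x \<bullet> ell2_scale \<i> x = 0" for x
      by (simp_all add: complex_nonneg_Reals_iff Re_inner_Psi Im_inner_Psi)
    have T_sym: "T x \<bullet> y = x \<bullet> T y" for x y
      by (rule complex_positive_symmetric[OF T.add T_scale T_real])
    have TT: "T (T x) = x - blinfun_apply A x" for x
    proof -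
      have "Psi (T (T x)) = Psi (x - blinfun_apply A x)" using R by (simp add: PT P)
      then show ?thesis by (metis Phi_Psi)
    qed
    \<comment> \<open>\<open>T\<close> commutes with its own square and hence with \<open>A\<close>,
      the identity minus that square. By the construction of \<open>D\<close> it then commutes with
      \<open>D\<close>, which is what uniqueness of the root asks for.\<close>
    have TA: "T (blinfun_apply A x) = blinfun_apply A (T x)" for x
    proof -
      have A_eq: "blinfun_apply A y = y - T (T y)" for y by (simp add: TT)
      show ?thesis unfolding A_eq by (simp add: T.diff)
    qed
    have TD: "T x = blinfun_apply D x" for x
    proof (rule positive_root_unique[where S = T and D = "blinfun_apply D"])
      show "linear T" by (rule bounded_linear.linear[OF T])
      show "linear (blinfun_apply D)" by (intro bounded_linear.linear blinfun.bounded_linear_right)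
      show "T (blinfun_apply D x) = blinfun_apply D (T x)" for x by (rule D(4)[OF T TA])
    qed (rule T_sym T_pos D(2) D(3) | simp only: TT D(1))+
    show "R = S"
    proof
      fix f
      show "R f = S f"
      proof (cases "f \<in> bergman \<alpha>")
        case True
        then obtain x where x: "f = Psi x" unfolding bergman_eq_range by blast
        show ?thesis using PT[of x] by (simp add: x S TD)
      next
        case False
        then show ?thesis using R by (simp add: S_def extensional_def)
      qed
    qed
  qed
  then have defect: "defect_operator \<alpha> \<phi> = S" by (simp add: defect_operator_def P_def[abs_def])
  have norm_D: "(norm (blinfun_apply D x))\<^sup>2 = (LINT z|dA_weighted \<alpha>. (1 - (cmod (\<phi> z))\<^sup>2) * (cmod (Psi x z))\<^sup>2)" for x
  proof -
    have "(norm (blinfun_apply D x))\<^sup>2 = blinfun_apply D (blinfun_apply D x) \<bullet> x"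
      using D(2)[of "blinfun_apply D x" x] by (simp add: power2_norm_eq_inner)
    also have "\<dots> = (norm x)\<^sup>2 - (norm (mult_ell2 x))\<^sup>2"
      by (simp add: D(1) inner_simps A(2) power2_norm_eq_inner)
    finally show ?thesis unfolding norm_diff_mult_ell2(2) .
  qed
  show ?thesis
    by (rule that[OF blinfun.bounded_linear_right[of D] D(2) norm_D]) (simp_all add: defect S S_bdd)
qed

lemma sub_bergman_eq:
  assumes "\<And>x. defect_operator \<alpha> \<phi> (Psi x) = Psi (D x)"
  shows "sub_bergman \<alpha> \<phi> = Psi ` range D"
  unfolding sub_bergman_def bergman_eq_range by (auto simp: assms image_image)

lemma compact_defect_iff:
  assumes "\<And>x. defect_operator \<alpha> \<phi> (Psi x) = Psi (D x)" "bounded_operator \<alpha> (defect_operator \<alpha> \<phi>)"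
  shows "compact_operator \<alpha> (defect_operator \<alpha> \<phi>) \<longleftrightarrow> compact (closure (D ` cball 0 1))"
proof -
  have "{f \<in> bergman \<alpha>. bergman_norm \<alpha> f \<le> 1} = Psi ` cball 0 1"
    unfolding bergman_eq_range by (auto simp: bergman_norm_Psi)
  then have "defect_operator \<alpha> \<phi> ` {f \<in> bergman \<alpha>. bergman_norm \<alpha> f \<le> 1} = Psi ` D ` cball 0 1"
    by (auto simp: assms(1) image_image)
  then show ?thesis unfolding compact_operator_def compactin_closure_Psi[symmetric] using assms(2) by simp
qed

end

section \<open>Weighted sequence spaces\<close>


definition weighted_ell2 :: "ell2 set" where
  "weighted_ell2 = {x. summable (\<lambda>n. (real n + 1) * (cmod (ell2_nth x n))\<^sup>2)}"

lemma Beta_right_Suc: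
  assumes "x > 0" "y > (0::real)"
  shows "Beta x (y + 1) = y / (x + y) * Beta x y"
  using Beta_plus1_right[of y x] assms nonpos_Ints_nonpos[of y] by (auto simp: field_simps)

lemma Beta_left_Suc:
  assumes "x > 0" "y > (0::real)"
  shows "Beta (x + 1) y = x / (x + y) * Beta x y"
  using Beta_plus1_left[of x y] assms nonpos_Ints_nonpos[of x] by (auto simp: field_simps)

lemma summable_comparable_iff:
  fixes a b p :: "nat \<Rightarrow> real"
  assumes c: "c > 0" and p: "\<And>n. p n \<ge> 0"
    and le: "\<And>n. c * b n \<le> a n" "\<And>n. a n \<le> C * b n" and b: "\<And>n. b n \<ge> 0"
  shows "summable (\<lambda>n. p n * a n) \<longleftrightarrow> summable (\<lambda>n. p n * b n)"
proof
  assume "summable (\<lambda>n. p n * a n)"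
  from summable_mult[OF this, of "1 / c"]
  show "summable (\<lambda>n. p n * b n)"
  proof (rule summable_comparison_test')
    fix n
    have "b n \<le> 1 / c * a n" using le(1)[of n] c by (simp add: field_simps)
    from mult_left_mono[OF this p[of n]] show "norm (p n * b n) \<le> 1 / c * (p n * a n)"
      using p[of n] b[of n] by (simp add: algebra_simps)
  qed
next
  assume "summable (\<lambda>n. p n * b n)"
  from summable_mult[OF this, of C]
  show "summable (\<lambda>n. p n * a n)"
  proof (rule summable_comparison_test')
    fix n
    have "0 \<le> a n" using le(1)[of n] c b[of n] by (meson mult_nonneg_nonneg less_imp_le order_trans)
    then show "norm (p n * a n) \<le> C * (p n * b n)"
      using mult_left_mono[OF le(2)[of n] p[of n]] p[of n] by (simp add: algebra_simps)
  qed
qed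

context bergman_weight
begin

text \<open>The factor with which the Taylor coefficient of index \<open>n + k\<close> (not
  \<open>n\<close>) enters the integral defining \<open>A2 k (\<alpha> - 1)\<close>: a squared
  quotient of factorials from differentiating, and the moment for the exponent 2 k + \<alpha> -
  1.\<close>

definition deriv_weight :: "nat \<Rightarrow> nat \<Rightarrow> real" where
  "deriv_weight k n = (fact (n + k) / fact n)\<^sup>2 * Beta (real n + 1) (2 * real k + \<alpha>)"

text \<open>Both weights belong to the coefficient of index \<open>n + k + 1\<close>. Raising the
  order by one therefore multiplies its weight by an explicit ratio, obtained by shifting one
  argument of Beta at a time.\<close>

lemma deriv_weight_Suc:
  assumes "2 * real k + \<alpha> > 0"
  defines "y \<equiv> 2 * real k + \<alpha>"
  shows "deriv_weight (Suc k) n = deriv_weight k (Suc n) * ((real n + 1) * y * (y + 1) / (real n + y + 2))"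
proof -
  have y: "y > 0" using assms by simp
  let ?B = "Beta (real n + 1) y" and ?f = "fact (Suc n + k) / fact (Suc n) :: real"
  have k: "2 * real (Suc k) + \<alpha> = (y + 1) + 1" by (simp add: y_def)
  have "Beta (real n + 1) (2 * real (Suc k) + \<alpha>) = (y + 1) / (real n + y + 2) * (y / (real n + 1 + y) * ?B)"
    unfolding k using y Beta_right_Suc[of "real n + 1" "y + 1"] Beta_right_Suc[of "real n + 1" y] by (simp add: add_ac)
  moreover have "Beta (real (Suc n) + 1) y = (real n + 1) / (real n + 1 + y) * ?B"
    using Beta_left_Suc[of "real n + 1" y] y by (simp add: add_ac)
  moreover have "fact (n + Suc k) / fact n = ?f * (real n + 1)"
  proof -
    have "fact (Suc n) = (real n + 1) * fact n" by (simp add: algebra_simps)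
    then have "?f * (real n + 1) = fact (Suc n + k) / ((real n + 1) * fact n) * (real n + 1)" by (simp only:)
    also have "\<dots> = fact (Suc n + k) / fact n" by (simp del: fact_Suc)
    finally show ?thesis by simp
  qed
  moreover have "(F * (real n + 1))\<^sup>2 * ((y + 1) / (real n + y + 2) * (y / (real n + 1 + y) * B))
    = F\<^sup>2 * ((real n + 1) / (real n + 1 + y) * B) * ((real n + 1) * y * (y + 1) / (real n + y + 2))" for F B :: real
    by (simp add: power2_eq_square mult_ac)
  ultimately show ?thesis unfolding deriv_weight_def y_def[symmetric] by (simp only:)
qed

lemma deriv_weight_1: "deriv_weight 1 n = (real n + 1) * wt (Suc n)"
proof -
  let ?B = "Beta (real n + 1) (\<alpha> + 1)"
  have "Beta (real n + 1) (2 * real 1 + \<alpha>) = (\<alpha> + 1) / (real n + 1 + (\<alpha> + 1)) * ?B"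
    using Beta_right_Suc[of "real n + 1" "\<alpha> + 1"] \<alpha> by (simp add: add_ac)
  moreover have "Beta (real (Suc n) + 1) (\<alpha> + 1) = (real n + 1) / (real n + 1 + (\<alpha> + 1)) * ?B"
    using Beta_left_Suc[of "real n + 1" "\<alpha> + 1"] \<alpha> by (simp add: add_ac)
  moreover have "fact (n + 1) / fact n = real n + 1" by simp
  ultimately show ?thesis unfolding deriv_weight_def wt_def by (simp add: power2_eq_square add_ac)
qed

text \<open>Induction on the order, starting at 1 because order 0 is admissible only for
  \<open>\<alpha> > 0\<close> and is then treated separately. The ratio gained at each step lies
  between positive constants, and the index \<open>n + k\<close> is that of the coefficient
  concerned.\<close>

lemma deriv_weight_comparable:
  assumes "2 * real k + \<alpha> > 0"
  shows "\<exists>c>0. \<exists>C. \<forall>n. c * ((real (n + k) + 1) * wt (n + k)) \<le> deriv_weight k n \<and>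
    deriv_weight k n \<le> C * ((real (n + k) + 1) * wt (n + k))"
proof -
  have ind_step: "\<exists>c>0. \<exists>C. \<forall>n. c * ((real (n + Suc k) + 1) * wt (n + Suc k)) \<le> deriv_weight (Suc k) n \<and>
    deriv_weight (Suc k) n \<le> C * ((real (n + Suc k) + 1) * wt (n + Suc k))"
    if pos: "2 * real k + \<alpha> > 0" and
      IH: "\<exists>c>0. \<exists>C. \<forall>n. c * ((real (n + k) + 1) * wt (n + k)) \<le> deriv_weight k n \<and>
        deriv_weight k n \<le> C * ((real (n + k) + 1) * wt (n + k))" for k
  proof -
    define y where "y = 2 * real k + \<alpha>"
    have y: "y > 0" using pos by (simp add: y_def)
    obtain c C where c: "c > 0" and le: "\<And>n. c * ((real (n + k) + 1) * wt (n + k)) \<le> deriv_weight k n"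
      "\<And>n. deriv_weight k n \<le> C * ((real (n + k) + 1) * wt (n + k))" using IH by blast
    let ?r = "\<lambda>n. (real n + 1) * y * (y + 1) / (real n + y + 2)"
    \<comment> \<open>The bounds are the value of the ratio at \<open>n = 0\<close> and its limit
      for large \<open>n\<close>.\<close>
    have r: "y * (y + 1) / (y + 2) \<le> ?r n" "?r n \<le> y * (y + 1)" for n
    proof -
      have "(real n + y + 2) \<le> (real n + 1) * (y + 2)" using y by (simp add: algebra_simps)
      then have "1 / (y + 2) \<le> (real n + 1) / (real n + y + 2)"
        using y by (simp add: divide_le_eq pos_le_divide_eq mult.commute)
      from mult_left_mono[OF this, of "y * (y + 1)"] show "y * (y + 1) / (y + 2) \<le> ?r n" using y by (simp add: mult_ac)
      have "(real n + 1) / (real n + y + 2) \<le> 1" using y by simp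
      from mult_left_mono[OF this, of "y * (y + 1)"] show "?r n \<le> y * (y + 1)" using y by (simp add: mult_ac)
    qed
    have w: "0 \<le> (real m + 1) * wt m" for m using wt_pos[of m] by simp
    show ?thesis
    proof (rule exI[of _ "c * (y * (y + 1) / (y + 2))"], rule conjI[rotated], rule exI[of _ "C * (y * (y + 1))"], intro allI conjI)
      show "c * (y * (y + 1) / (y + 2)) > 0" using c y by simp
      fix n
      have dw: "0 \<le> deriv_weight k (Suc n)"
        using le(1)[of "Suc n"] c w[of "Suc n + k"] by (meson mult_nonneg_nonneg less_imp_le order_trans)
      have "c * ((real (Suc n + k) + 1) * wt (Suc n + k)) * (y * (y + 1) / (y + 2)) \<le> deriv_weight k (Suc n) * ?r n"
        using dw r(1)[of n] y by (intro mult_mono le) auto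
      then show "c * (y * (y + 1) / (y + 2)) * ((real (n + Suc k) + 1) * wt (n + Suc k)) \<le> deriv_weight (Suc k) n"
        unfolding deriv_weight_Suc[OF pos] y_def[symmetric] by (simp add: mult_ac)
      have "deriv_weight k (Suc n) * ?r n \<le> C * ((real (Suc n + k) + 1) * wt (Suc n + k)) * (y * (y + 1))"
        using dw le(2)[of "Suc n"] r(2)[of n] y by (intro mult_mono) (auto intro: order_trans)
      then show "deriv_weight (Suc k) n \<le> C * (y * (y + 1)) * ((real (n + Suc k) + 1) * wt (n + Suc k))"
        unfolding deriv_weight_Suc[OF pos] y_def[symmetric] by (simp add: mult_ac)
    qed
  qed
  show ?thesis
  proof (cases "k = 0")
    case True
    then have "\<alpha> > 0" using assms by simp
    have eq: "(real n + 1) * wt n = deriv_weight 0 n * ((\<alpha> + 1) * \<alpha> * ((real n + 1) / (real n + 1 + \<alpha>)))" for n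
      using Beta_right_Suc[of "real n + 1" \<alpha>] \<open>\<alpha> > 0\<close> by (simp add: deriv_weight_def wt_def)
    have dw: "deriv_weight 0 n > 0" for n using \<open>\<alpha> > 0\<close> by (simp add: deriv_weight_def Beta_nonneg)
    have r: "(real n + 1) / (real n + 1 + \<alpha>) \<le> 1" "1 / (1 + \<alpha>) \<le> (real n + 1) / (real n + 1 + \<alpha>)" for n
      using \<open>\<alpha> > 0\<close> by (simp_all add: divide_le_eq pos_le_divide_eq algebra_simps)
    show ?thesis unfolding True
    proof (rule exI[of _ "1 / ((\<alpha> + 1) * \<alpha>)"], rule conjI[rotated], rule exI[of _ "1 / \<alpha>"], intro allI conjI)
      show "1 / ((\<alpha> + 1) * \<alpha>) > 0" using \<open>\<alpha> > 0\<close> by simp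
      fix n
      have "1 / ((\<alpha> + 1) * \<alpha>) * ((real n + 1) * wt n) = deriv_weight 0 n * ((real n + 1) / (real n + 1 + \<alpha>))"
        unfolding eq using \<open>\<alpha> > 0\<close> by simp
      also have "\<dots> \<le> deriv_weight 0 n" using dw[of n] r(1)[of n] by (intro mult_left_le) auto
      finally show "1 / ((\<alpha> + 1) * \<alpha>) * ((real (n + 0) + 1) * wt (n + 0)) \<le> deriv_weight 0 n" by simp
      have "deriv_weight 0 n * ((\<alpha> + 1) * (1 / (1 + \<alpha>))) \<le> deriv_weight 0 n * ((\<alpha> + 1) * ((real n + 1) / (real n + 1 + \<alpha>)))"
        using dw[of n] r(2)[of n] \<open>\<alpha> > 0\<close> by (intro mult_left_mono) auto
      also have "\<dots> = 1 / \<alpha> * ((real n + 1) * wt n)" unfolding eq using \<open>\<alpha> > 0\<close> by simp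
      finally show "deriv_weight 0 n \<le> 1 / \<alpha> * ((real (n + 0) + 1) * wt (n + 0))" using \<open>\<alpha> > 0\<close> by (simp add: add.commute)
    qed
  next
    case False
    then have "1 \<le> k" by simp
    then show ?thesis
    proof (induction k rule: dec_induct)
      case base
      show ?case
      proof (rule exI[of _ "1/2"], rule conjI[rotated], rule exI[of _ 1], intro allI conjI)
        fix n
        have "1 / 2 * ((real (n + 1) + 1) * wt (n + 1)) \<le> (real n + 1) * wt (Suc n)"
          using wt_pos[of "Suc n"] by (simp add: field_simps)
        then show "1 / 2 * ((real (n + 1) + 1) * wt (n + 1)) \<le> deriv_weight 1 n" unfolding deriv_weight_1 .
        show "deriv_weight 1 n \<le> 1 * ((real (n + 1) + 1) * wt (n + 1))"
          unfolding deriv_weight_1 using wt_pos[of "Suc n"] by (simp add: field_simps)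
      qed simp
    next
      case (step k)
      have "real k \<ge> 1" using step(1) by simp
      then have "2 * real k + \<alpha> > 0" using \<alpha> by linarith
      then show ?case by (rule ind_step[OF _ step.IH])
    qed
  qed
qed

text \<open>The order enters only through comparable weights and a shift of the index by
  \<open>k\<close>, neither of which affects summability; so every admissible order gives the same
  space.\<close>

lemma A2_eq_weighted:
  assumes "2 * real k + (\<alpha> - 1) > -1"
  shows "A2 k (\<alpha> - 1) = Psi ` weighted_ell2"
proof -
  have pos: "2 * real k + \<alpha> > 0" using assms by simp
  obtain c C where c: "c > 0" and le: "\<And>n. c * ((real (n + k) + 1) * wt (n + k)) \<le> deriv_weight k n"
      "\<And>n. deriv_weight k n \<le> C * ((real (n + k) + 1) * wt (n + k))"
    using deriv_weight_comparable[OF pos] by blast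
  have taylor: "(cmod (taylor_coeff ((deriv ^^ k) f) n))\<^sup>2 * Beta (real n + 1) (2 * real k + (\<alpha> - 1) + 1)
    = (cmod (taylor_coeff f (n + k)))\<^sup>2 * deriv_weight k n" for f n
  proof -
    have "taylor_coeff ((deriv ^^ k) f) n = taylor_coeff f (n + k) * of_real (fact (n + k) / fact n)"
      by (simp add: funpow_add)
    then show ?thesis by (simp only: norm_mult norm_of_real power_mult_distrib power2_abs deriv_weight_def) simp
  qed
  have iff: "f \<in> A2 k (\<alpha> - 1) \<longleftrightarrow> summable (\<lambda>n. (real n + 1) * (wt n * (cmod (taylor_coeff f n))\<^sup>2))"
    if "f \<in> analytic_disc" for f
  proof -
    have "f \<in> A2 k (\<alpha> - 1) \<longleftrightarrow> summable (\<lambda>n. (cmod (taylor_coeff f (n + k)))\<^sup>2 * deriv_weight k n)"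
      unfolding A2_iff[OF that assms] taylor ..
    also have "\<dots> \<longleftrightarrow> summable (\<lambda>n. (cmod (taylor_coeff f (n + k)))\<^sup>2 * ((real (n + k) + 1) * wt (n + k)))"
      by (rule summable_comparable_iff[OF c _ le]) (simp_all add: less_imp_le[OF wt_pos])
    also have "\<dots> \<longleftrightarrow> summable (\<lambda>n. (cmod (taylor_coeff f n))\<^sup>2 * ((real n + 1) * wt n))"
      by (rule summable_iff_shift[where f = "\<lambda>n. (cmod (taylor_coeff f n))\<^sup>2 * ((real n + 1) * wt n)"])
    finally show ?thesis by (simp only: mult_ac)
  qed
  have mem: "Psi x \<in> A2 k (\<alpha> - 1) \<longleftrightarrow> x \<in> weighted_ell2" for x
    unfolding iff[OF Psi_analytic] wt_taylor_coeff_Psi weighted_ell2_def by simp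
  \<comment> \<open>The weight \<open>real n + 1\<close> is at least 1, so the space lies inside
    \<open>bergman \<alpha>\<close>, the range of \<open>Psi\<close>.\<close>
  have "f \<in> range Psi" if "f \<in> A2 k (\<alpha> - 1)" for f
  proof -
    have an: "f \<in> analytic_disc" using that by (simp add: A2_def)
    have "summable (\<lambda>n. wt n * (cmod (taylor_coeff f n))\<^sup>2)"
      using that unfolding iff[OF an]
    proof (rule summable_comparison_test')
      fix n
      have "1 * (wt n * (cmod (taylor_coeff f n))\<^sup>2) \<le> (real n + 1) * (wt n * (cmod (taylor_coeff f n))\<^sup>2)"
        using wt_pos[of n] by (intro mult_right_mono mult_nonneg_nonneg) auto
      then show "norm (wt n * (cmod (taylor_coeff f n))\<^sup>2) \<le> (real n + 1) * (wt n * (cmod (taylor_coeff f n))\<^sup>2)"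
        using wt_pos[of n] by (simp only: real_norm_def abs_mult abs_power2 abs_of_pos mult_1)
    qed
    then show ?thesis using an unfolding bergman_eq_range[symmetric] bergman_iff by blast
  qed
  then show ?thesis using mem by blast
qed

text \<open>The extra factor 1 - |z|^2 raises the exponent to \<open>\<alpha> + 1\<close>, so this
  is Parseval one weight up, where Beta changes by the factor
  \<open>(\<alpha> + 1) / (real n + \<alpha> + 2)\<close>.\<close>

lemma boundary_weight_integral:
  "integrable (dA_weighted \<alpha>) (\<lambda>z. (1 - (cmod z)\<^sup>2) * (cmod (Psi x z))\<^sup>2)"
  "(LINT z|dA_weighted \<alpha>. (1 - (cmod z)\<^sup>2) * (cmod (Psi x z))\<^sup>2)
    = (\<Sum>n. (cmod (ell2_nth x n))\<^sup>2 * ((\<alpha> + 1) / (real n + \<alpha> + 2)))"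
  "summable (\<lambda>n. (cmod (ell2_nth x n))\<^sup>2 * ((\<alpha> + 1) / (real n + \<alpha> + 2)))"
proof -
  have [measurable]: "Psi x \<in> borel_measurable borel" using Psi_analytic by measurable
  have hol: "Psi x holomorphic_on disc" using Psi_analytic by (simp add: analytic_disc_def)
  let ?g = "\<lambda>z. (1 - (cmod z)\<^sup>2) * (cmod (Psi x z))\<^sup>2"
  let ?h = "\<lambda>z. (1 - (cmod z)\<^sup>2) powr 1 * (cmod (Psi x z))\<^sup>2"
  \<comment> \<open>Writing \<open>powr 1\<close> lets the exponents be added. Outside the disc the
    two weights may differ, but \<open>Psi x\<close> is zero there.\<close>
  have gh: "?g z = ?h z" for z
    by (cases "z \<in> disc") (auto simp: Psi_def abs_square_less_1 less_imp_le)
  let ?s = "\<lambda>n. (cmod (ell2_nth x n))\<^sup>2 * ((\<alpha> + 1) / (real n + \<alpha> + 2))"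
  have s: "(\<alpha> + 1) * ((cmod (taylor_coeff (Psi x) n))\<^sup>2 * Beta (real n + 1) (\<alpha> + 1 + 1)) = ?s n" for n
  proof -
    have "Beta (real n + 1) (\<alpha> + 1 + 1) = (\<alpha> + 1) / (real n + \<alpha> + 2) * Beta (real n + 1) (\<alpha> + 1)"
      using Beta_right_Suc[of "real n + 1" "\<alpha> + 1"] \<alpha> by (simp add: add_ac)
    then have "(\<alpha> + 1) * ((cmod (taylor_coeff (Psi x) n))\<^sup>2 * Beta (real n + 1) (\<alpha> + 1 + 1))
      = (wt n * (cmod (taylor_coeff (Psi x) n))\<^sup>2) * ((\<alpha> + 1) / (real n + \<alpha> + 2))"
      by (simp only: wt_def mult_ac)
    then show ?thesis by (simp only: wt_taylor_coeff_Psi)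
  qed
  have s0: "0 \<le> ?s n" for n using \<alpha> by simp
  show sm: "summable ?s"
  proof (rule summable_comparison_test'[OF summable_ell2[of x]])
    fix n
    have "(\<alpha> + 1) / (real n + \<alpha> + 2) \<le> 1" using \<alpha> by simp
    then show "norm (?s n) \<le> (cmod (ell2_nth x n))\<^sup>2"
      unfolding real_norm_def abs_of_nonneg[OF s0] by (intro mult_left_le) auto
  qed
  have t0: "0 \<le> (cmod (taylor_coeff (Psi x) n))\<^sup>2 * Beta (real n + 1) (\<alpha> + 1 + 1)" for n
    using \<alpha> by (intro mult_nonneg_nonneg less_imp_le[OF Beta_nonneg]) auto
  have "(\<integral>\<^sup>+z. ennreal (?h z) \<partial>dA_weighted \<alpha>)
    = ennreal (\<alpha> + 1) * (\<integral>\<^sup>+z. ennreal ((1 - (cmod z)\<^sup>2) powr (\<alpha> + 1) * (cmod (Psi x z))\<^sup>2) \<partial>dA)"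
    unfolding powr_add by (subst nn_integral_dA_weighted) (simp_all only: mult.assoc, measurable)
  also have "\<dots> = ennreal (\<alpha> + 1) * (\<Sum>n. ennreal ((cmod (taylor_coeff (Psi x) n))\<^sup>2 * Beta (real n + 1) (\<alpha> + 1 + 1)))"
    using \<alpha> by (subst parseval_dA[OF hol]) auto
  also have "\<dots> = (\<Sum>n. ennreal ((\<alpha> + 1) * ((cmod (taylor_coeff (Psi x) n))\<^sup>2 * Beta (real n + 1) (\<alpha> + 1 + 1))))"
    using \<alpha> t0 by (subst ennreal_suminf_cmult[symmetric]) (simp add: ennreal_mult)
  also have "\<dots> = ennreal (\<Sum>n. ?s n)" unfolding s by (rule suminf_ennreal2[OF s0 sm])
  finally have nn: "(\<integral>\<^sup>+z. ennreal (?h z) \<partial>dA_weighted \<alpha>) = ennreal (\<Sum>n. ?s n)" .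
  have h0: "0 \<le> ?h z" for z by simp
  have int: "integrable (dA_weighted \<alpha>) ?h"
    by (rule integrableI_nonneg) (measurable, use nn h0 in auto)
  show "integrable (dA_weighted \<alpha>) ?g" unfolding gh by (rule int)
  have "ennreal (LINT z|dA_weighted \<alpha>. ?h z) = ennreal (\<Sum>n. ?s n)"
    using nn nn_integral_eq_integral[OF int] h0 by simp
  moreover have "0 \<le> (\<Sum>n. ?s n)" by (rule suminf_nonneg[OF sm s0])
  moreover have "0 \<le> (LINT z|dA_weighted \<alpha>. ?h z)" by (rule Bochner_Integration.integral_nonneg[OF h0])
  ultimately show "(LINT z|dA_weighted \<alpha>. ?g z) = (\<Sum>n. ?s n)"
    unfolding gh by (simp only: ennreal_inj)
qed

end


lemma weighted_bound_iff:
  "x \<in> weighted_ell2 \<longleftrightarrow> (\<exists>K. \<forall>N. (\<Sum>n<N. (real n + 1) * (cmod (ell2_nth x n))\<^sup>2) \<le> K)"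
proof
  assume "x \<in> weighted_ell2"
  then have "(\<Sum>n<N. (real n + 1) * (cmod (ell2_nth x n))\<^sup>2) \<le> (\<Sum>n. (real n + 1) * (cmod (ell2_nth x n))\<^sup>2)" for N
    unfolding weighted_ell2_def by (intro sum_le_suminf) auto
  then show "\<exists>K. \<forall>N. (\<Sum>n<N. (real n + 1) * (cmod (ell2_nth x n))\<^sup>2) \<le> K" by blast
next
  assume "\<exists>K. \<forall>N. (\<Sum>n<N. (real n + 1) * (cmod (ell2_nth x n))\<^sup>2) \<le> K"
  then show "x \<in> weighted_ell2" unfolding weighted_ell2_def
    using summable_if_bounded_sums[of "\<lambda>n. (real n + 1) * (cmod (ell2_nth x n))\<^sup>2"] by auto
qed

lemma weighted_bound_imp_compact:
  assumes "\<And>x N. (\<Sum>n<N. (real n + 1) * (cmod (ell2_nth (D x) n))\<^sup>2) \<le> K * (norm x)\<^sup>2"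
  shows "compact (closure (D ` cball 0 1))"
proof -
  let ?S = "{y. \<forall>N. (\<Sum>n<N. (real n + 1) * (cmod (ell2_nth y n))\<^sup>2) \<le> \<bar>K\<bar>}"
  have S: "compact ?S"
    by (rule compact_weighted_ell2_ball)
      (auto intro: filterlim_at_top_mono[OF filterlim_real_sequentially])
  have "D x \<in> ?S" if "x \<in> cball 0 1" for x
  proof -
    have "(norm x)\<^sup>2 \<le> 1" using that by (simp add: power_le_one)
    then have "K * (norm x)\<^sup>2 \<le> \<bar>K\<bar> * 1" by (intro mult_mono) auto
    then show ?thesis using assms[where x = x] by (auto intro: order_trans)
  qed
  then have "closure (D ` cball 0 1) \<subseteq> ?S"
    by (intro closure_minimal compact_imp_closed[OF S]) blast
  then have "?S \<inter> closure (D ` cball 0 1) = closure (D ` cball 0 1)" by (rule Int_absorb1)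
  then show ?thesis using compact_Int_closed[OF S closed_closure[of "D ` cball 0 1"]] by (simp only:)
qed

text \<open>The closed graph theorem in disguise: the weighted truncations of \<open>D\<close> are pointwise bounded.\<close>

lemma range_weighted_imp_bound:
  fixes D :: "'a::banach \<Rightarrow> ell2"
  assumes D: "bounded_linear D" and range: "range D \<subseteq> weighted_ell2"
  obtains K where "\<And>x N. (\<Sum>n<N. (real n + 1) * (cmod (ell2_nth (D x) n))\<^sup>2) \<le> K * (norm x)\<^sup>2"
proof -
  interpret bounded_linear D by fact
  define T where "T N x = Ell2 (\<lambda>n. if n < N then sqrt (real n + 1) *\<^sub>R ell2_nth (D x) n else 0)" for N x
  have nth: "ell2_nth (T N x) n = (if n < N then sqrt (real n + 1) *\<^sub>R ell2_nth (D x) n else 0)" for N x n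
    unfolding T_def by (rule ell2_nth_Ell2_finite)
  have norm: "(norm (T N x))\<^sup>2 = (\<Sum>n<N. (real n + 1) * (cmod (ell2_nth (D x) n))\<^sup>2)" for N x
  proof -
    have "(norm (T N x))\<^sup>2 = (\<Sum>n<N. (cmod (ell2_nth (T N x) n))\<^sup>2)"
      unfolding norm_ell2_squared by (rule suminf_finite) (auto simp: nth)
    also have "\<dots> = (\<Sum>n<N. (real n + 1) * (cmod (ell2_nth (D x) n))\<^sup>2)"
      by (intro sum.cong) (auto simp: nth power_mult_distrib)
    finally show ?thesis .
  qed
  obtain B where B: "\<And>x. norm (D x) \<le> norm x * B" using bounded by blast
  have "bounded_linear (T N)" for N
  proof (rule bounded_linear_intro[where K = "sqrt (real N + 1) * \<bar>B\<bar>"])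
    show "T N (x + y) = T N x + T N y" for x y
      by (rule ell2_eqI) (simp add: nth add scaleR_add_right)
    show "T N (r *\<^sub>R x) = r *\<^sub>R T N x" for r x
      by (rule ell2_eqI) (simp add: nth scaleR mult.commute)
    fix x
    have "(norm (T N x))\<^sup>2 \<le> (real N + 1) * (norm (D x))\<^sup>2"
    proof -
      have "(norm (T N x))\<^sup>2 \<le> (\<Sum>n<N. (real N + 1) * (cmod (ell2_nth (D x) n))\<^sup>2)"
        unfolding norm by (intro sum_mono mult_right_mono) auto
      also have "\<dots> \<le> (real N + 1) * (norm (D x))\<^sup>2"
        unfolding sum_distrib_left[symmetric] by (intro mult_left_mono sum_le_norm_ell2) auto
      finally show ?thesis .
    qed
    then have "(norm (T N x))\<^sup>2 \<le> (sqrt (real N + 1) * norm (D x))\<^sup>2" by (simp add: power_mult_distrib)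
    then have "norm (T N x) \<le> sqrt (real N + 1) * norm (D x)" by (rule power2_le_imp_le) simp
    also have "\<dots> \<le> sqrt (real N + 1) * (norm x * \<bar>B\<bar>)"
      using order_trans[OF B mult_left_mono[OF abs_ge_self norm_ge_zero]] by (intro mult_left_mono) auto
    finally show "norm (T N x) \<le> norm x * (sqrt (real N + 1) * \<bar>B\<bar>)" by (simp add: mult_ac)
  qed
  moreover have "\<exists>C. \<forall>N. norm (T N x) \<le> C" for x
  proof -
    have "D x \<in> weighted_ell2" using range by auto
    then obtain K where "\<And>N. (norm (T N x))\<^sup>2 \<le> K" unfolding weighted_bound_iff norm by blast
    then have "norm (T N x) \<le> sqrt K" for N by (rule real_le_rsqrt)
    then show ?thesis by blast
  qed
  ultimately obtain C where C: "\<And>N x. norm (T N x) \<le> C * norm x"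
    using uniform_boundedness[of T] by blast
  have "(\<Sum>n<N. (real n + 1) * (cmod (ell2_nth (D x) n))\<^sup>2) \<le> C\<^sup>2 * (norm x)\<^sup>2" for N x
    using power_mono[OF C[of N x] norm_ge_zero, of 2] by (simp add: norm power_mult_distrib)
  then show ?thesis using that by blast
qed

section \<open>Duality between bounds on the form of \<open>D\<close> and its range\<close>

context bergman_weight
begin

text \<open>The test vector is the truncation \<open>f\<close> of \<open>D x\<close> weighted by
  \<open>real n + 1\<close>: the partial sum \<open>t\<close> equals
  \<open>D x \<bullet> f = x \<bullet> D f\<close>, and the hypothesis at \<open>f\<close> bounds
  the square of \<open>norm (D f)\<close> by a multiple of \<open>t\<close> itself. Cancelling one
  factor \<open>t\<close> leaves the bound.\<close>

lemma dual_weighted_bound: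
  assumes sym: "\<And>x y. D x \<bullet> y = x \<bullet> D y"
    and le: "\<And>x. (norm (D x))\<^sup>2 \<le> C * (\<Sum>n. (cmod (ell2_nth x n))\<^sup>2 * ((\<alpha> + 1) / (real n + \<alpha> + 2)))" and "C \<ge> 0"
  shows "\<exists>K. \<forall>x N. (\<Sum>n<N. (real n + 1) * (cmod (ell2_nth (D x) n))\<^sup>2) \<le> K * (norm x)\<^sup>2"
proof -
  define M where "M = C * (\<alpha> + 1)"
  have M: "M \<ge> 0" using \<alpha> \<open>C \<ge> 0\<close> by (simp add: M_def)
  have "(\<Sum>n<N. (real n + 1) * (cmod (ell2_nth (D x) n))\<^sup>2) \<le> M * (norm x)\<^sup>2" for x N
  proof -
    define t where "t = (\<Sum>n<N. (real n + 1) * (cmod (ell2_nth (D x) n))\<^sup>2)"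
    define f where "f = Ell2 (\<lambda>n. if n < N then (real n + 1) *\<^sub>R ell2_nth (D x) n else 0)"
    have nth: "ell2_nth f n = (if n < N then (real n + 1) *\<^sub>R ell2_nth (D x) n else 0)" for n
      unfolding f_def by (rule ell2_nth_Ell2_finite)
    have "t \<ge> 0" unfolding t_def by (intro sum_nonneg) auto
    have "D x \<bullet> f = (\<Sum>n<N. ell2_nth (D x) n \<bullet> ell2_nth f n)"
      unfolding inner_ell2_def by (rule suminf_finite) (auto simp: nth)
    also have "\<dots> = t" unfolding t_def by (intro sum.cong) (auto simp: nth power2_norm_eq_inner)
    finally have "t = x \<bullet> D f" by (simp add: sym)
    then have t: "t \<le> norm x * norm (D f)" by (simp add: norm_cauchy_schwarz)
    have "(\<Sum>n. (cmod (ell2_nth f n))\<^sup>2 * ((\<alpha> + 1) / (real n + \<alpha> + 2))) =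
      (\<Sum>n<N. (cmod (ell2_nth f n))\<^sup>2 * ((\<alpha> + 1) / (real n + \<alpha> + 2)))"
      by (rule suminf_finite) (auto simp: nth)
    also have "\<dots> \<le> (\<Sum>n<N. (\<alpha> + 1) * ((real n + 1) * (cmod (ell2_nth (D x) n))\<^sup>2))"
    proof (intro sum_mono)
      fix n assume "n \<in> {..<N}"
      then have "(cmod (ell2_nth f n))\<^sup>2 * ((\<alpha> + 1) / (real n + \<alpha> + 2))
        = (\<alpha> + 1) * ((real n + 1) * (cmod (ell2_nth (D x) n))\<^sup>2) * ((real n + 1) / (real n + \<alpha> + 2))"
        by (simp add: nth power_mult_distrib power2_eq_square[of "real n + 1"] mult_ac)
      also have "\<dots> \<le> (\<alpha> + 1) * ((real n + 1) * (cmod (ell2_nth (D x) n))\<^sup>2)"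
        using \<alpha> by (intro mult_left_le) auto
      finally show "(cmod (ell2_nth f n))\<^sup>2 * ((\<alpha> + 1) / (real n + \<alpha> + 2))
        \<le> (\<alpha> + 1) * ((real n + 1) * (cmod (ell2_nth (D x) n))\<^sup>2)" .
    qed
    also have "\<dots> = (\<alpha> + 1) * t" by (simp add: t_def sum_distrib_left)
    finally have "(norm (D f))\<^sup>2 \<le> C * ((\<alpha> + 1) * t)"
      by (intro order_trans[OF le[of f]] mult_left_mono \<open>C \<ge> 0\<close>)
    then have Df: "(norm (D f))\<^sup>2 \<le> M * t" by (simp add: M_def mult.assoc)
    have "t\<^sup>2 \<le> (norm x)\<^sup>2 * (norm (D f))\<^sup>2"
      using power_mono[OF t \<open>t \<ge> 0\<close>, of 2] by (simp add: power_mult_distrib)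
    also have "\<dots> \<le> (norm x)\<^sup>2 * (M * t)" by (intro mult_left_mono Df) simp
    finally have "t * t \<le> (M * (norm x)\<^sup>2) * t" by (simp add: power2_eq_square mult_ac)
    then show ?thesis unfolding t_def[symmetric]
      using \<open>t \<ge> 0\<close> M by (cases "t = 0") auto
  qed
  then show ?thesis by blast
qed

text \<open>The lower bound makes the functional \<open>f \<bullet> y\<close> dominated by
  \<open>norm (D f)\<close>. Representing it as \<open>D f \<bullet> h\<close> and using symmetry
  gives \<open>y = D h\<close>.\<close>

lemma weighted_subset_range:
  assumes D: "linear D" and sym: "\<And>x y. D x \<bullet> y = x \<bullet> D y"
    and ge: "\<And>x. C * (\<Sum>n. (cmod (ell2_nth x n))\<^sup>2 * ((\<alpha> + 1) / (real n + \<alpha> + 2))) \<le> (norm (D x))\<^sup>2" and "C > 0"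
  shows "weighted_ell2 \<subseteq> range D"
proof
  fix y assume y: "y \<in> weighted_ell2"
  define r where "r n = (real n + \<alpha> + 2) / (\<alpha> + 1)" for n
  have r0: "r n > 0" for n using \<alpha> by (simp add: r_def)
  have r_le: "r n \<le> (\<alpha> + 2) / (\<alpha> + 1) * (real n + 1)" for n
  proof -
    have "0 \<le> (\<alpha> + 1) * real n" using \<alpha> by simp
    then have "real n + \<alpha> + 2 \<le> (\<alpha> + 2) * (real n + 1)" by (simp add: algebra_simps)
    from divide_right_mono[OF this, of "\<alpha> + 1"] show ?thesis using \<alpha> by (simp add: r_def)
  qed
  have sum_y: "summable (\<lambda>n. r n * (cmod (ell2_nth y n))\<^sup>2)"
  proof (rule summable_comparison_test')
    show "summable (\<lambda>n. (\<alpha> + 2) / (\<alpha> + 1) * ((real n + 1) * (cmod (ell2_nth y n))\<^sup>2))"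
      using y by (intro summable_mult) (simp add: weighted_ell2_def)
    show "norm (r n * (cmod (ell2_nth y n))\<^sup>2) \<le> (\<alpha> + 2) / (\<alpha> + 1) * ((real n + 1) * (cmod (ell2_nth y n))\<^sup>2)" for n
      using mult_right_mono[OF r_le[of n], of "(cmod (ell2_nth y n))\<^sup>2"] r0[of n] by (simp add: mult.assoc)
  qed
  define G where "G = Ell2 (\<lambda>n. sqrt (r n) *\<^sub>R ell2_nth y n)"
  have G: "ell2_nth G n = sqrt (r n) *\<^sub>R ell2_nth y n" for n
    unfolding G_def using sum_y r0 by (subst Ell2_inverse) (auto simp: power_mult_distrib less_imp_le)
  have "\<bar>f \<bullet> y\<bar> \<le> norm G / sqrt C * norm (D f)" for f
  proof -
    \<comment> \<open>Weighted Cauchy-Schwarz: \<open>f \<bullet> y = E \<bullet> G\<close>, a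
      factor \<open>sqrt (r n)\<close> being moved from \<open>f\<close> to \<open>y\<close>. The
      squared norm of \<open>E\<close> is the sum in the lower bound, and \<open>G\<close> is
      square-summable because \<open>y\<close> lies in the weighted space.\<close>
    define E where "E = Ell2 (\<lambda>n. (1 / sqrt (r n)) *\<^sub>R ell2_nth f n)"
    have sq: "(cmod ((1 / sqrt (r n)) *\<^sub>R ell2_nth f n))\<^sup>2 = (cmod (ell2_nth f n))\<^sup>2 * ((\<alpha> + 1) / (real n + \<alpha> + 2))" for n
      using r0[of n] by (simp add: power_mult_distrib power_divide) (simp add: r_def)
    have E: "ell2_nth E n = (1 / sqrt (r n)) *\<^sub>R ell2_nth f n" for n
      unfolding E_def using boundary_weight_integral(3)[of f] sq by (subst Ell2_inverse) simp_all
    have "f \<bullet> y = E \<bullet> G"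
      unfolding inner_ell2_def using r0 by (simp add: E G less_imp_neq[symmetric])
    then have "\<bar>f \<bullet> y\<bar> \<le> norm E * norm G" by (simp add: Cauchy_Schwarz_ineq2)
    moreover have "norm E \<le> norm (D f) / sqrt C"
    proof -
      have "C * (norm E)\<^sup>2 \<le> (norm (D f))\<^sup>2" using ge[of f] unfolding norm_ell2_squared E sq .
      then have "(norm E)\<^sup>2 \<le> (norm (D f) / sqrt C)\<^sup>2"
        using \<open>C > 0\<close> by (simp add: power_divide pos_le_divide_eq mult.commute)
      then show ?thesis by (rule power2_le_imp_le) (use \<open>C > 0\<close> in simp)
    qed
    then have "norm E * norm G \<le> norm (D f) / sqrt C * norm G" by (intro mult_right_mono) auto
    ultimately show ?thesis by (simp add: mult.commute)
  qed
  moreover have "linear (\<lambda>f. f \<bullet> y)" by (rule linearI) (simp_all add: inner_simps)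
  ultimately obtain h where h: "\<And>f. f \<bullet> y = D f \<bullet> h"
    using functional_dominated_by_operator[OF D, of "\<lambda>f. f \<bullet> y"] by metis
  then have "f \<bullet> y = f \<bullet> D h" for f by (simp add: sym)
  then have "y = D h" by (metis vector_eq_ldot)
  then show "y \<in> range D" by simp
qed

end

section \<open>Normalised reproducing kernels\<close>


text \<open>The Hardy norm is at most the supremum norm, obtained without boundary integrals: the
  Bergman norms for exponents tending to -1 are at most 1 by normalisation, and their weights tend
  to 1 in each degree.\<close>

lemma sum_taylor_coeff_squared_le_1:
  assumes g: "g holomorphic_on disc" and le: "\<And>z. z \<in> disc \<Longrightarrow> cmod (g z) \<le> 1"
  shows "(\<Sum>n<N. (cmod (taylor_coeff g n))\<^sup>2) \<le> 1"
proof -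
  define \<beta> where "\<beta> j = - 1 + 1 / real (Suc j)" for j
  have \<beta>: "\<beta> j > -1" for j by (simp add: \<beta>_def)
  have bw: "bergman_weight (\<beta> j)" for j by (rule bergman_weight.intro[OF \<beta>])
  let ?w = "\<lambda>j n. bergman_weight.wt (\<beta> j) n"
  have "(\<Sum>n<N. ?w j n * (cmod (taylor_coeff g n))\<^sup>2) \<le> 1" for j
  proof -
    interpret bergman_weight "\<beta> j" by (rule bw)
    let ?t = "\<lambda>n. (cmod (taylor_coeff g n))\<^sup>2 * Beta (real n + 1) (\<beta> j + 1)"
    have t0: "0 \<le> ?t n" for n using \<beta>[of j] by (intro mult_nonneg_nonneg less_imp_le[OF Beta_nonneg]) auto
    have "ennreal (\<Sum>n<N. ?t n) = (\<Sum>n<N. ennreal (?t n))" using t0 by (simp add: sum_ennreal)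
    also have "\<dots> \<le> (\<Sum>n. ennreal (?t n))" by (intro sum_le_suminf) auto
    also have "\<dots> = (\<integral>\<^sup>+z. ennreal ((1 - (cmod z)\<^sup>2) powr \<beta> j * (cmod (g z))\<^sup>2) \<partial>dA)"
      by (rule parseval_dA[OF g \<beta>, symmetric])
    also have "\<dots> \<le> (\<integral>\<^sup>+z. ennreal ((1 - (cmod z)\<^sup>2) powr \<beta> j * (cmod z)\<^sup>2 ^ 0) \<partial>dA)"
    proof (rule nn_integral_mono_AE, rule AE_mp[OF AE_dA_disc], intro AE_I2 impI ennreal_leI mult_left_mono)
      fix z assume "z \<in> disc"
      from le[OF this] show "(cmod (g z))\<^sup>2 \<le> (cmod z)\<^sup>2 ^ 0" by (simp add: power_le_one)
    qed simp
    also have "\<dots> = ennreal (Beta (real 0 + 1) (\<beta> j + 1))" by (rule moment_dA[OF \<beta>])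
    finally have "(\<Sum>n<N. ?t n) \<le> Beta (real 0 + 1) (\<beta> j + 1)"
      using \<beta>[of j] by (subst (asm) ennreal_le_iff) (auto intro!: less_imp_le[OF Beta_nonneg])
    then have "(\<beta> j + 1) * (\<Sum>n<N. ?t n) \<le> wt 0" unfolding wt_def using \<beta>[of j] by (intro mult_left_mono) auto
    then show ?thesis unfolding wt_0 by (simp add: sum_distrib_left wt_def mult_ac)
  qed
  moreover have "(\<lambda>j. \<Sum>n<N. ?w j n * (cmod (taylor_coeff g n))\<^sup>2) \<longlonglongrightarrow> (\<Sum>n<N. 1 * (cmod (taylor_coeff g n))\<^sup>2)"
  proof (intro tendsto_intros)
    fix n
    have w: "?w j n = fact n / pochhammer (1 + 1 / real (Suc j)) n" for j
    proof -
      interpret bergman_weight "\<beta> j" by (rule bw)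
      have "\<beta> j + 2 = 1 + 1 / real (Suc j)" by (simp add: \<beta>_def)
      then have "1 / wt n = pochhammer (1 + 1 / real (Suc j)) n / fact n" using wt_eq[of n] by (simp only:)
      from arg_cong[OF this, of "\<lambda>x. 1 / x"] show ?thesis by simp
    qed
    have "(\<lambda>j. fact n / (\<Prod>i<n. 1 + 1 / real (Suc j) + of_nat i)) \<longlonglongrightarrow> fact n / (\<Prod>i<n. 1 + 0 + of_nat i :: real)"
      by (intro tendsto_intros LIMSEQ_Suc[OF lim_1_over_n]) (auto simp: add_pos_nonneg less_imp_neq[symmetric] intro!: less_imp_neq[symmetric])
    moreover have "(\<Prod>i<n. 1 + 0 + of_nat i) = (fact n :: real)"
      using pochhammer_fact[of n, where 'a = real] by (simp add: pochhammer_prod atLeast0LessThan)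
    ultimately show "(\<lambda>j. ?w j n) \<longlonglongrightarrow> 1"
      unfolding w by (simp add: pochhammer_prod atLeast0LessThan)
  qed
  ultimately show ?thesis by (intro tendsto_upperbound[where F = sequentially]) (auto intro: always_eventually)
qed

text \<open>Since the square sum of the Taylor coefficients is at most 1, the area mean of
  \<open>(cmod g)\<^sup>2\<close> is at most \<open>((cmod (g 0))\<^sup>2 + 1) / 2\<close>. This replaces the Schwarz-Pick lemma.\<close>

lemma area_mean_lower_bound:
  assumes g: "g holomorphic_on disc" and le: "\<And>z. z \<in> disc \<Longrightarrow> cmod (g z) \<le> 1"
  shows "(1 - (cmod (g 0))\<^sup>2) / 2 \<le> (LINT z|dA. (if z \<in> disc then 1 - (cmod (g z))\<^sup>2 else 0))"
proof -
  let ?g = "\<lambda>z. if z \<in> disc then g z else 0"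
  have gm: "(\<lambda>z. (cmod (?g z))\<^sup>2) \<in> borel_measurable borel"
    by (intro borel_measurable_power measurable_compose[OF borel_measurable_disc_indicator[OF g] borel_measurable_norm])
  have int: "integrable dA (\<lambda>z. (cmod (?g z))\<^sup>2)"
    by (rule integrable_dA_bounded[OF gm, where B = 1]) (auto simp: power_le_one le)
  interpret bergman_weight 0 by unfold_locales simp
  have Beta: "Beta (real n + 1) (0 + 1) = 1 / (real n + 1)" for n
  proof -
    have "wt n = 1 / (real n + 1)"
    proof (induction n)
      case (Suc n)
      then show ?case using wt_Suc[of n] by (simp add: field_simps)
    qed (simp add: wt_0)
    then show ?thesis by (simp add: wt_def)
  qed
  let ?b = "\<lambda>n. (cmod (taylor_coeff g n))\<^sup>2"
  \<comment> \<open>The weight 1 / (n + 1) is at most 1/2 except at \<open>n = 0\<close>, where the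
    missing half is added back.\<close>
  have part: "(\<Sum>n<N. ?b n * Beta (real n + 1) (0 + 1)) \<le> (1 + (cmod (g 0))\<^sup>2) / 2" for N
  proof -
    have "(\<Sum>n<N. ?b n * Beta (real n + 1) (0 + 1)) \<le> (\<Sum>n<N. ?b n * (1 / 2) + (if n = 0 then ?b 0 / 2 else 0))"
    proof (intro sum_mono)
      fix n
      show "?b n * Beta (real n + 1) (0 + 1) \<le> ?b n * (1 / 2) + (if n = 0 then ?b 0 / 2 else 0)"
      proof (cases "n = 0")
        case False
        then have "1 / (real n + 1) \<le> 1 / 2" by (intro divide_left_mono) auto
        then show ?thesis unfolding Beta using False mult_left_mono[of "1 / (real n + 1)" "1 / 2" "?b n"] by simp
      qed (use Beta[of 0] in simp)
    qed
    also have "\<dots> \<le> 1 / 2 + ?b 0 / 2"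
    proof -
      have "(\<Sum>n<N. ?b n) \<le> 1" by (rule sum_taylor_coeff_squared_le_1[OF g le])
      then have "(\<Sum>n<N. ?b n * (1 / 2)) \<le> 1 / 2" unfolding sum_distrib_right[symmetric] by linarith
      moreover have "(\<Sum>n<N. if n = 0 then ?b 0 / 2 else 0) \<le> ?b 0 / 2" by (simp add: sum.delta)
      ultimately show ?thesis by (simp only: sum.distrib add_mono)
    qed
    also have "\<dots> = (1 + (cmod (g 0))\<^sup>2) / 2" by (simp add: field_simps)
    finally show ?thesis .
  qed
  have "ennreal (LINT z|dA. (cmod (?g z))\<^sup>2) = (\<integral>\<^sup>+z. ennreal ((cmod (?g z))\<^sup>2) \<partial>dA)"
    by (rule nn_integral_eq_integral[OF int, symmetric]) simp
  also have "\<dots> = (\<integral>\<^sup>+z. ennreal ((1 - (cmod z)\<^sup>2) powr 0 * (cmod (g z))\<^sup>2) \<partial>dA)"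
    by (rule nn_integral_cong_AE, rule AE_mp[OF AE_dA_disc]) (auto simp: abs_square_eq_1)
  also have "\<dots> = (\<Sum>n. ennreal (?b n * Beta (real n + 1) (0 + 1)))" by (rule parseval_dA[OF g]) simp
  also have "\<dots> \<le> ennreal ((1 + (cmod (g 0))\<^sup>2) / 2)"
  proof (rule suminf_le_const)
    fix N
    have "(\<Sum>n<N. ennreal (?b n * Beta (real n + 1) (0 + 1))) = ennreal (\<Sum>n<N. ?b n * Beta (real n + 1) (0 + 1))"
      by (rule sum_ennreal) (unfold Beta, simp)
    also have "\<dots> \<le> ennreal ((1 + (cmod (g 0))\<^sup>2) / 2)" by (rule ennreal_leI[OF part])
    finally show "(\<Sum>n<N. ennreal (?b n * Beta (real n + 1) (0 + 1))) \<le> ennreal ((1 + (cmod (g 0))\<^sup>2) / 2)" .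
  qed simp
  finally have upper: "(LINT z|dA. (cmod (?g z))\<^sup>2) \<le> (1 + (cmod (g 0))\<^sup>2) / 2"
    by (subst (asm) ennreal_le_iff) auto
  have "measure dA UNIV = 1" by (simp add: measure_def emeasure_dA emeasure_disc_of_radius)
  then have "(LINT z|dA. 1 - (cmod (?g z))\<^sup>2) = 1 - (LINT z|dA. (cmod (?g z))\<^sup>2)"
    by (subst Bochner_Integration.integral_diff[OF _ int]) auto
  moreover have "(LINT z|dA. 1 - (cmod (?g z))\<^sup>2) = (LINT z|dA. (if z \<in> disc then 1 - (cmod (g z))\<^sup>2 else 0))"
  proof (rule integral_cong_AE)
    show "(\<lambda>z. 1 - (cmod (?g z))\<^sup>2) \<in> borel_measurable dA" using gm by simp
    have "(\<lambda>z. indicator disc z * (1 - (cmod (?g z))\<^sup>2)) \<in> borel_measurable borel"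
      by (intro borel_measurable_times borel_measurable_diff gm borel_measurable_indicator) auto
    also have "(\<lambda>z. indicator disc z * (1 - (cmod (?g z))\<^sup>2)) = (\<lambda>z. if z \<in> disc then 1 - (cmod (g z))\<^sup>2 else 0)"
      by (auto simp: indicator_def)
    finally show "(\<lambda>z. if z \<in> disc then 1 - (cmod (g z))\<^sup>2 else 0) \<in> borel_measurable dA" by simp
    show "AE z in dA. 1 - (cmod (?g z))\<^sup>2 = (if z \<in> disc then 1 - (cmod (g z))\<^sup>2 else 0)"
      using AE_dA_disc by eventually_elim simp
  qed
  ultimately show ?thesis using upper by (simp add: field_simps)
qed

lemma nn_integral_ball_affine:
  assumes [measurable]: "h \<in> borel_measurable (borel :: complex measure)" and "r > 0"
  shows "(\<integral>\<^sup>+z. h z * indicator (ball a r) z \<partial>lborel)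
    = ennreal (r\<^sup>2) * (\<integral>\<^sup>+w. h (a + r *\<^sub>R w) * indicator disc w \<partial>lborel)"
proof -
  have m [measurable]: "(\<lambda>w::complex. a + r *\<^sub>R w) \<in> borel_measurable borel"
    by (intro borel_measurable_continuous_onI continuous_intros)
  have gm: "(\<lambda>w. h (a + r *\<^sub>R w) * indicator disc w) \<in> borel_measurable borel"
    by (intro borel_measurable_times_ennreal measurable_compose[OF m assms(1)] borel_measurable_indicator) simp
  have fm: "(\<lambda>z. h z * indicator (ball a r) z) \<in> borel_measurable borel"
    by (intro borel_measurable_times_ennreal assms(1) borel_measurable_indicator) simp
  have "(\<integral>\<^sup>+z. h z * indicator (ball a r) z \<partial>lborel) = (\<integral>\<^sup>+z. h z * indicator (ball a r) z
      \<partial>density (distr lborel borel (\<lambda>w. a + r *\<^sub>R w)) (\<lambda>_. ennreal (\<bar>r\<bar> ^ DIM(complex))))"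
    using \<open>r > 0\<close> by (intro arg_cong2[where f = nn_integral, OF _ refl] lborel_affine) simp
  also have "\<dots> = (\<integral>\<^sup>+z. ennreal (\<bar>r\<bar> ^ DIM(complex)) * (h z * indicator (ball a r) z)
      \<partial>distr lborel borel (\<lambda>w. a + r *\<^sub>R w))"
    using fm by (intro nn_integral_density) simp_all
  also have "\<dots> = (\<integral>\<^sup>+w. ennreal (\<bar>r\<bar> ^ DIM(complex)) *
      (h (a + r *\<^sub>R w) * indicator (ball a r) (a + r *\<^sub>R w)) \<partial>lborel)"
    using fm m by (intro nn_integral_distr) simp_all
  also have "\<dots> = (\<integral>\<^sup>+w. ennreal (r\<^sup>2) * (h (a + r *\<^sub>R w) * indicator disc w) \<partial>lborel)"
    using \<open>r > 0\<close> by (intro nn_integral_cong) (auto simp: indicator_def dist_norm)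
  also have "\<dots> = ennreal (r\<^sup>2) * (\<integral>\<^sup>+w. h (a + r *\<^sub>R w) * indicator disc w \<partial>lborel)"
    by (rule nn_integral_cmult) (use gm in simp)
  finally show ?thesis .
qed

lemma norm_powr_of_real: "z \<noteq> 0 \<Longrightarrow> cmod (z powr of_real r) = cmod z powr r"
  by (simp add: powr_def exp_Reals_eq)

context bergman_weight
begin

text \<open>Coordinates of the normalised kernel, the function (1 - |a|^2)^((\<alpha> + 2) / 2) / (1
  - cnj a * z)^(\<alpha> + 2) of z.\<close>

definition unit_kernel :: "complex \<Rightarrow> ell2" where
  "unit_kernel a = Ell2 (\<lambda>n. of_real ((1 - (cmod a)\<^sup>2) powr ((\<alpha> + 2) / 2) / sqrt (wt n)) * cnj a ^ n)"

lemma unit_kernel_sums: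
  assumes "a \<in> disc"
  shows "(\<lambda>n. (cmod (of_real ((1 - (cmod a)\<^sup>2) powr ((\<alpha> + 2) / 2) / sqrt (wt n)) * cnj a ^ n))\<^sup>2) sums 1"
proof -
  let ?x = "(cmod a)\<^sup>2"
  have x: "0 \<le> ?x" "?x < 1" using assms by (auto simp: abs_square_less_1)
  have "(\<lambda>n. of_real (1 / wt n) * (of_real ?x) ^ n) sums ((1 - of_real ?x) powr of_real (- (\<alpha> + 2)) :: complex)"
    using x by (intro kernel_sums) (simp only: norm_of_real abs_of_nonneg)
  moreover have "(1 - of_real ?x :: complex) powr of_real (- (\<alpha> + 2)) = of_real ((1 - ?x) powr (- (\<alpha> + 2)))"
    using x by (subst powr_of_real[symmetric]) auto
  ultimately have "(\<lambda>n. complex_of_real (1 / wt n * ?x ^ n)) sums of_real ((1 - ?x) powr (- (\<alpha> + 2)))"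
    by (simp only: of_real_mult of_real_power)
  then have "(\<lambda>n. 1 / wt n * ?x ^ n) sums ((1 - ?x) powr (- (\<alpha> + 2)))" by (simp only: sums_of_real_iff)
  from sums_mult[OF this, of "(1 - ?x) powr (\<alpha> + 2)"]
  have "(\<lambda>n. (1 - ?x) powr (\<alpha> + 2) * (1 / wt n * ?x ^ n)) sums 1"
    using x by (simp only: powr_add[symmetric]) simp
  moreover have "(cmod (of_real ((1 - ?x) powr ((\<alpha> + 2) / 2) / sqrt (wt n)) * cnj a ^ n))\<^sup>2
    = (1 - ?x) powr (\<alpha> + 2) * (1 / wt n * ?x ^ n)" for n
  proof -
    have "((1 - ?x) powr ((\<alpha> + 2) / 2))\<^sup>2 = (1 - ?x) powr (\<alpha> + 2)"
      by (simp add: power2_eq_square flip: powr_add)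
    then show ?thesis using wt_pos[of n]
      by (simp add: norm_mult norm_power norm_divide power_mult_distrib power_divide power_mult[symmetric] mult.commute)
  qed
  ultimately show ?thesis by simp
qed

lemma nth_unit_kernel:
  assumes "a \<in> disc"
  shows "ell2_nth (unit_kernel a) n = of_real ((1 - (cmod a)\<^sup>2) powr ((\<alpha> + 2) / 2) / sqrt (wt n)) * cnj a ^ n"
  unfolding unit_kernel_def using unit_kernel_sums[OF assms] by (subst Ell2_inverse) (auto simp: sums_iff)

lemma norm_unit_kernel: "a \<in> disc \<Longrightarrow> norm (unit_kernel a) = 1"
proof -
  assume a: "a \<in> disc"
  have "(norm (unit_kernel a))\<^sup>2 = 1"
    unfolding norm_ell2_squared nth_unit_kernel[OF a] by (rule sums_unique[OF unit_kernel_sums[OF a], symmetric])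
  then show ?thesis by (simp add: power2_eq_1_iff) (metis norm_ge_zero not_one_le_zero neg_0_le_iff_le)
qed

lemma Psi_unit_kernel:
  assumes a: "a \<in> disc" and z: "z \<in> disc"
  shows "(cmod (Psi (unit_kernel a) z))\<^sup>2 = (1 - (cmod a)\<^sup>2) powr (\<alpha> + 2) * cmod (1 - cnj a * z) powr (- 2 * (\<alpha> + 2))"
proof -
  let ?s = "(1 - (cmod a)\<^sup>2) powr ((\<alpha> + 2) / 2)"
  have lt: "cmod (cnj a * z) < 1"
    using a z mult_strict_mono[of "cmod a" 1 "cmod z" 1] by (simp add: norm_mult)
  then have nz: "1 - cnj a * z \<noteq> 0" by auto
  have "ell2_nth (unit_kernel a) n / of_real (sqrt (wt n)) * z ^ n = of_real ?s * (of_real (1 / wt n) * (cnj a * z) ^ n)" for n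
  proof -
    have "complex_of_real (?s / sqrt (wt n)) / of_real (sqrt (wt n)) = of_real ?s * of_real (1 / wt n)"
      using wt_pos[of n] by (simp flip: of_real_divide of_real_mult)
    then show ?thesis unfolding nth_unit_kernel[OF a] by (simp add: power_mult_distrib mult_ac)
  qed
  then have "(\<lambda>n. of_real ?s * (of_real (1 / wt n) * (cnj a * z) ^ n)) sums Psi (unit_kernel a) z"
    using Psi_sums[OF z, of "unit_kernel a"] by simp
  moreover have "(\<lambda>n. of_real ?s * (of_real (1 / wt n) * (cnj a * z) ^ n)) sums (of_real ?s * (1 - cnj a * z) powr of_real (- (\<alpha> + 2)))"
    by (intro sums_mult kernel_sums lt)
  ultimately have "Psi (unit_kernel a) z = of_real ?s * (1 - cnj a * z) powr of_real (- (\<alpha> + 2))"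
    by (rule sums_unique2)
  then have "cmod (Psi (unit_kernel a) z) = ?s * cmod (1 - cnj a * z) powr (- (\<alpha> + 2))"
    by (simp only: norm_mult norm_of_real norm_powr_of_real[OF nz]) simp
  moreover have "?s\<^sup>2 = (1 - (cmod a)\<^sup>2) powr (\<alpha> + 2)" by (simp add: power2_eq_square flip: powr_add)
  moreover have "(cmod (1 - cnj a * z) powr (- (\<alpha> + 2)))\<^sup>2 = cmod (1 - cnj a * z) powr (- 2 * (\<alpha> + 2))"
    by (simp add: power2_eq_square flip: powr_add)
  ultimately show ?thesis by (simp only: power_mult_distrib)
qed

text \<open>The product of three lower bounds: the normalising factor of the measure; the comparison
  of (1 - |z|^2) powr \<alpha> with (1 - |a|) powr \<alpha>, where \<open>min\<close> covers either
  sign of \<alpha>; and the bound 3 (1 - |a|) for the kernel's denominator.\<close>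

definition kernel_const :: real where
  "kernel_const = (\<alpha> + 1) * (min ((1/2) powr \<alpha>) (3 powr \<alpha>) * 3 powr (- 2 * (\<alpha> + 2)))"

lemma kernel_const_pos: "kernel_const > 0"
  using \<alpha> by (simp add: kernel_const_def)

text \<open>With d = 1 - |a| and z within d / 2 of a, both 1 - |z|^2 and |1 - cnj a * z| are at most
  3 d, and the former is at least d / 2. The exponents of d add up to -2, the reciprocal of the area
  scale.\<close>

lemma unit_kernel_local_lower_bound:
  assumes a: "a \<in> disc" and z: "z \<in> ball a ((1 - cmod a) / 2)"
  shows "z \<in> disc" "kernel_const / (1 - cmod a)\<^sup>2 \<le> (\<alpha> + 1) * ((1 - (cmod z)\<^sup>2) powr \<alpha> * (cmod (Psi (unit_kernel a) z))\<^sup>2)"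
proof -
  define d where "d = 1 - cmod a"
  have d: "d > 0" using a by (simp add: d_def)
  have za: "cmod (z - a) < d / 2" using z by (simp add: d_def dist_norm norm_minus_commute)
  have zle: "cmod z \<le> cmod a + cmod (z - a)" using norm_triangle_ineq[of a "z - a"] by simp
  have zge: "cmod a - cmod (z - a) \<le> cmod z" using norm_triangle_ineq2[of a "a - z"] by (simp add: norm_minus_commute)
  have z1: "d / 2 \<le> 1 - cmod z" and z2: "1 - cmod z \<le> 3 / 2 * d"
    using zle zge za by (auto simp: d_def)
  show zd: "z \<in> disc" using z1 d by simp
  define t where "t = 1 - (cmod z)\<^sup>2"
  have t: "t = (1 - cmod z) * (1 + cmod z)" by (simp add: t_def power2_eq_square algebra_simps)
  have "(1 - cmod z) * 1 \<le> (1 - cmod z) * (1 + cmod z)" using zd by (intro mult_left_mono) auto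
  then have t1: "d / 2 \<le> t" unfolding t mult_1_right by (rule order_trans[OF z1])
  have "(1 - cmod z) * (1 + cmod z) \<le> (3 / 2 * d) * 2" using z2 zd d by (intro mult_mono) auto
  then have t2: "t \<le> 3 * d" unfolding t by simp
  have tp: "min ((1/2) powr \<alpha>) (3 powr \<alpha>) * d powr \<alpha> \<le> t powr \<alpha>"
  proof (cases "\<alpha> \<ge> 0")
    case True
    have "min ((1/2) powr \<alpha>) (3 powr \<alpha>) * d powr \<alpha> \<le> (1/2) powr \<alpha> * d powr \<alpha>" by (intro mult_right_mono) auto
    also have "\<dots> = (d / 2) powr \<alpha>" using d by (simp add: powr_mult[symmetric])
    also have "\<dots> \<le> t powr \<alpha>" using d t1 True by (intro powr_mono2) auto
    finally show ?thesis .
  next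
    case False
    have "min ((1/2) powr \<alpha>) (3 powr \<alpha>) * d powr \<alpha> \<le> 3 powr \<alpha> * d powr \<alpha>" by (intro mult_right_mono) auto
    also have "\<dots> = (3 * d) powr \<alpha>" using d by (simp add: powr_mult)
    also have "\<dots> \<le> t powr \<alpha>" using d t1 t2 False by (intro powr_mono2') auto
    finally show ?thesis .
  qed
  have den: "cmod (1 - cnj a * z) \<le> 3 * d"
  proof -
    \<comment> \<open>Expansion of the denominator around \<open>z = a\<close>; the two terms
      contribute at most \<open>2 * d\<close> and \<open>d / 2\<close>.\<close>
    have "1 - cnj a * z = of_real (1 - (cmod a)\<^sup>2) - cnj a * (z - a)"
      unfolding of_real_diff complex_norm_square by (simp add: algebra_simps)
    then have "cmod (1 - cnj a * z) \<le> \<bar>1 - (cmod a)\<^sup>2\<bar> + cmod a * cmod (z - a)"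
      using norm_triangle_ineq4[of "of_real (1 - (cmod a)\<^sup>2)" "cnj a * (z - a)"]
      by (simp only: norm_of_real norm_mult complex_mod_cnj)
    also have "\<bar>1 - (cmod a)\<^sup>2\<bar> = d * (1 + cmod a)"
      using a by (simp add: d_def power2_eq_square algebra_simps abs_square_le_1 mult_le_one)
    also have "\<dots> \<le> d * 2" using d a by (intro mult_left_mono) auto
    also have "cmod a * cmod (z - a) \<le> 1 * (d / 2)" using a za by (intro mult_mono) auto
    finally show ?thesis using d by simp
  qed
  have nz: "0 < cmod (1 - cnj a * z)" using a zd mult_strict_mono[of "cmod a" 1 "cmod z" 1]
    by (auto simp: norm_mult dest!: arg_cong[of _ _ cmod])
  have "d powr (\<alpha> + 2) * (3 powr (- 2 * (\<alpha> + 2)) * d powr (- 2 * (\<alpha> + 2))) \<le> (cmod (Psi (unit_kernel a) z))\<^sup>2"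
    unfolding Psi_unit_kernel[OF a zd]
  proof (rule mult_mono)
    have "d \<le> 1 - (cmod a)\<^sup>2" using a by (simp add: d_def power2_eq_square mult_left_le)
    then show "d powr (\<alpha> + 2) \<le> (1 - (cmod a)\<^sup>2) powr (\<alpha> + 2)" using \<alpha> d by (intro powr_mono2) auto
    have "3 powr (- 2 * (\<alpha> + 2)) * d powr (- 2 * (\<alpha> + 2)) = (3 * d) powr (- 2 * (\<alpha> + 2))" using d by (simp add: powr_mult)
    also have "\<dots> \<le> cmod (1 - cnj a * z) powr (- 2 * (\<alpha> + 2))" using \<alpha> den nz by (intro powr_mono2') auto
    finally show "3 powr (- 2 * (\<alpha> + 2)) * d powr (- 2 * (\<alpha> + 2)) \<le> cmod (1 - cnj a * z) powr (- 2 * (\<alpha> + 2))" .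
  qed auto
  from mult_mono[OF tp this]
  have product: "(min ((1/2) powr \<alpha>) (3 powr \<alpha>) * d powr \<alpha>) * (d powr (\<alpha> + 2) * (3 powr (- 2 * (\<alpha> + 2)) * d powr (- 2 * (\<alpha> + 2))))
    \<le> t powr \<alpha> * (cmod (Psi (unit_kernel a) z))\<^sup>2" by simp
  have power: "d powr \<alpha> * (d powr (\<alpha> + 2) * d powr (- 2 * (\<alpha> + 2))) = 1 / d\<^sup>2"
  proof -
    have "d powr \<alpha> * (d powr (\<alpha> + 2) * d powr (- 2 * (\<alpha> + 2))) = d powr (- 2)" by (simp add: algebra_simps flip: powr_add)
    also have "\<dots> = 1 / d\<^sup>2" using d by (simp add: powr_minus_divide)
    finally show ?thesis .
  qed
  have rearrange: "(m * u) * (v * (c * w)) = m * c * (u * (v * w))" for m u v c w :: real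
    by (simp only: mult_ac)
  have "min ((1/2) powr \<alpha>) (3 powr \<alpha>) * 3 powr (- 2 * (\<alpha> + 2)) * (1 / d\<^sup>2) \<le> t powr \<alpha> * (cmod (Psi (unit_kernel a) z))\<^sup>2"
    using product unfolding rearrange[of "min ((1/2) powr \<alpha>) (3 powr \<alpha>)" "d powr \<alpha>" "d powr (\<alpha> + 2)"
      "3 powr (- 2 * (\<alpha> + 2))" "d powr (- 2 * (\<alpha> + 2))"] power .
  from mult_left_mono[OF this, of "\<alpha> + 1"] show "kernel_const / (1 - cmod a)\<^sup>2 \<le> (\<alpha> + 1) * ((1 - (cmod z)\<^sup>2) powr \<alpha> * (cmod (Psi (unit_kernel a) z))\<^sup>2)"
    using \<alpha> by (simp add: kernel_const_def t_def d_def mult.assoc)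
qed

end

section \<open>The equivalences\<close>


context bergman_symbol
begin

abbreviation defect_form :: "ell2 \<Rightarrow> real" where
  "defect_form x \<equiv> (LINT z|dA_weighted \<alpha>. (1 - (cmod (\<phi> z))\<^sup>2) * (cmod (Psi x z))\<^sup>2)"

text \<open>The form is restricted to the disc of radius \<open>r\<close> around \<open>a\<close>,
  where the kernel density is bounded below, and rescaled to the unit disc; the area mean estimate
  for \<open>g\<close> then compares with the value at the centre. The 8 is 4 from the square of
  \<open>r\<close> times 2 from the mean estimate.\<close>

lemma defect_form_unit_kernel_lower_bound:
  assumes a: "a \<in> disc"
  shows "kernel_const / 8 * (1 - (cmod (\<phi> a))\<^sup>2) \<le> defect_form (unit_kernel a)"
proof -
  define r where "r = (1 - cmod a) / 2"
  have r: "r > 0" using a by (simp add: r_def)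
  have ball: "ball a r \<subseteq> disc" using unit_kernel_local_lower_bound(1)[OF a] by (auto simp: r_def)
  define F where "F z = (1 - (cmod (\<phi> z))\<^sup>2) * (cmod (Psi (unit_kernel a) z))\<^sup>2" for z
  define u where "u z = (if z \<in> disc then 1 - (cmod (\<phi> z))\<^sup>2 else 0)" for z
  have u0: "0 \<le> u z" for z using \<phi>_le_1 by (simp add: u_def power_le_one)
  have "(\<lambda>z. indicator disc z - (cmod (if z \<in> disc then \<phi> z else 0))\<^sup>2) \<in> borel_measurable borel"
    by (intro borel_measurable_diff borel_measurable_indicator borel_measurable_power
        measurable_compose[OF borel_measurable_disc_indicator[OF \<phi>_holomorphic] borel_measurable_norm]) simp
  also have "(\<lambda>z. indicator disc z - (cmod (if z \<in> disc then \<phi> z else 0))\<^sup>2) = u"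
    by (auto simp: u_def indicator_def)
  finally have um [measurable]: "u \<in> borel_measurable borel" .
  have int: "integrable (dA_weighted \<alpha>) F" unfolding F_def[abs_def] by (rule norm_diff_mult_ell2(1))
  then have Fm [measurable]: "F \<in> borel_measurable borel" by (auto dest: borel_measurable_integrable)
  have Fu: "F z = u z * (cmod (Psi (unit_kernel a) z))\<^sup>2" for z by (simp add: F_def u_def Psi_def)
  then have F0: "0 \<le> F z" for z using u0 by simp
  have Psi_m [measurable]: "Psi (unit_kernel a) \<in> borel_measurable borel" using Psi_analytic by measurable
  define g where "g w = \<phi> (a + r *\<^sub>R w)" for w
  have aff: "a + r *\<^sub>R w \<in> disc" if "w \<in> disc" for w
  proof -
    have "a + r *\<^sub>R w \<in> ball a r" using that r by (simp add: dist_norm)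
    then show ?thesis using ball by blast
  qed
  have g: "g holomorphic_on disc"
    unfolding g_def[abs_def] scaleR_conv_of_real
    by (rule holomorphic_on_compose_gen[OF _ \<phi>_holomorphic, unfolded o_def])
      (use aff in \<open>auto intro!: holomorphic_intros simp: scaleR_conv_of_real\<close>)
  have g1: "cmod (g w) \<le> 1" if "w \<in> disc" for w unfolding g_def by (intro \<phi>_le_1 aff that)
  let ?K = "kernel_const / (1 - cmod a)\<^sup>2"
  have K0: "?K \<ge> 0" using kernel_const_pos by simp
  have affm [measurable]: "(\<lambda>w::complex. a + r *\<^sub>R w) \<in> borel_measurable borel"
    by (intro borel_measurable_continuous_onI continuous_intros)
  have "ennreal (LINT w|dA. (if w \<in> disc then 1 - (cmod (g w))\<^sup>2 else 0))
    = ennreal (LINT w|dA. u (a + r *\<^sub>R w) * indicator disc w)"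
    using aff by (intro arg_cong[of _ _ ennreal] Bochner_Integration.integral_cong)
      (auto simp: u_def g_def indicator_def simp del: mem_ball)
  also have "\<dots> = (\<integral>\<^sup>+w. ennreal (u (a + r *\<^sub>R w) * indicator disc w) \<partial>dA)"
  proof (rule nn_integral_eq_integral[symmetric])
    show "integrable dA (\<lambda>w. u (a + r *\<^sub>R w) * indicator disc w)"
    proof (rule integrable_dA_bounded[where B = 1])
      show "norm (u (a + r *\<^sub>R w) * indicator disc w) \<le> 1" for w
        using u0[of "a + r *\<^sub>R w"] by (auto simp: u_def indicator_def abs_le_iff)
    qed (intro borel_measurable_times measurable_compose[OF affm um] borel_measurable_indicator, simp)
  qed (use u0 in auto)
  also have "\<dots> = (\<integral>\<^sup>+w. ennreal (u (a + r *\<^sub>R w)) * indicator disc w \<partial>lborel) / ennreal pi"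
    by (subst nn_integral_dA)
      (auto intro!: arg_cong2[of _ _ _ _ "(/)"] nn_integral_cong measurable_compose[OF affm um] simp: indicator_def)
  finally have avg: "ennreal (LINT w|dA. (if w \<in> disc then 1 - (cmod (g w))\<^sup>2 else 0))
    = (\<integral>\<^sup>+w. ennreal (u (a + r *\<^sub>R w)) * indicator disc w \<partial>lborel) / ennreal pi" .
  have pointwise: "ennreal ?K * (ennreal (u z) * indicator (ball a r) z)
    \<le> ennreal ((\<alpha> + 1) * ((1 - (cmod z)\<^sup>2) powr \<alpha> * F z)) * indicator disc z" for z
  proof (cases "z \<in> ball a r")
    case True
    have "?K * u z \<le> (\<alpha> + 1) * ((1 - (cmod z)\<^sup>2) powr \<alpha> * (cmod (Psi (unit_kernel a) z))\<^sup>2) * u z"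
      using unit_kernel_local_lower_bound(2)[OF a, of z] True u0[of z] by (intro mult_right_mono) (auto simp: r_def)
    then have "ennreal (?K * u z) \<le> ennreal ((\<alpha> + 1) * ((1 - (cmod z)\<^sup>2) powr \<alpha> * F z))"
      by (intro ennreal_leI) (simp add: Fu mult_ac)
    then show ?thesis using True ball K0 u0 by (auto simp: ennreal_mult[symmetric] subset_iff)
  qed simp
  let ?I = "\<integral>\<^sup>+w. ennreal (u (a + r *\<^sub>R w)) * indicator disc w \<partial>lborel"
  have Kr: "?K * r\<^sup>2 = kernel_const / 4" using a by (simp add: r_def power_divide)
  have bm: "(\<lambda>z. ennreal (u z) * indicator (ball a r) z) \<in> borel_measurable lborel"
    by (intro borel_measurable_times_ennreal borel_measurable_indicator) (simp_all add: um)
  have Wm: "(\<lambda>z. (1 - (cmod z)\<^sup>2) powr \<alpha> * F z) \<in> borel_measurable borel" by measurable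
  have "ennreal (kernel_const / 4 * ((1 - (cmod (g 0))\<^sup>2) / 2))
    \<le> ennreal (kernel_const / 4 * (LINT w|dA. (if w \<in> disc then 1 - (cmod (g w))\<^sup>2 else 0)))"
    using kernel_const_pos by (intro ennreal_leI mult_left_mono area_mean_lower_bound g g1) auto
  also have "\<dots> = ennreal (?K * r\<^sup>2) * (?I / ennreal pi)"
    unfolding avg[symmetric] Kr using kernel_const_pos by (intro ennreal_mult') simp
  also have "\<dots> = ennreal ?K * (ennreal (r\<^sup>2) * ?I) / ennreal pi"
    unfolding ennreal_mult''[OF zero_le_power2] by (simp only: ennreal_times_divide mult.assoc)
  also have "ennreal (r\<^sup>2) * ?I = (\<integral>\<^sup>+z. ennreal (u z) * indicator (ball a r) z \<partial>lborel)"
    by (rule nn_integral_ball_affine[OF _ r, symmetric]) (simp add: um)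
  also have "ennreal ?K * \<dots> = (\<integral>\<^sup>+z. ennreal ?K * (ennreal (u z) * indicator (ball a r) z) \<partial>lborel)"
    by (rule nn_integral_cmult[OF bm, symmetric])
  also have "\<dots> / ennreal pi \<le> (\<integral>\<^sup>+z. ennreal ((\<alpha> + 1) * ((1 - (cmod z)\<^sup>2) powr \<alpha> * F z)) * indicator disc z \<partial>lborel) / ennreal pi"
    by (intro divide_right_mono_ennreal nn_integral_mono pointwise)
  also have "\<dots> = (\<integral>\<^sup>+z. ennreal ((\<alpha> + 1) * ((1 - (cmod z)\<^sup>2) powr \<alpha> * F z)) \<partial>dA)"
    by (rule nn_integral_dA[symmetric]) (use Wm in simp)
  also have "\<dots> = (\<integral>\<^sup>+z. ennreal (\<alpha> + 1) * ennreal ((1 - (cmod z)\<^sup>2) powr \<alpha> * F z) \<partial>dA)"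
    using \<alpha> by (simp add: ennreal_mult')
  also have "\<dots> = ennreal (\<alpha> + 1) * (\<integral>\<^sup>+z. ennreal ((1 - (cmod z)\<^sup>2) powr \<alpha> * F z) \<partial>dA)"
    by (rule nn_integral_cmult) (use Wm in simp)
  also have "\<dots> = (\<integral>\<^sup>+z. ennreal (F z) \<partial>dA_weighted \<alpha>)"
    by (rule nn_integral_dA_weighted[OF Fm F0, symmetric])
  also have "\<dots> = ennreal (LINT z|dA_weighted \<alpha>. F z)"
    using F0 by (intro nn_integral_eq_integral int) simp
  finally have "kernel_const / 4 * ((1 - (cmod (g 0))\<^sup>2) / 2) \<le> (LINT z|dA_weighted \<alpha>. F z)"
    using F0 by (subst (asm) ennreal_le_iff) (auto intro!: Bochner_Integration.integral_nonneg)
  then show ?thesis by (simp add: g_def F_def)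
qed

lemma compact_imp_boundary_unimodular:
  assumes D: "bounded_linear D" and sym: "\<And>x y. D x \<bullet> y = x \<bullet> D y"
    and norm_D: "\<And>x. (norm (D x))\<^sup>2 = defect_form x"
    and compact: "compact (closure (D ` cball 0 1))"
  shows "boundary_unimodular \<phi>"
proof (rule ccontr)
  assume "\<not> boundary_unimodular \<phi>"
  then obtain e where e: "e > 0" "\<And>r. r < 1 \<Longrightarrow> \<exists>z. r \<le> cmod z \<and> cmod z < 1 \<and> cmod (\<phi> z) < 1 - e"
    unfolding boundary_unimodular_def by (auto simp: not_le)
  have "\<exists>z. 1 - 1 / real (Suc j) \<le> cmod z \<and> cmod z < 1 \<and> cmod (\<phi> z) < 1 - e" for j
    by (rule e(2)) simp
  then obtain a where a: "\<And>j. 1 - 1 / real (Suc j) \<le> cmod (a j)" "\<And>j. cmod (a j) < 1" "\<And>j. cmod (\<phi> (a j)) < 1 - e"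
    by metis
  have disc: "a j \<in> disc" for j using a(2) by simp
  have "(\<lambda>j. cmod (a j)) \<longlonglongrightarrow> 1"
  proof (rule tendsto_sandwich)
    show "(\<lambda>j. 1 - 1 / real (Suc j)) \<longlonglongrightarrow> 1"
      using tendsto_diff[OF tendsto_const LIMSEQ_Suc[OF lim_1_over_n], of 1] by simp
    show "\<forall>\<^sub>F j in sequentially. 1 - 1 / real (Suc j) \<le> cmod (a j)" by (intro always_eventually allI a(1))
    show "\<forall>\<^sub>F j in sequentially. cmod (a j) \<le> 1" by (intro always_eventually allI less_imp_le a(2))
  qed simp
  then have "(\<lambda>j. 1 - (cmod (a j))\<^sup>2) \<longlonglongrightarrow> 1 - 1\<^sup>2" by (intro tendsto_intros)
  then have "(\<lambda>j. (1 - (cmod (a j))\<^sup>2) powr ((\<alpha> + 2) / 2)) \<longlonglongrightarrow> 0 powr ((\<alpha> + 2) / 2)"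
    using \<alpha> by (intro tendsto_powr2 tendsto_const) (auto intro!: always_eventually simp: power_le_one a(2) less_imp_le)
  then have pw: "(\<lambda>j. (1 - (cmod (a j))\<^sup>2) powr ((\<alpha> + 2) / 2)) \<longlonglongrightarrow> 0" by simp
  \<comment> \<open>In a fixed coordinate the prefactor tends to 0 because its exponent is positive,
    while the power of \<open>cnj (a j)\<close> stays bounded.\<close>
  have coord: "(\<lambda>j. ell2_nth (unit_kernel (a j)) n) \<longlonglongrightarrow> 0" for n
  proof (rule Lim_null_comparison)
    show "\<forall>\<^sub>F j in sequentially. norm (ell2_nth (unit_kernel (a j)) n) \<le> (1 - (cmod (a j))\<^sup>2) powr ((\<alpha> + 2) / 2) * (1 / sqrt (wt n))"
    proof (intro always_eventually allI)
      fix j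
      have "cmod (a j) ^ n \<le> 1" using a(2)[of j] by (simp add: power_le_one)
      then have "(1 - (cmod (a j))\<^sup>2) powr ((\<alpha> + 2) / 2) / sqrt (wt n) * cmod (a j) ^ n \<le> (1 - (cmod (a j))\<^sup>2) powr ((\<alpha> + 2) / 2) / sqrt (wt n)"
        using wt_pos[of n] by (intro mult_left_le) auto
      then show "norm (ell2_nth (unit_kernel (a j)) n) \<le> (1 - (cmod (a j))\<^sup>2) powr ((\<alpha> + 2) / 2) * (1 / sqrt (wt n))"
        using wt_pos[of n] by (simp add: nth_unit_kernel[OF disc] norm_mult norm_divide norm_power)
    qed
    show "(\<lambda>j. (1 - (cmod (a j))\<^sup>2) powr ((\<alpha> + 2) / 2) * (1 / sqrt (wt n))) \<longlonglongrightarrow> 0"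
      by (rule tendsto_mult_left_zero[OF pw])
  qed
  have weak: "(\<lambda>j. unit_kernel (a j) \<bullet> y) \<longlonglongrightarrow> 0" for y
    by (rule ell2_weakly_null[where B = 1]) (simp_all add: norm_unit_kernel[OF disc] coord)
  have "D (unit_kernel (a j)) \<in> D ` cball 0 1" for j
    by (intro imageI) (simp add: norm_unit_kernel[OF disc])
  then have "\<forall>j. D (unit_kernel (a j)) \<in> closure (D ` cball 0 1)" using closure_subset by blast
  moreover have "seq_compact (closure (D ` cball 0 1))"
    using compact by (simp only: compact_eq_seq_compact_metric)
  ultimately obtain l s where s: "strict_mono s" and "((\<lambda>j. D (unit_kernel (a j))) \<circ> s) \<longlonglongrightarrow> l"
    using seq_compactE by metis
  then have l: "(\<lambda>j. D (unit_kernel (a (s j)))) \<longlonglongrightarrow> l" by (simp add: o_def)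
  \<comment> \<open>Symmetry moves \<open>D\<close> onto the fixed vector \<open>l\<close>, and the
    kernels are weakly null; so 0 is the only possible limit of the images.\<close>
  have "l \<bullet> l = 0"
  proof (rule LIMSEQ_unique)
    show "(\<lambda>j. D (unit_kernel (a (s j))) \<bullet> l) \<longlonglongrightarrow> l \<bullet> l" by (intro tendsto_intros l)
    show "(\<lambda>j. D (unit_kernel (a (s j))) \<bullet> l) \<longlonglongrightarrow> 0"
      unfolding sym using LIMSEQ_subseq_LIMSEQ[OF weak s] by (simp add: o_def)
  qed
  then have lim: "(\<lambda>j. (norm (D (unit_kernel (a (s j)))))\<^sup>2) \<longlonglongrightarrow> (norm (0::ell2))\<^sup>2"
    using l by (intro tendsto_intros) simp
  have low: "kernel_const / 8 * e \<le> (norm (D (unit_kernel (a (s j)))))\<^sup>2" for j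
  proof -
    \<comment> \<open>This converts the gap \<open>e\<close> for the modulus into the same gap for
      its square.\<close>
    have "(cmod (\<phi> (a (s j))))\<^sup>2 \<le> cmod (\<phi> (a (s j)))"
      using \<phi>_le_1[OF disc] by (simp add: power2_eq_square mult_left_le)
    then have "e \<le> 1 - (cmod (\<phi> (a (s j))))\<^sup>2" using a(3)[of "s j"] by linarith
    then have "kernel_const / 8 * e \<le> kernel_const / 8 * (1 - (cmod (\<phi> (a (s j))))\<^sup>2)"
      using kernel_const_pos by (intro mult_left_mono) auto
    also have "\<dots> \<le> (norm (D (unit_kernel (a (s j)))))\<^sup>2"
      unfolding norm_D by (rule defect_form_unit_kernel_lower_bound[OF disc])
    finally show ?thesis .
  qed
  have "kernel_const / 8 * e \<le> (norm (0::ell2))\<^sup>2"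
    by (rule LIMSEQ_le_const[OF lim]) (use low in blast)
  then show False using kernel_const_pos e(1) by (simp add: mult_le_0_iff)
qed

lemma defect_form_mono:
  assumes "\<And>z. z \<in> disc \<Longrightarrow> 1 - (cmod (\<phi> z))\<^sup>2 \<le> C * (1 - (cmod z)\<^sup>2)"
  shows "defect_form x \<le> C * (\<Sum>n. (cmod (ell2_nth x n))\<^sup>2 * ((\<alpha> + 1) / (real n + \<alpha> + 2)))"
proof -
  have "defect_form x \<le> (LINT z|dA_weighted \<alpha>. C * ((1 - (cmod z)\<^sup>2) * (cmod (Psi x z))\<^sup>2))"
  proof (rule integral_mono_AE)
    show "AE z in dA_weighted \<alpha>. (1 - (cmod (\<phi> z))\<^sup>2) * (cmod (Psi x z))\<^sup>2 \<le> C * ((1 - (cmod z)\<^sup>2) * (cmod (Psi x z))\<^sup>2)"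
      using AE_dA_weighted_disc by eventually_elim (simp only: mult.assoc[symmetric] mult_right_mono assms zero_le_power2)
  qed (intro norm_diff_mult_ell2 Bochner_Integration.integrable_mult_right boundary_weight_integral)+
  then show ?thesis by (simp add: boundary_weight_integral(2))
qed

lemma defect_form_mono':
  assumes "\<And>z. z \<in> disc \<Longrightarrow> C * (1 - (cmod z)\<^sup>2) \<le> 1 - (cmod (\<phi> z))\<^sup>2"
  shows "C * (\<Sum>n. (cmod (ell2_nth x n))\<^sup>2 * ((\<alpha> + 1) / (real n + \<alpha> + 2))) \<le> defect_form x"
proof -
  have "(LINT z|dA_weighted \<alpha>. C * ((1 - (cmod z)\<^sup>2) * (cmod (Psi x z))\<^sup>2)) \<le> defect_form x"
  proof (rule integral_mono_AE)
    show "AE z in dA_weighted \<alpha>. C * ((1 - (cmod z)\<^sup>2) * (cmod (Psi x z))\<^sup>2) \<le> (1 - (cmod (\<phi> z))\<^sup>2) * (cmod (Psi x z))\<^sup>2"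
      using AE_dA_weighted_disc by eventually_elim (simp only: mult.assoc[symmetric] mult_right_mono assms zero_le_power2)
  qed (intro norm_diff_mult_ell2 Bochner_Integration.integrable_mult_right boundary_weight_integral)+
  then show ?thesis by (simp add: boundary_weight_integral(2))
qed

text \<open>The implications run compact => Blaschke => range in the weighted space => compact. The
  bound \<open>bK\<close> yields both compactness and the range inclusion from the Blaschke
  property; equality uses in addition the lower bound on 1 - |phi|^2.\<close>

theorem main_equivalences:
  assumes k: "2 * real k + (\<alpha> - 1) > -1"
  shows "compact_operator \<alpha> (defect_operator \<alpha> \<phi>) \<longleftrightarrow> finite_blaschke \<phi>"
    and "finite_blaschke \<phi> \<longleftrightarrow> sub_bergman \<alpha> \<phi> \<subseteq> A2 k (\<alpha> - 1)"
    and "\<not> unimodular_constant \<phi> \<Longrightarrow> finite_blaschke \<phi> \<longleftrightarrow> sub_bergman \<alpha> \<phi> = A2 k (\<alpha> - 1)"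
proof -
  obtain D where D: "bounded_linear D" and sym: "\<And>x y. D x \<bullet> y = x \<bullet> D y"
    and norm_D: "\<And>x. (norm (D x))\<^sup>2 = defect_form x"
    and defect: "\<And>x. defect_operator \<alpha> \<phi> (Psi x) = Psi (D x)"
    and bdd: "bounded_operator \<alpha> (defect_operator \<alpha> \<phi>)"
    by (rule defect_operator_transfer) blast
  have inj: "inj Psi" by (metis Phi_Psi injI)
  have sub: "sub_bergman \<alpha> \<phi> = Psi ` range D" by (rule sub_bergman_eq[OF defect])
  have A2: "A2 k (\<alpha> - 1) = Psi ` weighted_ell2" by (rule A2_eq_weighted[OF k])
  have subset_iff: "sub_bergman \<alpha> \<phi> \<subseteq> A2 k (\<alpha> - 1) \<longleftrightarrow> range D \<subseteq> weighted_ell2"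
    unfolding sub A2 by (rule inj_image_subset_iff[OF inj])
  have compact_iff: "compact_operator \<alpha> (defect_operator \<alpha> \<phi>) \<longleftrightarrow> compact (closure (D ` cball 0 1))"
    by (rule compact_defect_iff[OF defect bdd])
  have ab: "finite_blaschke \<phi>" if "compact (closure (D ` cball 0 1))"
    using boundary_unimodular_imp_finite_blaschke[OF \<phi> compact_imp_boundary_unimodular[OF D sym norm_D that]] .
  have bK: "\<exists>K. \<forall>x N. (\<Sum>n<N. (real n + 1) * (cmod (ell2_nth (D x) n))\<^sup>2) \<le> K * (norm x)\<^sup>2" if fb: "finite_blaschke \<phi>"
  proof -
    obtain C where C: "C \<ge> 0" "\<And>z. z \<in> disc \<Longrightarrow> 1 - (cmod (\<phi> z))\<^sup>2 \<le> C * (1 - (cmod z)\<^sup>2)"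
      using finite_blaschke_upper[OF fb] by blast
    show ?thesis
      by (rule dual_weighted_bound[OF sym _ C(1)]) (unfold norm_D, rule defect_form_mono[OF C(2)])
  qed
  have bd: "range D \<subseteq> weighted_ell2" if "finite_blaschke \<phi>"
    using bK[OF that] unfolding image_subset_iff weighted_bound_iff by blast
  have ba: "compact (closure (D ` cball 0 1))" if "finite_blaschke \<phi>"
    using bK[OF that] weighted_bound_imp_compact[of D] by blast
  have da: "compact (closure (D ` cball 0 1))" if "range D \<subseteq> weighted_ell2"
    using range_weighted_imp_bound[OF D that] weighted_bound_imp_compact[of D] by metis
  show "compact_operator \<alpha> (defect_operator \<alpha> \<phi>) \<longleftrightarrow> finite_blaschke \<phi>"
    unfolding compact_iff using ab ba by blast
  show bd_iff: "finite_blaschke \<phi> \<longleftrightarrow> sub_bergman \<alpha> \<phi> \<subseteq> A2 k (\<alpha> - 1)"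
    unfolding subset_iff using ab bd da by blast
  assume nc: "\<not> unimodular_constant \<phi>"
  have "weighted_ell2 \<subseteq> range D" if fb: "finite_blaschke \<phi>"
  proof -
    obtain C where C: "C > 0" "\<And>z. z \<in> disc \<Longrightarrow> C * (1 - (cmod z)\<^sup>2) \<le> 1 - (cmod (\<phi> z))\<^sup>2"
      using finite_blaschke_lower[OF fb nc] by blast
    show ?thesis
      by (rule weighted_subset_range[OF bounded_linear.linear[OF D] sym _ C(1)])
        (unfold norm_D, rule defect_form_mono'[OF C(2)])
  qed
  then show "finite_blaschke \<phi> \<longleftrightarrow> sub_bergman \<alpha> \<phi> = A2 k (\<alpha> - 1)"
    using bd_iff unfolding sub A2 by blast
qed

end

theorem theorem12:
  fixes \<alpha> :: real and \<phi> :: "complex \<Rightarrow> complex" and k :: nat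
  assumes "\<alpha> > -1"
    and "\<phi> \<in> Hinf_ball"
    and "2 * real k + (\<alpha> - 1) > -1"
  shows "(compact_operator \<alpha> (defect_operator \<alpha> \<phi>) \<longleftrightarrow> finite_blaschke \<phi>) \<and>
    (finite_blaschke \<phi> \<longleftrightarrow> sub_bergman \<alpha> \<phi> \<subseteq> A2 k (\<alpha> - 1)) \<and>
    (\<not> unimodular_constant \<phi> \<longrightarrow>
      (finite_blaschke \<phi> \<longleftrightarrow> sub_bergman \<alpha> \<phi> = A2 k (\<alpha> - 1)))"
proof -
  interpret bergman_symbol \<alpha> \<phi>
    using assms(1,2) by unfold_locales
  show ?thesis
    using main_equivalences[OF assms(3)] by blast
qed

end
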